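(* Let $p$ be a prime number and $n$ a positive integer, and let $t$ be an integer with $p\nmid t$ whose residue class in $(\mathbb{Z}/p\mathbb{Z})^\times$ has order exactly $n$. Assume there is an element $\alpha\in\mathbb{Z}[\zeta_n]$ with $N_{\mathbb{Q}(\zeta_n)/\mathbb{Q}}(\alpha)=\pm p$. Let $G_{p,n}=\langle \sigma,\tau : \sigma^p=\tau^n=1,\ \tau^{-1}\sigma\tau=\sigma^t\rangle$. If $k$ is a field with $\zeta_p,\zeta_n\in k$, then $k(G_{p,n})$ is rational over $k$.
   Context: For a finite group $G$ and a field $k$, let $k(x(g):g\in G)$ be the rational function field in variables $x(g)$ indexed by $G$, with $G$ acting by $k$-automorphisms via $h\cdot x(g)=x(hg)$; then $k(G)$ denotes the fixed field of this action. $\zeta_e$ denotes a primitive $e$-th root of unity, $\mathbb{Z}[\zeta_n]$ the ring of integers of $\mathbb{Q}(\zeta_n)$, and $N_{\mathbb{Q}(\zeta_n)/\mathbb{Q}}$ the field norm. Saying $\zeta_r\in k$ includes the requirement that either $\operatorname{char}k=0$ or $\operatorname{char}k\nmid r$. Rational means purely transcendental. *)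

theory Defs
  imports
    "HOL-Algebra.Algebra"
    "HOL-Algebra.Algebraic_Closure_Type"
    "HOL-Number_Theory.Residues"
    "HOL-Library.Poly_Mapping"
    "HOL-Computational_Algebra.Fraction_Field"
    Complex_Main
begin

subsection \<open>Groups given by generators and relations\<close>

text \<open>A letter \<open>(s, False)\<close> stands for the generator \<open>s\<close> and \<open>(s, True)\<close> for its inverse;
  a relation \<open>l = r\<close> is the pair \<open>(l, r)\<close> of words.\<close>

type_synonym 's word = "('s \<times> bool) list"

inductive pres_cong :: "('s word \<times> 's word) set \<Rightarrow> 's word \<Rightarrow> 's word \<Rightarrow> bool"
  for Rel where
  refl: "pres_cong Rel u u"
| sym: "pres_cong Rel u v \<Longrightarrow> pres_cong Rel v u"
| trans: "pres_cong Rel u v \<Longrightarrow> pres_cong Rel v w \<Longrightarrow> pres_cong Rel u w"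
| cancel: "pres_cong Rel (u @ [(s, b), (s, \<not> b)] @ v) (u @ v)"
| rel: "(l, r) \<in> Rel \<Longrightarrow> pres_cong Rel (u @ l @ v) (u @ r @ v)"

definition presented_group :: "('s word \<times> 's word) set \<Rightarrow> 's word set monoid" where
  "presented_group Rel =
     \<lparr>carrier = UNIV // {(u, v). pres_cong Rel u v},
      monoid.mult = (\<lambda>A B. {w. \<exists>a\<in>A. \<exists>b\<in>B. pres_cong Rel (a @ b) w}),
      one = {w. pres_cong Rel [] w}\<rparr>"

definition word_pow :: "'s \<Rightarrow> int \<Rightarrow> 's word" where
  "word_pow s i = replicate (nat \<bar>i\<bar>) (s, i < 0)"

datatype gen = Sigma | Tau

definition metacyclic_group :: "nat \<Rightarrow> nat \<Rightarrow> int \<Rightarrow> gen word set monoid" where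
  "metacyclic_group p n t = presented_group
     {(word_pow Sigma (int p), []),
      (word_pow Tau (int n), []),
      (word_pow Tau (- 1) @ word_pow Sigma 1 @ word_pow Tau 1, word_pow Sigma t)}"

subsection \<open>Purely transcendental extensions\<close>

text \<open>The index type of the polynomials below is the field itself: the variable named \<open>b\<close>
  is evaluated at the element \<open>b\<close>.\<close>

definition alg_independent :: "'a::field set \<Rightarrow> 'a set \<Rightarrow> bool" where
  "alg_independent k B \<longleftrightarrow>
     (\<forall>P :: ('a \<Rightarrow>\<^sub>0 nat) \<Rightarrow>\<^sub>0 'a.
        (\<forall>m. Poly_Mapping.lookup P m \<in> k) \<longrightarrow>
        (\<forall>m\<in>Poly_Mapping.keys P. Poly_Mapping.keys m \<subseteq> B) \<longrightarrow>
        (\<Sum>m\<in>Poly_Mapping.keys P. Poly_Mapping.lookup P m *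
           (\<Prod>b\<in>Poly_Mapping.keys m. b ^ Poly_Mapping.lookup m b)) = 0 \<longrightarrow>
        P = 0)"

definition purely_transcendental :: "'a::field set \<Rightarrow> 'a set \<Rightarrow> bool" where
  "purely_transcendental k L \<longleftrightarrow>
     (\<exists>B. B \<subseteq> L \<and> alg_independent k B \<and> L = generate_field ring_of_type_algebra (k \<union> B))"

subsection \<open>The field \<open>k(x(g) : g \<in> G)\<close> and its fixed field\<close>

text \<open>The order on the index type is only there because the library's integral domain instance
  for polynomials asks for one.\<close>

type_synonym ('g, 'k) ratfun = "(('g \<Rightarrow>\<^sub>0 nat) \<Rightarrow>\<^sub>0 'k) fract"

definition rf_const :: "'k::field \<Rightarrow> ('g::linorder, 'k) ratfun" where
  "rf_const c = Fract (Poly_Mapping.single 0 c) 1"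

definition rf_var :: "'g::linorder \<Rightarrow> ('g, 'k::field) ratfun" where
  "rf_var g = Fract (Poly_Mapping.single (Poly_Mapping.single g 1) 1) 1"

definition group_ratfun_field :: "('g::linorder, 'm) monoid_scheme \<Rightarrow> ('g, 'k::field) ratfun set" where
  "group_ratfun_field G =
     generate_field ring_of_type_algebra (range rf_const \<union> rf_var ` carrier G)"

text \<open>For a group \<open>G\<close> and \<open>h \<in> carrier G\<close> the next set is nonempty and its members all have the
  same restriction to \<^term>\<open>group_ratfun_field G\<close>, namely the action of \<open>h\<close>; outside they are
  unconstrained.\<close>

definition group_act ::
  "('g::linorder, 'm) monoid_scheme \<Rightarrow> 'g \<Rightarrow> (('g, 'k::field) ratfun \<Rightarrow> ('g, 'k) ratfun) set" where
  "group_act G h =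
     {\<phi> \<in> ring_iso (ring_of_type_algebra\<lparr>carrier := group_ratfun_field G\<rparr>)
                   (ring_of_type_algebra\<lparr>carrier := group_ratfun_field G\<rparr>).
        (\<forall>c. \<phi> (rf_const c) = rf_const c) \<and>
        (\<forall>g\<in>carrier G. \<phi> (rf_var g) = rf_var (h \<otimes>\<^bsub>G\<^esub> g))}"

definition noether_field :: "('g::linorder, 'm) monoid_scheme \<Rightarrow> ('g, 'k::field) ratfun set" where
  "noether_field G =
     {f \<in> group_ratfun_field G. \<forall>h\<in>carrier G. \<forall>\<phi>\<in>group_act G h. \<phi> f = f}"

subsection \<open>Roots of unity and cyclotomic fields\<close>

definition primitive_root_of_unity :: "nat \<Rightarrow> 'a::field \<Rightarrow> bool" where
  "primitive_root_of_unity r z \<longleftrightarrow> z ^ r = 1 \<and> (\<forall>j. 0 < j \<and> j < r \<longrightarrow> z ^ j \<noteq> 1)"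

definition contains_zeta :: "'k::field itself \<Rightarrow> nat \<Rightarrow> bool" where
  "contains_zeta T r \<longleftrightarrow>
     (CHAR('k) = 0 \<or> \<not> CHAR('k) dvd r) \<and> (\<exists>z::'k. primitive_root_of_unity r z)"

definition cyclotomic_field :: "nat \<Rightarrow> complex set" where
  "cyclotomic_field n = generate_field ring_of_type_algebra {cis (2 * pi / real n)}"

text \<open>The ring \<open>\<int>[\<zeta>\<^sub>n]\<close>, as the ring of integers of \<open>\<rat>(\<zeta>\<^sub>n)\<close>.\<close>

definition cyclotomic_integers :: "nat \<Rightarrow> complex set" where
  "cyclotomic_integers n = {\<alpha> \<in> cyclotomic_field n. algebraic_int \<alpha>}"

text \<open>The norm from a number field \<open>F \<subseteq> \<complex>\<close> to \<open>\<rat>\<close>: the product of the images under all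
  embeddings of \<open>F\<close> into the complex numbers.  Embeddings are taken to be undefined outside \<open>F\<close>
  so that each of them is counted once.\<close>

definition embeddings :: "complex set \<Rightarrow> (complex \<Rightarrow> complex) set" where
  "embeddings F = ring_hom (ring_of_type_algebra\<lparr>carrier := F\<rparr>) ring_of_type_algebra \<inter> extensional F"

definition field_norm :: "complex set \<Rightarrow> complex \<Rightarrow> complex" where
  "field_norm F \<alpha> = (\<Prod>\<phi>\<in>embeddings F. \<phi> \<alpha>)"

end

theory Submission
  imports Defs "HOL-Number_Theory.Number_Theory"
begin

text \<open>Let \<open>L = k(x(g) : g \<in> G)\<close>. Resolvents along \<open>\<sigma>\<close> give generators \<open>Y\<^sub>a\<^sub>j\<close> of \<open>L\<close> with
  \<open>\<sigma> Y\<^sub>a\<^sub>j = \<zeta>\<^bsup>a t^j\<^esup> Y\<^sub>a\<^sub>j\<close> and \<open>\<tau> Y\<^sub>a\<^sub>j = Y\<^sub>a\<^sub>,\<^sub>j\<^sub>+\<^sub>1\<close>. After dividing by powers of the \<open>Y\<^sub>1\<^sub>j\<close>, the element \<open>\<sigma>\<close> moves only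
  \<open>y = Y\<^sub>1\<^sub>0\<close> and its conjugates, and the \<open>\<sigma>\<close>-invariant monomials in these correspond to the ideal
  \<open>(p, X - t)\<close> of \<open>\<int>[X]/(X\<^sup>n - 1)\<close>. Its image in \<open>\<int>[\<zeta>\<^sub>n]\<close> is a prime of norm \<open>p\<close>, generated by a conjugate of \<open>\<alpha>\<close>.
  The ideal itself need not be free, but the permutation modules \<open>\<int>[X]/(X\<^bsup>n/q\<^esup> - 1)\<close>, for the primes
  \<open>q\<close> dividing \<open>n\<close>, make up for the difference: they are realised by elements \<open>z\<^sub>q\<close> that are rational in the
  remaining generators, and the sum of all these modules has a permutation basis. On
  such a basis \<open>\<tau>\<close> is linearised by resolvents, which gives \<open>p n = |G|\<close> generators of the fixed field.
  Since \<open>L\<close> is algebraic over the fixed field, they are algebraically independent.\<close>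

subsection \<open>Ideals of integer polynomials\<close>

text \<open>The hypothesis on \<alpha> speaks about one factor of Q[X]/(X^n - 1), the field
  Q(\<zeta>_n). In the other factors, the fields Q(\<zeta>_d) for proper divisors d of n, a lift of
  the generator is uncontrolled; this is where freeness can fail. Every proper divisor of n divides
  some n/q with q prime, so the added modules see all of these factors. The module for q costs n/q
  of the generators. They are taken from row a = q: since n < p these rows exist, they are distinct,
  and they avoid row 1, which carries y, and row 0, which provides an eigenvector of \<tau> with
  eigenvalue \<omega>. The hypothesis concerns algebraic integers, while the construction works with
  integer polynomials. Two classical facts are therefore proved on the way: the integers of
  Q(\<zeta>_n) are integer polynomials in \<zeta>_n, and the primitive n-th roots of unity are
  conjugate.\<close>

inductive_set idl :: "'a::comm_ring_1 set \<Rightarrow> 'a set" for S where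
  zero: "0 \<in> idl S"
| step: "s \<in> S \<Longrightarrow> y \<in> idl S \<Longrightarrow> r * s + y \<in> idl S"

lemma idl_incl: "s \<in> S \<Longrightarrow> s \<in> idl S"
  using idl.step[of s S 0 1] by (simp add: idl.zero)

lemma idl_add: "x \<in> idl S \<Longrightarrow> y \<in> idl S \<Longrightarrow> x + y \<in> idl S"
  by (induction x rule: idl.induct) (auto simp: add.assoc intro: idl.step)

lemma idl_mult: "x \<in> idl S \<Longrightarrow> r * x \<in> idl S"
  by (induction x rule: idl.induct)
     (auto simp: distrib_left mult.assoc[symmetric] intro: idl.zero idl.step)

lemma idl_mult_right: "x \<in> idl S \<Longrightarrow> x * r \<in> idl S"
  using idl_mult[of x S r] by (simp add: mult.commute)

lemma idl_uminus: "x \<in> idl S \<Longrightarrow> - x \<in> idl S"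
  using idl_mult[of x S "-1"] by simp

lemma idl_diff: "x \<in> idl S \<Longrightarrow> y \<in> idl S \<Longrightarrow> x - y \<in> idl S"
  using idl_add[of x S "- y"] by (simp add: idl_uminus)

lemma idl_sum: "(\<And>i. i \<in> I \<Longrightarrow> f i \<in> idl S) \<Longrightarrow> (\<Sum>i\<in>I. f i) \<in> idl S"
  by (induction I rule: infinite_finite_induct) (auto intro: idl.zero idl_add)

lemma idl_least: "S \<subseteq> idl T \<Longrightarrow> idl S \<subseteq> idl T"
proof
  fix x assume "S \<subseteq> idl T" "x \<in> idl S"
  from this(2) show "x \<in> idl T"
    by (induction rule: idl.induct) (use \<open>S \<subseteq> idl T\<close> in \<open>auto intro: idl.zero idl_add idl_mult\<close>)
qed

lemma idl_mono: "S \<subseteq> T \<Longrightarrow> idl S \<subseteq> idl T"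
  by (rule idl_least) (auto intro: idl_incl)

lemma idl_dvd: "s \<in> idl S \<Longrightarrow> s dvd x \<Longrightarrow> x \<in> idl S"
  by (auto elim!: dvdE intro: idl_mult_right)

lemma idl_singleton_iff: "x \<in> idl {s} \<longleftrightarrow> s dvd x"
proof
  show "x \<in> idl {s} \<Longrightarrow> s dvd x" by (induction rule: idl.induct) auto
qed (auto intro: idl_dvd idl_incl)

lemma idl_insertE:
  assumes "x \<in> idl (insert a S)"
  obtains r y where "x = r * a + y" "y \<in> idl S"
proof -
  from assms have "\<exists>r y. x = r * a + y \<and> y \<in> idl S"
  proof (induction rule: idl.induct)
    case zero
    show ?case by (rule exI[of _ 0]) (auto intro: idl.zero)
  next
    case (step s y r)
    then obtain r' y' where y: "y = r' * a + y'" "y' \<in> idl S" by auto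
    show ?case
    proof (cases "s = a")
      case True
      show ?thesis by (rule exI[of _ "r + r'"], rule exI[of _ y'])
         (simp add: y True algebra_simps)
    next
      case False
      with step y show ?thesis
        by (intro exI[of _ r'] exI[of _ "r * s + y'"] conjI idl.step) (auto simp: algebra_simps)
    qed
  qed
  with that show thesis by auto
qed

lemma idl_insertI: "y \<in> idl S \<Longrightarrow> r * a + y \<in> idl (insert a S)"
  using idl_mono[of S "insert a S"] by (auto intro: idl.step)

text \<open>In the product of the two representations of 1, every term except the multiple of a * b
  lies in the ideal of S.\<close>

lemma idl_comaximal_mult:
  assumes "1 \<in> idl (insert a S)" "1 \<in> idl (insert b S)"
  shows "1 \<in> idl (insert (a * b) S)"
proof -
  obtain r x where 1: "1 = r * a + x" "x \<in> idl S" using assms(1) by (rule idl_insertE)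
  obtain s y where 2: "1 = s * b + y" "y \<in> idl S" using assms(2) by (rule idl_insertE)
  have "(1::'a) = (r * a + x) * (s * b + y)" using 1(1) 2(1) by simp
  also have "\<dots> = (r * s) * (a * b) + ((r * a + x) * y + s * b * x)" by (simp add: algebra_simps)
  also have "\<dots> \<in> idl (insert (a * b) S)"
    by (intro idl_insertI idl_add idl_mult 1 2)
  finally show ?thesis .
qed

lemma idl_comaximal_prod:
  assumes "\<And>i. i \<in> I \<Longrightarrow> 1 \<in> idl (insert (a i) S)"
  shows "1 \<in> idl (insert (\<Prod>i\<in>I. a i) S)"
  using assms
  by (induction I rule: infinite_finite_induct) (auto intro: idl_comaximal_mult idl_incl)

text \<open>\<open>gens n\<close> generates the ideal of all integer polynomials vanishing at the primitive \<open>n\<close>-th roots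
  of unity (lemma \<open>vanish_primitive_imp_idl\<close>); this avoids cyclotomic polynomials.\<close>

definition Xm1 :: "nat \<Rightarrow> int poly" where "Xm1 m = monom 1 m - 1"
text \<open>For q dividing n this is the norm element of the subgroup of order q in \<int>[X]/(X^n -
  1), the cofactor of \<open>Xm1 (n div q)\<close> in \<open>Xm1 n\<close>.\<close>

definition Npoly :: "nat \<Rightarrow> nat \<Rightarrow> int poly" where "Npoly n q = (\<Sum>i<q. monom 1 (n div q * i))"
definition gens :: "nat \<Rightarrow> int poly set" where "gens n = insert (Xm1 n) (Npoly n ` prime_factors n)"

lemma Xm1_dvd_mult: "Xm1 m dvd Xm1 (m * k)"
proof -
  have "monom (1::int) (m * k) = monom 1 m ^ k" by (simp add: monom_power)
  thus ?thesis unfolding Xm1_def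
    by (metis dvd_triv_left power_diff_1_eq)
qed

lemma Xm1_dvd: "m dvd k \<Longrightarrow> Xm1 m dvd Xm1 k"
  by (auto elim!: dvdE intro: Xm1_dvd_mult)

lemma Npoly_mult:
  assumes "q dvd n" shows "Npoly n q * Xm1 (n div q) = Xm1 n"
proof -
  have "monom (1::int) n = monom 1 (n div q) ^ q" using assms by (simp add: monom_power)
  moreover have "monom (1::int) (n div q * i) = monom 1 (n div q) ^ i" for i by (simp add: monom_power)
  ultimately show ?thesis unfolding Xm1_def Npoly_def
    by (subst mult.commute) (simp only: power_diff_1_eq)
qed

text \<open>Each of the q summands of \<open>Npoly n q\<close> is 1 modulo
  \<open>Xm1 (n div q)\<close>. On the module of q the norm element thus acts as the integer
  q.\<close>

lemma Xm1_dvd_Npoly_minus: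
  "Xm1 (n div q) dvd Npoly n q - of_nat q"
proof -
  have "Npoly n q - of_nat q = (\<Sum>i<q. Xm1 (n div q * i))"
    by (simp add: Npoly_def Xm1_def sum_subtractf)
  also have "Xm1 (n div q) dvd \<dots>" by (intro dvd_sum Xm1_dvd_mult)
  finally show ?thesis .
qed

lemma coprime_bezout_nat:
  assumes "coprime (a::nat) b" "b \<noteq> 1"
  shows "\<exists>x y. a * x = b * y + 1"
proof (cases "a = 0")
  case False
  from bezout_nat[OF False, of b] assms show ?thesis by simp
qed (use assms in auto)

lemma bezout_prime_nat:
  assumes "Factorial_Ring.prime (r::nat)" "Factorial_Ring.prime q" "q \<noteq> r"
  shows "\<exists>x y. r * x = q * y + 1"
  using assms coprime_bezout_nat[of r q] by (metis not_prime_1 primes_coprime)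

text \<open>A Bezout relation between exponents lifts to integer polynomials: with m = n/(qr) and rx
  = qy + 1, X^(rmx) - 1 is X^m - 1 plus X^m times X^(qmy) - 1, while n/q = rm and n/r = qm.\<close>

lemma Xm1_gcd_aux:
  assumes q: "Factorial_Ring.prime q" and r: "Factorial_Ring.prime r" "q \<noteq> r" and n: "q dvd n" "r dvd n"
  obtains u v where "Xm1 (n div (q * r)) = u * Xm1 (n div q) + v * Xm1 (n div r)"
proof -
  have "coprime q r" using assms by (simp add: primes_coprime)
  then obtain x y where xy: "r * x = q * y + 1"
    using bezout_prime_nat[of r q] q r by blast
  define m where "m = n div (q * r)"
  have qr: "q * r dvd n" using \<open>coprime q r\<close> n by (simp add: divides_mult)
  have nq: "n div q = r * m" "n div r = q * m"
    using qr q r unfolding m_def by (auto elim!: dvdE simp: prime_gt_0_nat)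
  have "Xm1 m = Xm1 (r * m * x) - monom 1 m * Xm1 (q * m * y)"
  proof -
    have "r * m * x = m + q * m * y" using xy by (metis add.commute distrib_left mult.assoc mult.commute mult.right_neutral)
    thus ?thesis by (simp add: Xm1_def algebra_simps mult_monom)
  qed
  moreover obtain A where "Xm1 (r * m * x) = Xm1 (r*m) * A" using Xm1_dvd_mult by blast
  moreover obtain B where "Xm1 (q * m * y) = Xm1 (q*m) * B" using Xm1_dvd_mult by blast
  ultimately have "Xm1 m = A * Xm1 (n div q) + (- monom 1 m * B) * Xm1 (n div r)"
    by (simp add: nq algebra_simps)
  thus ?thesis using that unfolding m_def by blast
qed

text \<open>In the combination of \<open>Xm1_gcd_aux\<close> the second summand becomes a multiple
  of \<open>Xm1 n\<close> after multiplication by \<open>Npoly n r\<close>. This lets the module of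
  q ignore the other primes.\<close>

lemma Xm1_dvd_Npoly_mult:
  assumes q: "Factorial_Ring.prime q" and r: "Factorial_Ring.prime r" "q \<noteq> r" and n: "q dvd n" "r dvd n"
  shows "Xm1 (n div q) dvd Npoly n r * Xm1 (n div (q * r))"
proof -
  obtain u v where uv: "Xm1 (n div (q * r)) = u * Xm1 (n div q) + v * Xm1 (n div r)"
    using Xm1_gcd_aux assms .
  have "Npoly n r * Xm1 (n div (q * r)) = Npoly n r * u * Xm1 (n div q) + v * Xm1 n"
    using Npoly_mult[OF n(2)] by (simp add: uv algebra_simps)
  thus ?thesis using Xm1_dvd[of "n div q" n] n by (auto simp: dvd_div_iff_mult)
qed

text \<open>At a primitive n-th root of unity, X^(n/(qr)) has order qr, which is no prime power, so
  1 minus it is a unit. Algebraically, modulo X^(n/(qr)) - 1 the norm elements of q and r become the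
  coprime integers q and r.\<close>

lemma one_in_idl_gens_Xm1:
  assumes q: "Factorial_Ring.prime q" and r: "Factorial_Ring.prime r" "q \<noteq> r" and n: "q dvd n" "r dvd n" "0 < n"
  shows "1 \<in> idl (insert (Xm1 (n div (q * r))) (gens n))" (is "1 \<in> ?I")
proof -
  have *: "of_nat s \<in> ?I" if "s \<in> {q, r}" for s
  proof -
    have s: "s \<in> prime_factors n" using that assms by (auto simp: in_prime_factors_iff)
    have "n div (q * r) dvd n div s"
    proof -
      have "coprime q r" using assms by (simp add: primes_coprime)
      hence "q * r dvd n" using n by (simp add: divides_mult)
      thus ?thesis using that q r by (auto elim!: dvdE simp: prime_gt_0_nat)
    qed
    hence "Xm1 (n div (q * r)) dvd Npoly n s - of_nat s"
      using Xm1_dvd Xm1_dvd_Npoly_minus dvd_trans by blast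
    hence "Npoly n s - of_nat s \<in> ?I" by (meson idl_dvd idl_incl insertI1)
    moreover have "Npoly n s \<in> ?I" using s by (intro idl_incl) (auto simp: gens_def)
    ultimately show ?thesis using idl_diff[of "Npoly n s" _ "Npoly n s - of_nat s"] by simp
  qed
  have "coprime q r" using assms by (simp add: primes_coprime)
  then obtain x y where xy: "r * x = q * y + 1"
    using bezout_prime_nat[of r q] q r by blast
  have "(1::int poly) = of_nat x * of_nat r - of_nat y * of_nat q"
    using arg_cong[OF xy, of "of_nat :: nat \<Rightarrow> int poly"] by (simp add: algebra_simps)
  also have "\<dots> \<in> ?I" by (intro idl_diff idl_mult *) auto
  finally show ?thesis .
qed

text \<open>The congruences say that the matrix with diagonal blocks \<open>a\<close>, \<open>d q\<close> and off-diagonal blocks \<open>c q\<close>,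
  \<open>W * Npoly n q\<close> is invertible enough to change the generators of the sum of the ideal
  \<open>idl (insert f (gens n))\<close> of \<open>\<int>[X]/(X\<^sup>n - 1)\<close> with the modules \<open>\<int>[X]/(X\<^bsup>n/q\<^esup> - 1)\<close> into a permutation
  basis. Multiplying by \<open>W\<close> decouples the different primes \<open>q\<close>.\<close>

lemma lattice_data:
  assumes p: "Factorial_Ring.prime p" and n: "0 < n" "coprime p n"
    and f: "of_nat p \<in> idl (insert f (gens n))"
  obtains a W :: "int poly" and c d :: "nat \<Rightarrow> int poly" where
    "a - f \<in> idl (gens n)"
    "\<And>q. q \<in> prime_factors n \<Longrightarrow> Xm1 (n div q) dvd a * d q - of_nat q * W * c q - 1"
    "\<And>q r. q \<in> prime_factors n \<Longrightarrow> r \<in> prime_factors n \<Longrightarrow> q \<noteq> r \<Longrightarrow> Xm1 (n div q) dvd Npoly n r * W"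
proof -
  define P where "P = {(q, r). q \<in> prime_factors n \<and> r \<in> prime_factors n \<and> q \<noteq> r}"
  \<comment> \<open>A unit modulo \<open>gens n\<close>, since every factor is one, although
    \<open>Npoly n r * W\<close> vanishes modulo \<open>Xm1 (n div q)\<close> whenever r \<noteq> q.
    If n has at most one prime factor, the product is empty.\<close>
  define W where "W = (\<Prod>(q, r)\<in>P. Xm1 (n div (q * r)))"
  have finP: "finite P" by (rule finite_subset[of _ "prime_factors n \<times> prime_factors n"]) (auto simp: P_def)
  have N: "Xm1 (n div q) dvd Npoly n r * W"
    if "q \<in> prime_factors n" "r \<in> prime_factors n" "q \<noteq> r" for q r
  proof -
    have "Xm1 (n div q) dvd Npoly n r * Xm1 (n div (q * r))"
      using that by (intro Xm1_dvd_Npoly_mult) (auto simp: in_prime_factors_iff)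
    moreover have "Xm1 (n div (q * r)) dvd W"
      unfolding W_def using dvd_prodI[OF finP, of "(q, r)" "\<lambda>(q, r). Xm1 (n div (q * r))"] that
      by (auto simp: P_def)
    ultimately show ?thesis by (rule dvd_trans[OF _ mult_dvd_mono[OF dvd_refl]])
  qed
  have "1 \<in> idl (insert W (gens n))"
    unfolding W_def
    by (rule idl_comaximal_prod)
       (use n in \<open>auto simp: P_def in_prime_factors_iff intro!: one_in_idl_gens_Xm1\<close>)
  then obtain w i where wi: "1 = w * W + i" "i \<in> idl (gens n)" by (rule idl_insertE)
  \<comment> \<open>The same class as f modulo \<open>gens n\<close>, but congruent to 1 modulo W,
    because 1 - i is w * W.\<close>
  define a where "a = f + i * (1 - f)"
  have aW: "1 - a = w * (1 - f) * W"
  proof -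
    have "1 - a = (1 - i) * (1 - f)" by (simp add: a_def algebra_simps)
    also have "1 - i = w * W" using wi(1) by (simp add: algebra_simps)
    finally show ?thesis by (simp add: algebra_simps)
  qed
  have af: "a - f \<in> idl (gens n)" unfolding a_def using wi by (simp add: idl_mult_right)
  have "insert f (gens n) \<subseteq> idl (insert a (gens n))"
  proof -
    have "f = 1 * a + - (a - f)" by simp
    also have "\<dots> \<in> idl (insert a (gens n))" by (intro idl_insertI idl_uminus af)
    finally show ?thesis by (auto intro: idl_incl)
  qed
  hence pa: "of_nat p \<in> idl (insert a (gens n))" using f idl_least by blast
  have "\<exists>cd. Xm1 (n div q) dvd a * snd cd - of_nat q * W * fst cd - 1"
    if q: "q \<in> prime_factors n" for q
  proof -
    \<comment> \<open>The aim is that q and W are both comaximal with a and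
      \<open>Xm1 (n div q)\<close>. For q: the ideal I contains \<open>gens n\<close>, hence p by
      the hypothesis on f, and p is prime to q.\<close>
    define I where "I = idl {of_nat q * 1, a, Xm1 (n div q)}"
    have aI: "a \<in> I" and hI: "Xm1 (n div q) \<in> I" and qI: "of_nat q \<in> I"
      unfolding I_def by (auto intro: idl_incl)
    have qn: "q dvd n" "Factorial_Ring.prime q" using q by (auto simp: in_prime_factors_iff)
    have "gens n \<subseteq> I"
    proof -
      have "Xm1 n \<in> I" using idl_dvd[OF hI[unfolded I_def], of "Xm1 n"] Xm1_dvd[of "n div q" n] qn
        by (auto simp: I_def dvd_div_iff_mult)
      moreover have "Npoly n r \<in> I" if r: "r \<in> prime_factors n" for r
      proof (cases "r = q")
        case True
        have "Npoly n q - of_nat q \<in> I"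
          using idl_dvd[OF hI[unfolded I_def] Xm1_dvd_Npoly_minus] by (simp add: I_def)
        from idl_add[OF this[unfolded I_def] qI[unfolded I_def]] show ?thesis by (simp add: True I_def)
      next
        case False
        have "Npoly n r * W \<in> I"
          using idl_dvd[OF hI[unfolded I_def] N] q r False by (simp add: I_def)
        with aI have "(w * (1 - f)) * (Npoly n r * W) + Npoly n r * a \<in> I"
          unfolding I_def by (intro idl_add[OF idl_mult idl_mult])
        also have "(w * (1 - f)) * (Npoly n r * W) + Npoly n r * a = Npoly n r * ((1 - a) + a)"
          by (simp add: aW algebra_simps)
        finally show ?thesis by simp
      qed
      ultimately show ?thesis by (auto simp: gens_def)
    qed
    hence "insert a (gens n) \<subseteq> idl {of_nat q * 1, a, Xm1 (n div q)}" using aI by (auto simp: I_def)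
    from idl_least[OF this] have pI: "of_nat p \<in> I" using pa by (auto simp: I_def)
    have "coprime p q" using coprime_divisors[OF dvd_refl qn(1) n(2)] .
    then obtain x y where xy: "p * x = q * y + 1"
      using coprime_bezout_nat[of p q] qn by (metis not_prime_1)
    have "(1::int poly) = of_nat x * of_nat p - of_nat y * of_nat q"
      using arg_cong[OF xy, of "of_nat :: nat \<Rightarrow> int poly"] by (simp add: algebra_simps)
    also have "\<dots> \<in> I" using pI qI unfolding I_def by (intro idl_diff idl_mult) auto
    finally have "1 \<in> idl (insert (of_nat q) {a, Xm1 (n div q)})" by (simp add: I_def)
    \<comment> \<open>For W this is the identity 1 = (1 - a) + a, as W divides 1 - a.\<close>
    moreover have "1 \<in> idl (insert W {a, Xm1 (n div q)})"
    proof -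
      have "(w * (1 - f)) * W + a \<in> idl (insert W {a, Xm1 (n div q)})"
        by (intro idl_insertI idl_incl) auto
      thus ?thesis by (simp add: aW[symmetric])
    qed
    ultimately have "1 \<in> idl (insert (of_nat q * W) {a, Xm1 (n div q)})"
      by (rule idl_comaximal_mult)
    then obtain c y where c: "1 = c * (of_nat q * W) + y" "y \<in> idl {a, Xm1 (n div q)}"
      by (rule idl_insertE)
    from c(2) obtain d z where d: "y = d * a + z" "z \<in> idl {Xm1 (n div q)}"
      by (rule idl_insertE)
    have "a * d - of_nat q * W * (- c) - 1 = - z" using c(1) d(1) by (simp add: algebra_simps)
    moreover have "Xm1 (n div q) dvd - z" using d(2) by (simp add: idl_singleton_iff)
    ultimately show ?thesis by (intro exI[of _ "(- c, d)"]) simp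
  qed
  hence "\<forall>q\<in>prime_factors n. \<exists>cd. Xm1 (n div q) dvd a * snd cd - of_nat q * W * fst cd - 1"
    by blast
  from bchoice[OF this] obtain cd where "\<forall>q\<in>prime_factors n.
     Xm1 (n div q) dvd a * snd (cd q) - of_nat q * W * fst (cd q) - 1" ..
  with af N show ?thesis by (intro that[of a "\<lambda>q. snd (cd q)" W "\<lambda>q. fst (cd q)"]) simp_all
qed

subsection \<open>Generated subfields and Kummer extensions\<close>

abbreviation gf :: "'a::field set \<Rightarrow> 'a set" where "gf \<equiv> generate_field ring_of_type_algebra"

lemma m_inv_ring_of_type_algebra:
  assumes "(x::'a::field) \<noteq> 0" shows "inv\<^bsub>ring_of_type_algebra\<^esub> x = inverse x"
proof -
  interpret R: Ring.field "ring_of_type_algebra :: 'a ring" by (rule field_from_type_algebra)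
  show ?thesis
    using assms by (intro R.comm_inv_char) (auto simp: ring_of_type_algebra_def)
qed

lemma gf_zero [simp]: "(0::'a::field) \<in> gf S"
proof -
  interpret R: Ring.field "ring_of_type_algebra :: 'a ring" by (rule field_from_type_algebra)
  have "S \<subseteq> carrier ring_of_type_algebra" by (simp add: ring_of_type_algebra_def)
  from R.zero_in_generate[of S] show ?thesis by (simp add: ring_of_type_algebra_def)
qed

lemma a_inv_ring_of_type_algebra: "\<ominus>\<^bsub>ring_of_type_algebra\<^esub> (x::'a::field) = - x"
proof -
  interpret R: Ring.field "ring_of_type_algebra :: 'a ring" by (rule field_from_type_algebra)
  show ?thesis
    by (intro R.minus_equality) (auto simp: ring_of_type_algebra_def)
qed

lemma gf_one [simp]: "1 \<in> gf S"
  using generate_field.one[of ring_of_type_algebra S] by (simp add: ring_of_type_algebra_def)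

lemma gf_incl: "x \<in> S \<Longrightarrow> x \<in> gf S"
  by (rule generate_field.incl)

lemma gf_uminus: "x \<in> gf S \<Longrightarrow> - x \<in> gf S"
  using generate_field.a_inv[of x ring_of_type_algebra S] by (simp add: a_inv_ring_of_type_algebra)

lemma gf_add: "x \<in> gf S \<Longrightarrow> y \<in> gf S \<Longrightarrow> x + y \<in> gf S"
  using generate_field.eng_add[of x ring_of_type_algebra S y] by (simp add: ring_of_type_algebra_def)

lemma gf_mult: "x \<in> gf S \<Longrightarrow> y \<in> gf S \<Longrightarrow> x * y \<in> gf S"
  using generate_field.eng_mult[of x ring_of_type_algebra S y] by (simp add: ring_of_type_algebra_def)

lemma gf_inverse: "x \<in> gf S \<Longrightarrow> inverse x \<in> gf S"
  using generate_field.m_inv[of x ring_of_type_algebra S]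
  by (cases "x = 0") (auto simp: m_inv_ring_of_type_algebra, simp add: ring_of_type_algebra_def)

lemma gf_induct [consumes 1, case_names incl one uminus inverse add mult]:
  assumes "x \<in> gf S"
    and "\<And>x. x \<in> S \<Longrightarrow> P x" "P 1" "\<And>x. x \<in> gf S \<Longrightarrow> P x \<Longrightarrow> P (- x)"
    "\<And>x. x \<in> gf S \<Longrightarrow> x \<noteq> 0 \<Longrightarrow> P x \<Longrightarrow> P (inverse x)"
    "\<And>x y. x \<in> gf S \<Longrightarrow> y \<in> gf S \<Longrightarrow> P x \<Longrightarrow> P y \<Longrightarrow> P (x + y)"
    "\<And>x y. x \<in> gf S \<Longrightarrow> y \<in> gf S \<Longrightarrow> P x \<Longrightarrow> P y \<Longrightarrow> P (x * y)"
  shows "P x"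
  using assms(1)
proof (induction rule: generate_field.induct)
  case (m_inv h)
  thus ?case using assms(5)[of h]
    by (subst m_inv_ring_of_type_algebra) (auto simp: ring_of_type_algebra_def)
qed (use assms in \<open>auto simp: a_inv_ring_of_type_algebra, auto simp: ring_of_type_algebra_def\<close>)

lemma gf_diff: "x \<in> gf S \<Longrightarrow> y \<in> gf S \<Longrightarrow> x - y \<in> gf S"
  using gf_add[of x S "- y"] gf_uminus[of y S] by simp

lemma gf_divide: "x \<in> gf S \<Longrightarrow> y \<in> gf S \<Longrightarrow> x / y \<in> gf S"
  using gf_mult[of x S "inverse y"] gf_inverse[of y S] by (simp add: divide_inverse)

lemma gf_power: "x \<in> gf S \<Longrightarrow> x ^ m \<in> gf S"
  by (induction m) (auto intro: gf_mult)

lemma gf_powi: "x \<in> gf S \<Longrightarrow> x powi m \<in> gf S"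
  by (auto simp: power_int_def intro: gf_power gf_inverse)

lemma gf_sum: "(\<And>i. i \<in> I \<Longrightarrow> f i \<in> gf S) \<Longrightarrow> (\<Sum>i\<in>I. f i) \<in> gf S"
  by (induction I rule: infinite_finite_induct) (auto intro: gf_add)

lemma gf_prod: "(\<And>i. i \<in> I \<Longrightarrow> f i \<in> gf S) \<Longrightarrow> (\<Prod>i\<in>I. f i) \<in> gf S"
  by (induction I rule: infinite_finite_induct) (auto intro: gf_mult)

lemma gf_of_nat: "of_nat m \<in> gf S"
  by (induction m) (auto intro: gf_add)

lemmas gf_closed = gf_add gf_diff gf_uminus gf_mult gf_divide gf_power gf_powi gf_inverse gf_sum gf_prod gf_of_nat

lemma gf_least: assumes "S \<subseteq> gf T" shows "gf S \<subseteq> gf T"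
proof
  fix x assume "x \<in> gf S"
  thus "x \<in> gf T" by (induction rule: gf_induct) (use assms in \<open>auto intro: gf_closed\<close>)
qed

lemma gf_mono: "S \<subseteq> T \<Longrightarrow> gf S \<subseteq> gf T"
  by (rule gf_least) (auto intro: gf_incl)

text \<open>Applied with R a ring of polynomial expressions, this reduces questions about a
  generated field to numerators and denominators in R.\<close>

lemma gf_fraction:
  assumes R: "1 \<in> R" "\<And>a. a \<in> R \<Longrightarrow> - a \<in> R" "\<And>a b. a \<in> R \<Longrightarrow> b \<in> R \<Longrightarrow> a + b \<in> R"
      "\<And>a b. a \<in> R \<Longrightarrow> b \<in> R \<Longrightarrow> a * b \<in> R"
    and S: "S \<subseteq> R" and x: "x \<in> gf S"
  shows "\<exists>a b. a \<in> R \<and> b \<in> R \<and> b \<noteq> 0 \<and> x = a / b"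
  using x
proof (induction rule: gf_induct)
  case (incl x)
  thus ?case using R(1) S by (intro exI[of _ x] exI[of _ 1]) auto
next
  case one
  thus ?case using R(1) by (intro exI[of _ 1]) auto
next
  case (uminus x)
  then obtain a b where "a \<in> R" "b \<in> R" "b \<noteq> 0" "x = a / b" by blast
  thus ?case using R(2) by (intro exI[of _ "-a"] exI[of _ b]) auto
next
  case (inverse x)
  then obtain a b where "a \<in> R" "b \<in> R" "b \<noteq> 0" "x = a / b" by blast
  thus ?case using inverse by (intro exI[of _ b] exI[of _ a]) auto
next
  case (add x y)
  then obtain a b c d where "a \<in> R" "b \<in> R" "b \<noteq> 0" "x = a / b"
    "c \<in> R" "d \<in> R" "d \<noteq> 0" "y = c / d" by blast
  thus ?case by (intro exI[of _ "a * d + c * b"] exI[of _ "b * d"])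
     (auto simp: add_frac_eq intro: R(3,4))
next
  case (mult x y)
  then obtain a b c d where "a \<in> R" "b \<in> R" "b \<noteq> 0" "x = a / b"
    "c \<in> R" "d \<in> R" "d \<noteq> 0" "y = c / d" by blast
  thus ?case by (intro exI[of _ "a * c"] exI[of _ "b * d"])
     (auto intro: R(4))
qed

text \<open>Endomorphisms of the whole type rather than of a subfield, so that compatibility with
  the operations carries no membership conditions. The action of a group element is later extended
  to all variables for this purpose.\<close>

locale fhom =
  fixes \<phi> :: "'a::field \<Rightarrow> 'a"
  assumes hom_add: "\<phi> (x + y) = \<phi> x + \<phi> y"
    and hom_mult: "\<phi> (x * y) = \<phi> x * \<phi> y"
    and hom_one [simp]: "\<phi> 1 = 1"
begin

lemma hom_zero [simp]: "\<phi> 0 = 0"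
  using hom_add[of 0 0] by (metis add_0 add_cancel_right_left)

lemma hom_uminus: "\<phi> (- x) = - \<phi> x"
  using hom_add[of x "- x"] by (simp add: eq_neg_iff_add_eq_0 add.commute)

lemma hom_eq_0_iff [simp]: "\<phi> x = 0 \<longleftrightarrow> x = 0"
proof
  assume "\<phi> x = 0"
  thus "x = 0" using hom_mult[of x "inverse x"] by (cases "x = 0") auto
qed auto

lemma hom_inverse: "\<phi> (inverse x) = inverse (\<phi> x)"
proof (cases "x = 0")
  case False
  hence "\<phi> x * \<phi> (inverse x) = 1" by (simp add: hom_mult[symmetric])
  thus ?thesis using inverse_unique by metis
qed auto

lemma hom_divide: "\<phi> (x / y) = \<phi> x / \<phi> y"
  by (simp add: divide_inverse hom_mult hom_inverse)

lemma hom_power: "\<phi> (x ^ m) = \<phi> x ^ m"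
  by (induction m) (auto simp: hom_mult)

lemma hom_powi: "\<phi> (x powi m) = \<phi> x powi m"
  by (auto simp: power_int_def hom_power hom_inverse)

lemma hom_sum: "\<phi> (\<Sum>i\<in>I. f i) = (\<Sum>i\<in>I. \<phi> (f i))"
  by (induction I rule: infinite_finite_induct) (auto simp: hom_add)

lemma hom_prod: "\<phi> (\<Prod>i\<in>I. f i) = (\<Prod>i\<in>I. \<phi> (f i))"
  by (induction I rule: infinite_finite_induct) (auto simp: hom_mult)

lemma funpow_fhom: "fhom (\<phi> ^^ m)"
  by (induction m) (unfold_locales, auto simp: hom_add hom_mult fhom_def)

lemma hom_gf_image:
  assumes "x \<in> gf S" "\<And>s. s \<in> S \<Longrightarrow> \<phi> s \<in> gf T"
  shows "\<phi> x \<in> gf T"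
  using assms(1)
  by (induction rule: gf_induct)
     (use assms(2) in \<open>auto simp: hom_add hom_mult hom_uminus hom_inverse intro: gf_closed\<close>)

lemma hom_gf_fixed:
  assumes "x \<in> gf S" "\<And>s. s \<in> S \<Longrightarrow> \<phi> s = s"
  shows "\<phi> x = x"
  using assms(1)
  by (induction rule: gf_induct)
     (use assms(2) in \<open>auto simp: hom_add hom_mult hom_uminus hom_inverse\<close>)

end

lemma fhom_eq_on_gf:
  assumes "fhom \<phi>" "fhom \<psi>" "x \<in> gf S" "\<And>s. s \<in> S \<Longrightarrow> \<phi> s = \<psi> s"
  shows "\<phi> x = \<psi> x"
proof -
  interpret A: fhom \<phi> by fact
  interpret B: fhom \<psi> by fact
  show ?thesis using assms(3)
    by (induction rule: gf_induct)
       (use assms(4) in \<open>auto simp: A.hom_add A.hom_mult A.hom_uminus A.hom_inverse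
          B.hom_add B.hom_mult B.hom_uminus B.hom_inverse\<close>)
qed

section \<open>Powers of a primitive root of unity and Kummer descent\<close>

lemma primitive_power_eq_1_iff:
  assumes "primitive_root_of_unity m (w::'a::field)" "0 < m"
  shows "w ^ i = 1 \<longleftrightarrow> m dvd i"
proof
  assume "w ^ i = 1"
  have "w ^ i = (w ^ m) ^ (i div m) * w ^ (i mod m)"
    by (metis mult_div_mod_eq power_add power_mult)
  hence "w ^ (i mod m) = 1" using assms \<open>w ^ i = 1\<close> by (simp add: primitive_root_of_unity_def)
  hence "i mod m = 0" using assms unfolding primitive_root_of_unity_def
    by (metis gr0I mod_less_divisor)
  thus "m dvd i" by auto
next
  assume "m dvd i" thus "w ^ i = 1"
    using assms by (auto elim!: dvdE simp: power_mult primitive_root_of_unity_def)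
qed

lemma sum_powers_primitive:
  assumes "primitive_root_of_unity m (w::'a::field)" "0 < m"
  shows "(\<Sum>j<m. w ^ (i * j)) = (if m dvd i then of_nat m else 0)"
proof (cases "m dvd i")
  case True
  hence "w ^ (i * j) = 1" for j
    using primitive_power_eq_1_iff[OF assms] by simp
  thus ?thesis using True by simp
next
  case False
  hence "w ^ i \<noteq> 1" using primitive_power_eq_1_iff[OF assms] by simp
  moreover have "(w ^ i) ^ m = 1"
    using assms by (metis power_mult mult.commute power_one primitive_root_of_unity_def)
  ultimately have "(\<Sum>j<m. (w ^ i) ^ j) = 0" by (simp add: geometric_sum)
  thus ?thesis using False by (simp add: power_mult)
qed

text \<open>In characteristic not dividing \<open>m\<close>, the average over the powers of \<open>\<phi>\<close> kills the terms
  \<open>c w\<^sup>i\<close> with \<open>i\<close> not divisible by \<open>m\<close>; denominators are made invariant by a norm.\<close>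

lemma (in fhom) kummer_fixed:
  fixes w z :: 'a
  assumes T: "\<And>s. s \<in> T \<Longrightarrow> \<phi> s = s" and m: "0 < m" "of_nat m \<noteq> (0::'a)"
    and z: "primitive_root_of_unity m z" "z \<in> gf T"
    and w: "\<phi> w = z * w" "w ^ m \<in> gf T"
    and f: "f \<in> gf (insert w T)" "\<phi> f = f"
  shows "f \<in> gf T"
proof -
  define R where "R = {poly P w | P. \<forall>i. Polynomial.coeff P i \<in> gf T}"
  have zm: "z ^ m = 1" using z by (simp add: primitive_root_of_unity_def)
  have fixT: "\<phi> x = x" if "x \<in> gf T" for x using hom_gf_fixed that T by blast
  have fixTn: "(\<phi> ^^ j) x = x" if "x \<in> gf T" for x j
    by (induction j) (auto simp: fixT that)
  have wn: "(\<phi> ^^ j) w = z ^ j * w" for j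
    by (induction j) (auto simp: hom_mult hom_power w fixT[OF z(2)])
  have R_poly: "poly P w \<in> R" if "\<And>i. Polynomial.coeff P i \<in> gf T" for P
    using that unfolding R_def by blast
  have R_add: "x + y \<in> R" if xy: "x \<in> R" "y \<in> R" for x y
  proof -
    from xy obtain P Q where "x = poly P w" "\<forall>i. Polynomial.coeff P i \<in> gf T"
      "y = poly Q w" "\<forall>i. Polynomial.coeff Q i \<in> gf T" unfolding R_def by blast
    thus ?thesis using R_poly[of "P + Q"] by (auto intro: gf_closed)
  qed
  have R_mult: "x * y \<in> R" if xy: "x \<in> R" "y \<in> R" for x y
  proof -
    from xy obtain P Q where "x = poly P w" "\<forall>i. Polynomial.coeff P i \<in> gf T"
      "y = poly Q w" "\<forall>i. Polynomial.coeff Q i \<in> gf T" unfolding R_def by blast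
    thus ?thesis using R_poly[of "P * Q"] by (auto simp: coeff_mult intro: gf_closed)
  qed
  have R_T: "x \<in> R" if "x \<in> gf T" for x
    using R_poly[of "[:x:]"] that by (auto simp: coeff_pCons split: nat.splits)
  have R_w: "w \<in> R"
    using R_poly[of "[:0, 1:]"] by (auto simp: coeff_pCons split: nat.splits)
  have R_uminus: "- x \<in> R" if "x \<in> R" for x
    using R_mult[OF R_T[OF gf_uminus[OF gf_one]] that] by simp
  have phi_poly: "(\<phi> ^^ j) (poly P w) = (\<Sum>i\<le>degree P. Polynomial.coeff P i * w ^ i * z ^ (i * j))"
    if "\<And>i. Polynomial.coeff P i \<in> gf T" for P j
  proof -
    interpret J: fhom "\<phi> ^^ j" by (rule funpow_fhom)
    show ?thesis
      by (simp add: poly_altdef J.hom_sum J.hom_mult J.hom_power wn fixTn[OF that] power_mult_distrib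
          flip: power_mult) (simp add: mult_ac)
  qed
  have fix_R: "(\<phi> ^^ m) x = x" if "x \<in> R" for x
  proof -
    from that obtain P where P: "x = poly P w" "\<And>i. Polynomial.coeff P i \<in> gf T"
      unfolding R_def by blast
    have "z ^ (i * m) = 1" for i using zm by (simp add: mult.commute[of i] power_mult)
    thus ?thesis unfolding P(1) phi_poly[OF P(2)] by (simp add: poly_altdef)
  qed
  have R_sum: "(\<Sum>i\<in>I. g i) \<in> R" if "\<And>i. i \<in> I \<Longrightarrow> g i \<in> R" for g :: "nat \<Rightarrow> 'a" and I
    using that by (induction I rule: infinite_finite_induct) (auto intro: R_add R_T)
  have R_prod: "(\<Prod>i\<in>I. g i) \<in> R" if "\<And>i. i \<in> I \<Longrightarrow> g i \<in> R" for g :: "nat \<Rightarrow> 'a" and I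
    using that by (induction I rule: infinite_finite_induct) (auto intro: R_mult R_T)
  have R_power: "x ^ i \<in> R" if "x \<in> R" for x i
    using that by (induction i) (auto intro: R_mult R_T)
  have phi_R: "(\<phi> ^^ j) x \<in> R" if x: "x \<in> R" for x j
  proof -
    from x obtain P where P: "x = poly P w" "\<And>i. Polynomial.coeff P i \<in> gf T"
      unfolding R_def by blast
    show ?thesis unfolding P(1) phi_poly[OF P(2)]
      by (intro R_sum R_mult R_power R_w R_T P z)
  qed
  have fixed_R: "x \<in> gf T" if x: "x \<in> R" "\<phi> x = x" for x
  proof -
    from x obtain P where P: "x = poly P w" "\<And>i. Polynomial.coeff P i \<in> gf T"
      unfolding R_def by blast
    have "(\<phi> ^^ j) x = x" for j by (induction j) (auto simp: x)
    hence "of_nat m * x = (\<Sum>j<m. (\<phi> ^^ j) x)" by simp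
    also have "\<dots> = (\<Sum>j<m. \<Sum>i\<le>degree P. Polynomial.coeff P i * w ^ i * z ^ (i * j))"
      unfolding P(1) phi_poly[OF P(2)] ..
    also have "\<dots> = (\<Sum>i\<le>degree P. Polynomial.coeff P i * w ^ i * (\<Sum>j<m. z ^ (i * j)))"
      by (subst sum.swap) (simp add: sum_distrib_left)
    also have "\<dots> = (\<Sum>i\<le>degree P. Polynomial.coeff P i * w ^ i * (if m dvd i then of_nat m else 0))"
      using z m by (simp add: sum_powers_primitive)
    also have "\<dots> \<in> gf T"
    proof (rule gf_sum)
      fix i
      show "Polynomial.coeff P i * w ^ i * (if m dvd i then of_nat m else 0) \<in> gf T"
      proof (cases "m dvd i")
        case True
        then obtain l where "i = m * l" by (auto elim: dvdE)
        hence "w ^ i \<in> gf T" using w(2) by (auto simp: power_mult intro: gf_power)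
        thus ?thesis using P by (auto intro: gf_closed)
      qed auto
    qed
    finally have "of_nat m * x / of_nat m \<in> gf T" by (intro gf_divide gf_of_nat)
    thus ?thesis using m by simp
  qed
  have "\<exists>a b. a \<in> R \<and> b \<in> R \<and> b \<noteq> 0 \<and> f = a / b"
  proof (rule gf_fraction[OF R_T[OF gf_one] R_uminus R_add R_mult _ f(1)])
    show "insert w T \<subseteq> R" using R_w R_T gf_incl by auto
  qed
  then obtain a b where ab: "a \<in> R" "b \<in> R" "b \<noteq> 0" "f = a / b" by blast
  define b' where "b' = (\<Prod>j\<in>{1..<m}. (\<phi> ^^ j) b)"
  define N where "N = (\<Prod>j<m. (\<phi> ^^ j) b)"
  have N: "N = b * b'"
  proof -
    have "{..<m} = insert 0 {1..<m}" using m by auto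
    thus ?thesis unfolding N_def b'_def by simp
  qed
  have "\<phi> N = (\<Prod>j<m. (\<phi> ^^ Suc j) b)" by (simp add: N_def hom_prod)
  hence "b * \<phi> N = (\<Prod>j<Suc m. (\<phi> ^^ j) b)" by (simp only: prod.lessThan_Suc_shift) simp
  also have "\<dots> = N * b" using fix_R[OF ab(2)] by (simp add: N_def)
  finally have phiN: "\<phi> N = N" using ab(3) by simp
  have "(\<phi> ^^ j) b \<noteq> 0" for j
    using fhom.hom_eq_0_iff[OF funpow_fhom] ab(3) by blast
  hence N0: "N \<noteq> 0" by (simp add: N_def)
  have NR: "N \<in> R" unfolding N_def by (intro R_prod phi_R ab)
  have bR: "b' \<in> R" unfolding b'_def by (intro R_prod phi_R ab)
  have fN: "f * N = a * b'" using ab(3) by (simp add: ab(4) N)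
  have "f * N \<in> gf T"
  proof (rule fixed_R)
    show "f * N \<in> R" unfolding fN by (intro R_mult ab bR)
  qed (simp add: hom_mult f phiN)
  moreover have "N \<in> gf T" by (rule fixed_R) (auto simp: phiN NR)
  ultimately have "(f * N) / N \<in> gf T" by (rule gf_divide)
  thus ?thesis using N0 by simp
qed

text \<open>The action of \<open>\<int>[X]\<close> on the multiplicative group with \<open>X\<close> acting as \<open>\<phi>\<close>:
  \<open>pw \<phi> (\<Sum>\<^sub>i c\<^sub>i X\<^sup>i) y = \<Prod>\<^sub>i \<phi>\<^sup>i(y)\<^bsup>c\<^sub>i\<^esup>\<close>. It is additive in the polynomial only for \<open>y \<noteq> 0\<close>.\<close>

definition pw :: "('a::field \<Rightarrow> 'a) \<Rightarrow> int poly \<Rightarrow> 'a \<Rightarrow> 'a" where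
  "pw \<phi> F y = fold_coeffs (\<lambda>c x. y powi c * \<phi> x) F 1"

context fhom begin

lemma pw_0 [simp]: "pw \<phi> 0 y = 1"
  by (simp add: pw_def)

lemma pw_pCons: "pw \<phi> (pCons c F) y = y powi c * \<phi> (pw \<phi> F y)"
  by (cases "F = 0 \<and> c = 0") (auto simp: pw_def)

lemma pw_1 [simp]: "pw \<phi> 1 y = y"
  unfolding one_pCons by (simp add: pw_pCons)

lemma pw_const: "pw \<phi> [:c:] y = y powi c"
  by (simp add: pw_pCons)

lemma pw_of_nat: "pw \<phi> (of_nat m) y = y ^ m"
  by (simp add: of_nat_poly pw_const)

lemma pw_monom: "pw \<phi> (monom 1 i) y = (\<phi> ^^ i) y"
  by (induction i) (simp_all add: monom_0 monom_Suc pw_pCons)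

lemma pw_one_arg [simp]: "pw \<phi> F 1 = 1"
  by (induction F) (auto simp: pw_pCons)

lemma pw_nonzero: "y \<noteq> 0 \<Longrightarrow> pw \<phi> F y \<noteq> 0"
  by (induction F) (auto simp: pw_pCons)

lemma pw_add: "y \<noteq> 0 \<Longrightarrow> pw \<phi> (F + G) y = pw \<phi> F y * pw \<phi> G y"
  by (induction F G rule: poly_induct2)
     (auto simp: pw_pCons hom_mult power_int_add)

lemma pw_uminus: "y \<noteq> 0 \<Longrightarrow> pw \<phi> (- F) y = inverse (pw \<phi> F y)"
  using pw_add[of y F "- F"] pw_nonzero[of y F] by (simp add: inverse_unique)

lemma pw_diff: "y \<noteq> 0 \<Longrightarrow> pw \<phi> (F - G) y = pw \<phi> F y / pw \<phi> G y"
  using pw_add[of y F "- G"] pw_uminus[of y G] by (simp add: divide_inverse)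

lemma pw_smult: "pw \<phi> (smult c F) y = pw \<phi> F y powi c"
  by (induction F) (auto simp: pw_pCons power_int_mult_distrib hom_powi mult.commute[of c] power_int_mult)

lemma pw_mult: "y \<noteq> 0 \<Longrightarrow> pw \<phi> (F * G) y = pw \<phi> F (pw \<phi> G y)"
  by (induction F) (auto simp: pw_pCons pw_add pw_smult)

lemma pw_mult_arg: "pw \<phi> F (y * z) = pw \<phi> F y * pw \<phi> F z"
  by (induction F) (auto simp: pw_pCons power_int_mult_distrib hom_mult)

lemma pw_prod_arg: "pw \<phi> F (\<Prod>i\<in>I. y i) = (\<Prod>i\<in>I. pw \<phi> F (y i))"
  by (induction I rule: infinite_finite_induct) (auto simp: pw_mult_arg)

lemma pw_Xm1: "y \<noteq> 0 \<Longrightarrow> (\<phi> ^^ m) y = y \<Longrightarrow> pw \<phi> (Xm1 m) y = 1"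
  by (simp add: Xm1_def pw_diff pw_monom)

lemma pw_funpow: "(\<phi> ^^ m) (pw \<phi> F y) = pw \<phi> F ((\<phi> ^^ m) y)"
proof -
  have "\<phi> (pw \<phi> F y) = pw \<phi> F (\<phi> y)" for y
    by (induction F) (auto simp: pw_pCons hom_mult hom_powi)
  thus ?thesis by (induction m) auto
qed

lemma pw_eq_1:
  assumes "y \<noteq> 0" "(\<phi> ^^ m) y = y" "Xm1 m dvd F"
  shows "pw \<phi> F y = 1"
proof -
  from assms(3) obtain G where "F = G * Xm1 m" by (metis dvdE mult.commute)
  thus ?thesis using assms by (simp add: pw_mult pw_Xm1)
qed

lemma pw_cong:
  assumes "y \<noteq> 0" "(\<phi> ^^ m) y = y" "Xm1 m dvd F - G"
  shows "pw \<phi> F y = pw \<phi> G y"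
  using pw_eq_1[OF assms] pw_nonzero[OF assms(1)] by (simp add: pw_diff[OF assms(1)])

lemma pw_closed:
  assumes "\<And>x. x \<in> gf S \<Longrightarrow> \<phi> x \<in> gf S" "y \<in> gf S"
  shows "pw \<phi> F y \<in> gf S"
  by (induction F) (auto simp: pw_pCons intro!: gf_mult gf_powi assms)

text \<open>For a \<phi>-stable field, the polynomials whose action takes y into the field form an
  ideal, so that checking generators suffices.\<close>

lemma pw_idl_closed:
  assumes "\<And>x. x \<in> gf S \<Longrightarrow> \<phi> x \<in> gf S" "y \<noteq> 0"
    and "\<And>G. G \<in> T \<Longrightarrow> pw \<phi> G y \<in> gf S" "F \<in> idl T"
  shows "pw \<phi> F y \<in> gf S"
  using assms(4)
  by (induction rule: idl.induct)
     (auto simp: pw_add pw_mult assms(2) intro!: gf_mult pw_closed assms(1,3))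

text \<open>The induction passes from y to \<phi> y, which satisfies the hypothesis with \<zeta> ^ t
  in place of \<zeta>; hence \<zeta> is left arbitrary. If \<zeta> ^ p = 1, the result is
  \<psi>-invariant as soon as p divides F(t); with \<zeta> = 1 it is always invariant.\<close>

lemma pw_eigen:
  assumes psi: "fhom \<psi>" and \<zeta>: "\<phi> \<zeta> = \<zeta>" "\<zeta> \<noteq> 0"
    and y: "\<And>i. \<psi> ((\<phi> ^^ i) y) = \<zeta> ^ (t ^ i) * (\<phi> ^^ i) y"
  shows "\<psi> (pw \<phi> F y) = \<zeta> powi (poly F (int t)) * pw \<phi> F y"
  using \<zeta> y
proof (induction F arbitrary: \<zeta> y)
  case 0
  then show ?case by (simp add: fhom.hom_one[OF psi])
next
  case (pCons c F \<zeta> y)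
  interpret psi: fhom \<psi> by fact
  have pw_phi: "\<phi> (pw \<phi> F y) = pw \<phi> F (\<phi> y)" for F y using pw_funpow[of 1] by simp
  have "\<psi> (pw \<phi> F (\<phi> y)) = (\<zeta> ^ t) powi (poly F (int t)) * pw \<phi> F (\<phi> y)"
  proof (rule pCons.IH)
    fix i
    show "\<psi> ((\<phi> ^^ i) (\<phi> y)) = (\<zeta> ^ t) ^ (t ^ i) * (\<phi> ^^ i) (\<phi> y)"
      using pCons.prems(3)[of "Suc i"] by (simp add: funpow_swap1 power_mult)
  qed (use pCons.prems in \<open>auto simp: hom_power\<close>)
  moreover have "(\<zeta> ^ t) powi (poly F (int t)) = \<zeta> powi (int t * poly F (int t))"
    by (simp add: power_int_mult)
  moreover have "\<psi> y = \<zeta> * y" using pCons.prems(3)[of 0] by simp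
  ultimately show ?case
    using pCons.prems(2)
    by (simp add: pw_pCons pw_phi psi.hom_mult psi.hom_powi power_int_mult_distrib power_int_add)
qed

end

lemma dvd_add_diff_iff:
  assumes "i < m" "j < (m::nat)" shows "m dvd j + (m - i) \<longleftrightarrow> i = j"
proof
  assume "m dvd j + (m - i)"
  then obtain l where l: "j + (m - i) = m * l" by (auto elim: dvdE)
  have "m * l < m * 2" "0 < m * l" using assms unfolding l[symmetric] by auto
  hence "l = 1" by (auto simp: less_2_cases_iff)
  thus "i = j" using l assms by simp
qed (use assms in auto)

text \<open>The Lagrange resolvent, with exponent \<open>c * (m - i)\<close> in place of \<open>- c * i\<close>.\<close>

definition res :: "('a::field \<Rightarrow> 'a) \<Rightarrow> 'a \<Rightarrow> nat \<Rightarrow> 'a \<Rightarrow> nat \<Rightarrow> 'a" where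
  "res \<phi> w m z c = (\<Sum>i<m. w ^ (c * (m - i)) * (\<phi> ^^ i) z)"

lemma (in fhom) res_eigen:
  assumes w: "w ^ m = 1" "\<phi> w = w" and z: "(\<phi> ^^ m) z = z"
  shows "\<phi> (res \<phi> w m z c) = w ^ c * res \<phi> w m z c"
proof -
  define g where "g i = w ^ (c * (m - i)) * (\<phi> ^^ i) z" for i
  have "\<phi> (res \<phi> w m z c) = (\<Sum>i<m. w ^ (c * (m - i)) * (\<phi> ^^ Suc i) z)"
    by (simp add: res_def hom_sum hom_mult hom_power w)
  also have "\<dots> = (\<Sum>i<m. w ^ c * g (Suc i))"
  proof (rule sum.cong)
    fix i assume "i \<in> {..<m}"
    hence "c * (m - i) = c + c * (m - Suc i)" by (simp add: Suc_diff_Suc flip: mult_Suc_right)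
    thus "w ^ (c * (m - i)) * (\<phi> ^^ Suc i) z = w ^ c * g (Suc i)"
      by (simp add: g_def power_add mult.assoc)
  qed auto
  also have "\<dots> = w ^ c * (\<Sum>i<m. g (Suc i))" by (simp add: sum_distrib_left)
  also have "(\<Sum>i<m. g (Suc i)) = (\<Sum>i<m. g i)"
  proof -
    have "w ^ (c * m) = 1" using w by (simp add: mult.commute[of c] power_mult)
    hence "g m = g 0" using z by (simp add: g_def)
    moreover have "g 0 + (\<Sum>i<m. g (Suc i)) = (\<Sum>i<m. g i) + g m"
      using sum.lessThan_Suc_shift[of g m] by simp
    ultimately show ?thesis by simp
  qed
  finally show ?thesis by (simp add: res_def g_def)
qed

text \<open>Discrete Fourier inversion: orthogonality of the powers of w isolates the j-th conjugate
  of z.\<close>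

lemma res_inversion:
  assumes w: "primitive_root_of_unity m (w::'a::field)" and j: "j < m"
  shows "(\<Sum>c<m. w ^ (c * j) * res \<phi> w m z c) = of_nat m * (\<phi> ^^ j) z"
proof -
  have "(\<Sum>c<m. w ^ (c * j) * res \<phi> w m z c) = (\<Sum>c<m. \<Sum>i<m. w ^ ((j + (m - i)) * c) * (\<phi> ^^ i) z)"
    by (simp only: res_def sum_distrib_left power_add[symmetric] mult.assoc[symmetric]
        distrib_left[symmetric] mult.commute[of "_ + _"])
  also have "\<dots> = (\<Sum>i<m. (\<Sum>c<m. w ^ ((j + (m - i)) * c)) * (\<phi> ^^ i) z)"
    by (subst sum.swap) (simp add: sum_distrib_right)
  also have "\<dots> = (\<Sum>i<m. if i = j then of_nat m * (\<phi> ^^ i) z else 0)"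
  proof (rule sum.cong)
    fix i assume i: "i \<in> {..<m}"
    have "m dvd j + (m - i) \<longleftrightarrow> i = j" using dvd_add_diff_iff[of i m j] i j by simp
    thus "(\<Sum>c<m. w ^ ((j + (m - i)) * c)) * (\<phi> ^^ i) z = (if i = j then of_nat m * (\<phi> ^^ i) z else 0)"
      using sum_powers_primitive[OF w, of "j + (m - i)"] j by simp
  qed auto
  finally show ?thesis using j by simp
qed

lemma res_inversion_gf:
  assumes w: "primitive_root_of_unity m (w::'a::field)" "w \<in> gf S" and j: "j < m" "of_nat m \<noteq> (0::'a)"
    and "\<And>c. c < m \<Longrightarrow> res \<phi> w m z c \<in> gf S"
  shows "(\<phi> ^^ j) z \<in> gf S"
proof -
  have "of_nat m * (\<phi> ^^ j) z / of_nat m \<in> gf S"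
    unfolding res_inversion[OF w(1) j(1), symmetric]
    using assms by (intro gf_closed) auto
  thus ?thesis using j by simp
qed

lemma primitive_root_power:
  assumes "primitive_root_of_unity n (w::'a::field)" "q dvd n" "0 < n"
  shows "primitive_root_of_unity (n div q) (w ^ q)"
proof -
  have "\<not> n dvd q * j" if "0 < j" "j < n div q" for j
  proof
    assume "n dvd q * j"
    hence "n \<le> q * j" using that assms by (intro dvd_imp_le) (auto intro!: Nat.gr0I)
    moreover have "q * j < n" using that assms
      by (metis dvd_mult_div_cancel mult_less_cancel1 less_nat_zero_code mult_is_0 neq0_conv)
    ultimately show False by simp
  qed
  thus ?thesis using assms primitive_power_eq_1_iff[OF assms(1,3)]
    unfolding primitive_root_of_unity_def by (simp flip: power_mult)
qed

subsection \<open>Fixed fields of monomial metacyclic actions\<close>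

text \<open>The conditions on t and f together say that f and \<open>gens n\<close> generate the
  ideal (p, X - t). The weight \<open>a * t ^ j\<close> reflects the relation \<sigma> \<tau> =
  \<tau> \<sigma>^t, by which \<tau> multiplies \<sigma>-weights by t.\<close>

locale metacyclic_field = \<sigma>: fhom \<sigma> + \<tau>: fhom \<tau> for \<sigma> \<tau> :: "'a::field \<Rightarrow> 'a" +
  fixes k L :: "'a set" and \<zeta> \<omega> :: 'a and Y :: "nat \<Rightarrow> nat \<Rightarrow> 'a" and p n t :: nat and f :: "int poly"
  assumes fix_k: "\<And>c. c \<in> k \<Longrightarrow> \<sigma> c = c" "\<And>c. c \<in> k \<Longrightarrow> \<tau> c = c"
    and zeta: "primitive_root_of_unity p \<zeta>" "\<zeta> \<in> k" "of_nat p \<noteq> (0::'a)"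
    and omega: "primitive_root_of_unity n \<omega>" "\<omega> \<in> k" "of_nat n \<noteq> (0::'a)"
    and p: "Factorial_Ring.prime p" and n: "0 < n" "n < p"
    and t: "\<And>q. q \<in> prime_factors n \<Longrightarrow> int p dvd poly (Npoly n q) (int t)" "int p dvd poly (Xm1 n) (int t)"
    and f: "of_nat p \<in> idl (insert f (gens n))" "monom 1 1 - of_nat t \<in> idl (insert f (gens n))"
      "int p dvd poly f (int t)"
    and tau_Y: "\<And>a j. \<tau> (Y a j) = Y a (Suc j)" and Y_period: "\<And>a. Y a n = Y a 0"
    and sigma_Y: "\<And>a j. \<sigma> (Y a j) = \<zeta> ^ (a * t ^ j) * Y a j"
    and L: "L = gf (k \<union> {Y a j |a j. a < p \<and> j < n})"
    \<comment> \<open>replaces the algebraic independence of the \<open>Y a j\<close>; it forces quantities built from them to be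
      nonzero\<close>
    and min_gens: "\<And>B. finite B \<Longrightarrow> L \<subseteq> gf (k \<union> B) \<Longrightarrow> p * n \<le> card B"
begin

section \<open>Eigenvectors of the two automorphisms\<close>

lemma p1: "1 < p" using p prime_gt_1_nat by blast

lemma Y_add: "Y a (i + j) = (\<tau> ^^ i) (Y a j)"
  by (induction i) (auto simp: tau_Y[symmetric])

lemma Y_mod: "Y a j = Y a (j mod n)"
proof -
  have per: "Y a (i + n) = Y a i" for i using Y_add[of a i n] Y_add[of a i 0] Y_period by simp
  have "Y a (i + n * m) = Y a i" for i m
  proof (induction m)
    case (Suc m)
    thus ?case using per[of "i + n * m"] by (simp add: algebra_simps)
  qed simp
  from this[of "j mod n" "j div n"] show ?thesis by simp
qed

lemma Y_in_L: "a < p \<Longrightarrow> Y a j \<in> L"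
  unfolding L by (subst Y_mod) (use n in \<open>auto intro!: gf_incl exI\<close>)

text \<open>Otherwise one of the p n generators of L could be dropped, against
  \<open>min_gens\<close>.\<close>

lemma Y_nonzero: assumes "a < p" shows "Y a j \<noteq> 0"
proof
  assume 0: "Y a j = 0"
  define I where "I = {..<p} \<times> {..<n} - {(a, j mod n)}"
  define B where "B = (\<lambda>(a, j). Y a j) ` I"
  have "finite B" "card B \<le> card I" by (auto simp: B_def I_def intro: card_image_le)
  have "L \<subseteq> gf (k \<union> B)" unfolding L
  proof (intro gf_least subsetI)
    fix x assume "x \<in> k \<union> {Y a j |a j. a < p \<and> j < n}"
    then consider "x \<in> k" | b i where "x = Y b i" "b < p" "i < n" by auto
    thus "x \<in> gf (k \<union> B)"
    proof cases
      case 2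
      show ?thesis
      proof (cases "(b, i) = (a, j mod n)")
        case True
        hence "x = 0" using 0 Y_mod 2 by simp
        thus ?thesis by simp
      next
        case False
        hence "x \<in> B" using 2 by (force simp: B_def I_def)
        thus ?thesis by (intro gf_incl) auto
      qed
    qed (auto intro: gf_incl)
  qed
  from min_gens[OF \<open>finite B\<close> this] \<open>card B \<le> card I\<close> have "p * n \<le> card I" by simp
  moreover have "card I = p * n - 1" using assms n unfolding I_def
    by (subst card_Diff_singleton) auto
  ultimately show False using p1 n by (metis One_nat_def Suc_pred diff_le_self lessI mult_pos_pos not_less zero_less_one less_trans)
qed

definition y where "y = Y 1 0"

text \<open>\<open>Y 1 j\<close> has \<sigma>-weight \<open>t ^ j\<close>, so its a-th power cancels
  the weight \<open>a * t ^ j\<close>.\<close>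

definition Z where "Z a j = Y a j / Y 1 j ^ a"

lemma tau_Z: "\<tau> (Z a j) = Z a (Suc j)"
  by (simp add: Z_def \<tau>.hom_divide \<tau>.hom_power tau_Y)

lemma Z_funpow: "(\<tau> ^^ i) (Z a 0) = Z a i"
  by (induction i) (auto simp: tau_Z)

lemma Z_period: "(\<tau> ^^ n) (Z a 0) = Z a 0"
  using Y_period by (simp add: Z_funpow) (simp add: Z_def)

lemma sigma_Z: "\<sigma> (Z a j) = Z a j"
proof -
  have "\<zeta> \<noteq> 0" using zeta p1 by (auto simp: primitive_root_of_unity_def power_0_left)
  hence "\<zeta> ^ (a * t ^ j) \<noteq> 0" by simp
  thus ?thesis
    by (simp add: Z_def \<sigma>.hom_divide \<sigma>.hom_power sigma_Y power_mult_distrib flip: power_mult)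
       (simp add: mult.commute)
qed

definition U where "U a c = res \<tau> \<omega> n (Z a 0) c"

lemma omega_power: "\<omega> ^ n = 1" "\<omega> \<noteq> 0"
  using omega n by (auto simp: primitive_root_of_unity_def power_0_left)

lemma tau_U: "\<tau> (U a c) = \<omega> ^ c * U a c"
  unfolding U_def by (rule \<tau>.res_eigen) (use omega_power fix_k omega Z_period in auto)

lemma sigma_U: "\<sigma> (U a c) = U a c"
  unfolding U_def res_def
  by (simp add: \<sigma>.hom_sum \<sigma>.hom_mult \<sigma>.hom_power fix_k omega Z_funpow sigma_Z)

lemma Z_in_gf_U:
  assumes "k \<subseteq> gf S" "\<And>c. c < n \<Longrightarrow> U a c \<in> gf S"
  shows "Z a j \<in> gf S"
proof -
  have "Z a j = Z a (j mod n)"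
    using Y_mod[of _ j] by (simp add: Z_def)
  also have "\<dots> = (\<tau> ^^ (j mod n)) (Z a 0)" by (simp add: Z_funpow)
  also have "\<dots> \<in> gf S"
    by (rule res_inversion_gf[OF omega(1)]) (use assms omega n in \<open>auto simp: U_def\<close>)
  finally show ?thesis .
qed

lemma U_in_L: "a < p \<Longrightarrow> U a c \<in> L"
  unfolding U_def res_def Z_funpow unfolding L
proof (intro gf_closed)
  show "\<omega> \<in> gf (k \<union> {Y a j |a j. a < p \<and> j < n})" using omega by (intro gf_incl) auto
  fix i assume "a < p"
  thus "Z a i \<in> gf (k \<union> {Y a j |a j. a < p \<and> j < n})" unfolding Z_def
    using Y_in_L[of a i] Y_in_L[of 1 i] p1 by (intro gf_closed) (auto simp: L)
qed

text \<open>The count of \<open>Y_nonzero\<close> for the generating set in which the rows a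
  \<noteq> 1 are replaced by U. Row 1 stays as it is, since \<open>Z 1 j\<close> is 1 and carries no
  information.\<close>

lemma U_nonzero: assumes "a < p" "a \<noteq> 1" "c < n" shows "U a c \<noteq> 0"
proof
  assume 0: "U a c = 0"
  define g where "g = (\<lambda>(a, j). if a = 1 then Y a j else U a j)"
  define I where "I = {..<p} \<times> {..<n} - {(a, c)}"
  define B where "B = g ` I"
  have B: "finite B" "card B \<le> card I" by (auto simp: B_def I_def intro: card_image_le)
  have gB: "g (b, i) \<in> gf (k \<union> B)" if "b < p" "i < n" for b i
  proof (cases "(b, i) = (a, c)")
    case True
    thus ?thesis using 0 assms by (auto simp: g_def)
  next
    case False
    thus ?thesis using that by (intro gf_incl) (auto simp: B_def I_def)
  qed
  have "L \<subseteq> gf (k \<union> B)" unfolding L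
  proof (intro gf_least subsetI)
    fix x assume "x \<in> k \<union> {Y a j |a j. a < p \<and> j < n}"
    then consider "x \<in> k" | b i where "x = Y b i" "b < p" "i < n" by auto
    thus "x \<in> gf (k \<union> B)"
    proof cases
      case 2
      have y: "Y 1 i \<in> gf (k \<union> B)" using gB[of 1 i] 2 p1 by (simp add: g_def)
      show ?thesis
      proof (cases "b = 1")
        case False
        have "Z b i \<in> gf (k \<union> B)"
          using False gB[of b] 2 by (intro Z_in_gf_U) (auto simp: g_def intro: gf_incl)
        hence "Z b i * Y 1 i ^ b \<in> gf (k \<union> B)" using y by (intro gf_closed)
        thus ?thesis using Y_nonzero[of 1 i] p1 by (simp add: Z_def 2)
      qed (use 2 y in auto)
    qed (auto intro: gf_incl)
  qed
  from min_gens[OF B(1) this] B(2) have "p * n \<le> card I" by simp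
  moreover have "card I = p * n - 1" using assms n unfolding I_def
    by (subst card_Diff_singleton) auto
  ultimately show False using p1 n by (metis One_nat_def Suc_pred diff_le_self lessI mult_pos_pos not_less zero_less_one less_trans)
qed

text \<open>The eigenvector of \<tau> with eigenvalue \<omega> by which all others are normalised.
  For n = 1 the only column is 0, which \<open>1 mod n\<close> respects.\<close>

definition u where "u = U 0 (1 mod n)"

lemma u_nonzero: "u \<noteq> 0"
  unfolding u_def using p1 n by (intro U_nonzero) auto

lemma omega_mod: "\<omega> ^ (c mod n) = \<omega> ^ c"
  using omega_power by (metis mult_div_mod_eq power_add power_mult power_one mult_1)

lemma tau_u: "\<tau> u = \<omega> * u"
  unfolding u_def tau_U omega_mod by simp

lemma sigma_u: "\<sigma> u = u"
  by (simp add: u_def sigma_U)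

definition V where "V a c = U a c / u ^ c"

lemma tau_V: "\<tau> (V a c) = V a c"
  using omega_power by (simp add: V_def \<tau>.hom_divide \<tau>.hom_power tau_U tau_u power_mult_distrib)

lemma sigma_V: "\<sigma> (V a c) = V a c"
  by (simp add: V_def \<sigma>.hom_divide \<sigma>.hom_power sigma_U sigma_u)

text \<open>\<open>\<omega> ^ q\<close> has order n/q, and the c-th summand is an eigenvector of
  \<tau> for its c-th power, so the orbit of z q has length dividing n/q. By Fourier inversion the
  conjugates of z q and the n/q elements \<open>V q c\<close> determine each other over
  k(u).\<close>

definition z where "z q = (\<Sum>c<n div q. V q c * u ^ (q * c))"

lemma prime_factorD:
  assumes "q \<in> prime_factors n"
  shows "q dvd n" "1 < q" "q < p" "n div q \<le> n" "0 < n div q" "n div q * q = n"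
    "of_nat (n div q) \<noteq> (0::'a)"
proof -
  show q: "q dvd n" "1 < q" using assms prime_gt_1_nat[of q] by (auto simp: in_prime_factors_iff)
  show "q < p" using dvd_imp_le[OF q(1)] n by simp
  show 1: "n div q \<le> n" "n div q * q = n" using q by auto
  show "0 < n div q" using 1(2) n by (cases "n div q") auto
  have "of_nat (n div q) * of_nat q = (of_nat n :: 'a)" using 1(2) by (metis of_nat_mult)
  thus "of_nat (n div q) \<noteq> (0::'a)" using omega(3) by auto
qed

lemma tau_z: "(\<tau> ^^ i) (z q) = (\<Sum>c<n div q. (\<omega> ^ q) ^ (c * i) * (V q c * u ^ (q * c)))"
proof (induction i)
  case (Suc i)
  have "\<tau> \<omega> = \<omega>" using fix_k omega by auto
  thus ?case
    by (simp add: Suc \<tau>.hom_sum \<tau>.hom_mult \<tau>.hom_power tau_V tau_u power_mult_distrib power_add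
        flip: power_mult) (simp add: mult_ac power_add distrib_left)
qed (simp add: z_def)

lemma z_period: assumes "q \<in> prime_factors n" shows "(\<tau> ^^ (n div q)) (z q) = z q"
proof -
  have "(\<omega> ^ q) ^ (c * (n div q)) = 1" for c
  proof -
    have "(\<omega> ^ q) ^ (c * (n div q)) = (\<omega> ^ n) ^ c"
      using prime_factorD(6)[OF assms] by (metis mult.commute mult.left_commute power_mult)
    thus ?thesis using omega_power by simp
  qed
  thus ?thesis by (simp add: tau_z) (simp add: z_def)
qed

lemma res_z:
  assumes q: "q \<in> prime_factors n" and c: "c < n div q"
  shows "res \<tau> (\<omega> ^ q) (n div q) (z q) c = of_nat (n div q) * (V q c * u ^ (q * c))"
proof -
  define m where "m = n div q"
  have w: "primitive_root_of_unity m (\<omega> ^ q)"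
    unfolding m_def by (rule primitive_root_power[OF omega(1)]) (use prime_factorD[OF q] n in auto)
  have m: "0 < m" using prime_factorD[OF q] by (simp add: m_def)
  have "res \<tau> (\<omega> ^ q) m (z q) c =
      (\<Sum>i<m. \<Sum>b<m. (\<omega> ^ q) ^ ((c * (m - i)) + b * i) * (V q b * u ^ (q * b)))"
    by (simp add: res_def tau_z sum_distrib_left m_def[symmetric] power_add mult.assoc)
  also have "\<dots> = (\<Sum>i<m. \<Sum>b<m. (\<omega> ^ q) ^ ((b + (m - c)) * i) * (V q b * u ^ (q * b)))"
  proof (intro sum.cong refl arg_cong2[where f = "(*)"])
    fix i b assume "i \<in> {..<m}"
    have wm: "(\<omega> ^ q) ^ m = 1" using w by (simp add: primitive_root_of_unity_def)
    \<comment> \<open>Both exponents are i(b - c) modulo m; multiples of m are added to keep them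
      natural numbers.\<close>
    have "c * (m - i) + b * i + m * i = (b + (m - c)) * i + m * c"
    proof -
      have "c \<le> m" "i \<le> m" using c \<open>i \<in> {..<m}\<close> by (auto simp: m_def)
      then obtain g h where "m = c + g" "m = i + h" by (metis le_Suc_ex)
      hence gh: "m - c = g" "m - i = h" "c + g = i + h" by auto
      have "c * h + b * i + m * i = c * h + b * i + (c + g) * i" by (simp only: \<open>m = c + g\<close>)
      also have "\<dots> = (b + g) * i + (i + h) * c" by (simp add: algebra_simps)
      also have "i + h = m" using \<open>m = i + h\<close> ..
      finally show ?thesis unfolding gh .
    qed
    hence "(\<omega> ^ q) ^ (c * (m - i) + b * i + m * i) = (\<omega> ^ q) ^ ((b + (m - c)) * i + m * c)" by simp
    thus "(\<omega> ^ q) ^ (c * (m - i) + b * i) = (\<omega> ^ q) ^ ((b + (m - c)) * i)"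
      using wm by (simp add: power_add power_mult)
  qed simp_all
  also have "\<dots> = (\<Sum>b<m. (\<Sum>i<m. (\<omega> ^ q) ^ ((b + (m - c)) * i)) * (V q b * u ^ (q * b)))"
    by (subst sum.swap) (simp add: sum_distrib_right)
  also have "\<dots> = (\<Sum>b<m. if b = c then of_nat m * (V q b * u ^ (q * b)) else 0)"
  proof (rule sum.cong)
    fix b assume b: "b \<in> {..<m}"
    have "m dvd b + (m - c) \<longleftrightarrow> b = c" using dvd_add_diff_iff[of c m b] b c by (auto simp: m_def)
    thus "(\<Sum>i<m. (\<omega> ^ q) ^ ((b + (m - c)) * i)) * (V q b * u ^ (q * b)) =
        (if b = c then of_nat m * (V q b * u ^ (q * b)) else 0)"
      using sum_powers_primitive[OF w m, of "b + (m - c)"] by simp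
  qed auto
  also have "\<dots> = of_nat m * (V q c * u ^ (q * c))" using c by (simp add: m_def)
  finally show ?thesis by (simp add: m_def)
qed

text \<open>The resolvent of z q with index 0 is a nonzero multiple of \<open>V q 0\<close>.\<close>

lemma z_nonzero: assumes q: "q \<in> prime_factors n" shows "z q \<noteq> 0"
proof
  assume "z q = 0"
  hence "(\<tau> ^^ i) (z q) = 0" for i by (induction i) auto
  hence "res \<tau> (\<omega> ^ q) (n div q) (z q) 0 = 0" by (simp add: res_def)
  hence "V q 0 = 0" using res_z[OF q, of 0] prime_factorD[OF q] by simp
  thus False using U_nonzero[of q 0] prime_factorD[OF q] n u_nonzero by (simp add: V_def)
qed

text \<open>The group generated by the conjugates of \<open>y\<close> and of the \<open>z q\<close> contains the \<open>\<sigma>\<close>-invariant elements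
  \<open>e\<close> and \<open>F q\<close> with \<open>\<tau>\<close>-orbits of lengths \<open>n\<close> and \<open>n div q\<close>; by \<open>lattice_data\<close> their conjugates recover the
  \<open>z q\<close> and all \<open>\<sigma>\<close>-invariant monomials in the conjugates of \<open>y\<close>. Hence \<open>e\<close> and \<open>F q\<close> can replace \<open>y\<close> and
  \<open>z q\<close>, and resolvents along \<open>\<tau>\<close>, divided by powers of \<open>u\<close>, give the generators \<open>Bf a b\<close>.\<close>

lemma fixed_field_generators:
  "\<exists>B. B \<subseteq> L \<and> finite B \<and> card B \<le> p * n \<and> {x \<in> L. \<sigma> x = x \<and> \<tau> x = x} = gf (k \<union> B)"
proof -
  have "coprime p n" using p n by (meson nat_dvd_not_less prime_imp_coprime)
  from lattice_data[OF p n(1) this f(1)]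
  obtain g W :: "int poly" and c d :: "nat \<Rightarrow> int poly" where
    g: "g - f \<in> idl (gens n)" and
    cd: "\<And>q. q \<in> prime_factors n \<Longrightarrow> Xm1 (n div q) dvd g * d q - of_nat q * W * c q - 1" and
    W: "\<And>q r. q \<in> prime_factors n \<Longrightarrow> r \<in> prime_factors n \<Longrightarrow> q \<noteq> r \<Longrightarrow> Xm1 (n div q) dvd Npoly n r * W"
    by metis
  define e where "e = pw \<tau> g y * (\<Prod>q\<in>prime_factors n. pw \<tau> (c q) (z q))"
  define F where "F q = pw \<tau> (W * Npoly n q) y * pw \<tau> (d q) (z q)" for q
  have y0: "y \<noteq> 0" and yn: "(\<tau> ^^ n) y = y" and y_funpow: "\<And>i. (\<tau> ^^ i) y = Y 1 i"
    using Y_nonzero p1 Y_period by (auto simp: y_def Y_add[of _ _ 0, simplified, symmetric])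
  note z0 = z_nonzero
  have zn: "(\<tau> ^^ n) (z q) = z q" if "q \<in> prime_factors n" for q
  proof -
    have "(\<tau> ^^ (i * (n div q))) (z q) = z q" for i
      by (induction i) (auto simp: funpow_add z_period[OF that])
    from this[of q] show ?thesis using prime_factorD(6)[OF that] by (simp add: mult.commute)
  qed
  interpret n: fhom "\<tau> ^^ n" by (rule \<tau>.funpow_fhom)
  have en: "(\<tau> ^^ n) e = e"
    using yn zn by (simp add: e_def n.hom_mult n.hom_prod \<tau>.pw_funpow cong: prod.cong)
  \<comment> \<open>Multiplication by X^(n/q) fixes the norm element \<open>Npoly n q\<close> modulo
    X^n - 1, so the part of F q in y has as short an orbit as the part in z q.\<close>
  have Fn: "(\<tau> ^^ (n div q)) (F q) = F q" if q: "q \<in> prime_factors n" for q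
  proof -
    interpret m: fhom "\<tau> ^^ (n div q)" by (rule \<tau>.funpow_fhom)
    have "monom 1 (n div q) * (W * Npoly n q) - W * Npoly n q = W * Xm1 n"
      unfolding Npoly_mult[OF prime_factorD(1)[OF q], symmetric] by (simp add: Xm1_def algebra_simps)
    hence "Xm1 n dvd monom 1 (n div q) * (W * Npoly n q) - W * Npoly n q" by simp
    from \<tau>.pw_cong[OF y0 yn this]
    have "(\<tau> ^^ (n div q)) (pw \<tau> (W * Npoly n q) y) = pw \<tau> (W * Npoly n q) y"
      by (simp add: \<tau>.pw_mult[OF y0, of "monom 1 (n div q)"] \<tau>.pw_monom)
    thus ?thesis by (simp add: F_def m.hom_mult \<tau>.pw_funpow z_period[OF q])
  qed

  have zp: "\<zeta> powi m = 1" if "int p dvd m" for m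
  proof -
    from that obtain l where "m = int p * l" by (auto elim: dvdE)
    thus ?thesis using zeta by (simp add: power_int_mult primitive_root_of_unity_def)
  qed
  have zeta0: "\<zeta> \<noteq> 0" using zeta p1 by (auto simp: primitive_root_of_unity_def power_0_left)
  have sigma_y: "\<sigma> (pw \<tau> G y) = pw \<tau> G y" if "int p dvd poly G (int t)" for G
  proof -
    have "\<sigma> (pw \<tau> G y) = \<zeta> powi (poly G (int t)) * pw \<tau> G y"
      by (rule \<tau>.pw_eigen) (use zeta0 zeta fix_k sigma_Y in \<open>auto simp: y_funpow intro: \<sigma>.fhom_axioms\<close>)
    thus ?thesis by (simp add: zp that)
  qed
  have sigma_pz: "\<sigma> (pw \<tau> G (z q)) = pw \<tau> G (z q)" for G q
  proof -
    have "\<sigma> ((\<tau> ^^ i) (z q)) = (\<tau> ^^ i) (z q)" for i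
      using fix_k omega
      by (simp add: tau_z \<sigma>.hom_sum \<sigma>.hom_mult \<sigma>.hom_power sigma_V sigma_u)
    hence "\<sigma> (pw \<tau> G (z q)) = 1 powi (poly G (int t)) * pw \<tau> G (z q)"
      by (intro \<tau>.pw_eigen) (auto intro: \<sigma>.fhom_axioms)
    thus ?thesis by simp
  qed
  have idl_t: "int p dvd poly x (int t)" if "x \<in> idl (gens n)" for x
    using that
  proof (induction rule: idl.induct)
    case (step s y r)
    hence "int p dvd poly s (int t)" using t by (auto simp: gens_def)
    thus ?case using step by simp
  qed auto
  have "int p dvd poly g (int t)"
    using dvd_add[OF idl_t[OF g] f(3)] by simp
  hence sigma_e: "\<sigma> e = e"
    by (simp add: e_def \<sigma>.hom_mult \<sigma>.hom_prod sigma_y sigma_pz)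
  have sigma_F: "\<sigma> (F q) = F q" if q: "q \<in> prime_factors n" for q
    using sigma_y[of "W * Npoly n q"] t(1)[OF q] by (simp add: F_def \<sigma>.hom_mult sigma_pz)

  \<comment> \<open>One invariant for each pair (a, b), which bounds their number by p n: row 1
    holds the resolvents of e, the place of u holds \<open>u ^ n\<close>, the first n/q places of
    row q hold the resolvents of F q, and every other place keeps \<open>V a b\<close>.\<close>
  define Bf where "Bf a b = (if a = 1 then res \<tau> \<omega> n e b / u ^ b
     else if a = 0 \<and> b = 1 mod n then u ^ n
     else if a \<in> prime_factors n \<and> b < n div a then res \<tau> (\<omega> ^ a) (n div a) (F a) b / u ^ (a * b)
     else V a b)" for a b
  define B where "B = (\<lambda>(a, b). Bf a b) ` ({..<p} \<times> {..<n})"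
  have finB: "finite B" by (simp add: B_def)
  have cardB: "card B \<le> p * n" unfolding B_def
    by (rule order.trans[OF card_image_le]) auto
  have Bf_B: "Bf a b \<in> B" if "a < p" "b < n" for a b
    unfolding B_def by (rule image_eqI[of _ _ "(a, b)"]) (use that in auto)

  have omega_fix: "\<tau> \<omega> = \<omega>" "\<sigma> \<omega> = \<omega>" using omega fix_k by auto
  have tau_L: "\<tau> x \<in> L" if "x \<in> L" for x
    using that unfolding L
  proof (rule \<tau>.hom_gf_image)
    fix s assume "s \<in> k \<union> {Y a j |a j. a < p \<and> j < n}"
    thus "\<tau> s \<in> gf (k \<union> {Y a j |a j. a < p \<and> j < n})"
      using Y_in_L unfolding L by (auto simp: fix_k tau_Y intro: gf_incl)
  qed
  have taun_L: "(\<tau> ^^ i) x \<in> L" if "x \<in> L" for x i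
    by (induction i) (auto simp: that tau_L)
  have u_L: "u \<in> L" unfolding u_def using p1 by (intro U_in_L) auto
  have omega_L: "\<omega> \<in> L" unfolding L using omega by (intro gf_incl) auto
  have V_L: "V a b \<in> L" if "a < p" for a b
    using U_in_L[OF that, of b] u_L unfolding V_def L by (intro gf_closed)
  have z_L: "z q \<in> L" if "q \<in> prime_factors n" for q
    using V_L[of q] prime_factorD[OF that] u_L unfolding z_def L by (intro gf_closed) auto
  have pw_L: "pw \<tau> G x \<in> L" if "x \<in> L" for G x
    using that tau_L unfolding L by (intro \<tau>.pw_closed) auto
  have y_L: "y \<in> L" using p1 unfolding y_def by (intro Y_in_L)
  have e_L: "e \<in> L" using pw_L[OF y_L] pw_L[OF z_L] unfolding e_def L
    by (intro gf_closed) auto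
  have F_L: "F q \<in> L" if "q \<in> prime_factors n" for q
    using pw_L[OF y_L] pw_L[OF z_L[OF that]] unfolding F_def L by (intro gf_closed)
  have res_L: "res \<tau> w m x b \<in> L" if "w \<in> L" "x \<in> L" for w m x b
    using taun_L[OF that(2)] that(1) unfolding res_def L by (intro gf_closed)
  have omega_pow_L: "\<omega> ^ i \<in> L" for i using omega_L unfolding L by (intro gf_closed)
  have BL: "B \<subseteq> L"
  proof
    fix x assume "x \<in> B"
    then obtain a b where ab: "a < p" "b < n" "x = Bf a b" by (auto simp: B_def)
    have "res \<tau> \<omega> n e b / u ^ b \<in> L" "u ^ n \<in> L"
      using res_L[OF omega_L e_L] u_L unfolding L by (auto intro!: gf_closed)
    moreover have "res \<tau> (\<omega> ^ a) (n div a) (F a) b / u ^ (a * b) \<in> L" if "a \<in> prime_factors n"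
      using res_L[OF omega_pow_L F_L[OF that]] u_L unfolding L by (auto intro!: gf_closed)
    ultimately show "x \<in> L" using V_L[OF ab(1)] by (auto simp: ab Bf_def)
  qed
  have res_sigma: "\<sigma> (res \<tau> w m x b) = res \<tau> w m x b"
    if "\<sigma> w = w" "\<And>i. \<sigma> ((\<tau> ^^ i) x) = (\<tau> ^^ i) x" for w m x b
    using that by (simp add: res_def \<sigma>.hom_sum \<sigma>.hom_mult \<sigma>.hom_power)
  have sigma_tau: "\<sigma> ((\<tau> ^^ i) e) = (\<tau> ^^ i) e" for i
  proof -
    interpret i: fhom "\<tau> ^^ i" by (rule \<tau>.funpow_fhom)
    have "int p dvd poly (monom 1 i * g) (int t)" using \<open>int p dvd poly g (int t)\<close> by simp
    from sigma_y[OF this] have "\<sigma> ((\<tau> ^^ i) (pw \<tau> g y)) = (\<tau> ^^ i) (pw \<tau> g y)"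
      by (simp add: \<tau>.pw_mult[OF y0] \<tau>.pw_monom)
    moreover have "\<sigma> ((\<tau> ^^ i) (pw \<tau> (c q) (z q))) = (\<tau> ^^ i) (pw \<tau> (c q) (z q))"
      if "q \<in> prime_factors n" for q
      using sigma_pz[of "monom 1 i * c q" q] z0[OF that] by (simp add: \<tau>.pw_mult \<tau>.pw_monom)
    ultimately show ?thesis by (simp add: e_def i.hom_mult i.hom_prod \<sigma>.hom_mult \<sigma>.hom_prod)
  qed
  have sigma_tauF: "\<sigma> ((\<tau> ^^ i) (F q)) = (\<tau> ^^ i) (F q)" if q: "q \<in> prime_factors n" for i q
  proof -
    interpret i: fhom "\<tau> ^^ i" by (rule \<tau>.funpow_fhom)
    have "int p dvd poly (monom 1 i * (W * Npoly n q)) (int t)" using t(1)[OF q] by simp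
    from sigma_y[OF this] have "\<sigma> ((\<tau> ^^ i) (pw \<tau> (W * Npoly n q) y)) = (\<tau> ^^ i) (pw \<tau> (W * Npoly n q) y)"
      by (simp add: \<tau>.pw_mult[OF y0, of "monom 1 i"] \<tau>.pw_monom)
    moreover have "\<sigma> ((\<tau> ^^ i) (pw \<tau> (d q) (z q))) = (\<tau> ^^ i) (pw \<tau> (d q) (z q))"
      using sigma_pz[of "monom 1 i * d q" q] z0[OF that] by (simp add: \<tau>.pw_mult \<tau>.pw_monom)
    ultimately show ?thesis by (simp add: F_def i.hom_mult \<sigma>.hom_mult)
  qed
  have fix_B: "\<sigma> x = x \<and> \<tau> x = x" if "x \<in> B" for x
  proof -
    from that obtain a b where ab: "a < p" "b < n" "x = Bf a b" by (auto simp: B_def)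
    have "\<tau> (res \<tau> \<omega> n e b) = \<omega> ^ b * res \<tau> \<omega> n e b"
      using omega_power omega_fix en by (intro \<tau>.res_eigen)
    hence 1: "\<tau> (res \<tau> \<omega> n e b / u ^ b) = res \<tau> \<omega> n e b / u ^ b"
      using omega_power by (simp add: \<tau>.hom_divide \<tau>.hom_power tau_u power_mult_distrib)
    have 2: "\<sigma> (res \<tau> \<omega> n e b / u ^ b) = res \<tau> \<omega> n e b / u ^ b"
      by (simp add: \<sigma>.hom_divide \<sigma>.hom_power sigma_u res_sigma[OF omega_fix(2) sigma_tau])
    have 3: "\<tau> (u ^ n) = u ^ n" "\<sigma> (u ^ n) = u ^ n"
      using omega_power by (auto simp: \<tau>.hom_power \<sigma>.hom_power tau_u sigma_u power_mult_distrib)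
    have 4: "\<tau> (res \<tau> (\<omega> ^ a) (n div a) (F a) b / u ^ (a * b)) = res \<tau> (\<omega> ^ a) (n div a) (F a) b / u ^ (a * b)"
      if a: "a \<in> prime_factors n"
    proof -
      have "(\<omega> ^ a) ^ (n div a) = 1"
        using prime_factorD(1)[OF a] omega_power by (simp flip: power_mult)
      hence "\<tau> (res \<tau> (\<omega> ^ a) (n div a) (F a) b) = (\<omega> ^ a) ^ b * res \<tau> (\<omega> ^ a) (n div a) (F a) b"
        using omega_fix Fn[OF a] by (intro \<tau>.res_eigen) (auto simp: \<tau>.hom_power)
      thus ?thesis using omega_power
        by (simp add: \<tau>.hom_divide \<tau>.hom_power tau_u power_mult_distrib power_mult)
    qed
    have 5: "\<sigma> (res \<tau> (\<omega> ^ a) (n div a) (F a) b / u ^ (a * b)) = res \<tau> (\<omega> ^ a) (n div a) (F a) b / u ^ (a * b)"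
      if a: "a \<in> prime_factors n"
    proof -
      have "\<sigma> (\<omega> ^ a) = \<omega> ^ a" by (simp add: \<sigma>.hom_power omega_fix)
      thus ?thesis by (simp add: \<sigma>.hom_divide \<sigma>.hom_power sigma_u res_sigma[OF _ sigma_tauF[OF a]])
    qed
    show ?thesis using 1 2 3 4 5 tau_V sigma_V by (auto simp: ab Bf_def)
  qed

  define T where "T = k \<union> B"
  \<comment> \<open>With u adjoined, the divisions by powers of u in \<open>Bf\<close> can be
    undone; u is removed again at the end.\<close>
  define T' where "T' = insert u T"
  have omega_T: "\<omega> \<in> gf T" "\<zeta> \<in> gf T" using omega zeta by (auto simp: T_def intro: gf_incl)
  have gfT': "gf T \<subseteq> gf T'" by (intro gf_mono) (auto simp: T'_def)
  have u_T': "u \<in> gf T'" by (auto simp: T'_def intro: gf_incl)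
  have omega_T': "\<omega> \<in> gf T'" using omega_T gfT' by auto
  have B_T': "x \<in> gf T'" if "x \<in> B" for x using that by (auto simp: T'_def T_def intro: gf_incl)
  have tau_T': "\<tau> x \<in> gf T'" if "x \<in> gf T'" for x
    using that
  proof (rule \<tau>.hom_gf_image)
    fix s assume "s \<in> T'"
    thus "\<tau> s \<in> gf T'"
      using fix_B fix_k tau_u gf_mult[OF omega_T' u_T'] by (auto simp: T'_def T_def intro: gf_incl)
  qed
  note pw_T' = \<tau>.pw_closed[OF tau_T']
  have e_T': "e \<in> gf T'"
  proof -
    have "res \<tau> \<omega> n e b \<in> gf T'" if "b < n" for b
    proof -
      have "Bf 1 b * u ^ b \<in> gf T'" using B_T'[OF Bf_B[OF p1 that]] u_T' by (intro gf_closed)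
      thus ?thesis using u_nonzero by (simp add: Bf_def)
    qed
    from res_inversion_gf[OF omega(1) omega_T' n(1) omega(3) this]
    show ?thesis by simp
  qed
  have F_T': "F q \<in> gf T'" if q: "q \<in> prime_factors n" for q
  proof -
    note pf = prime_factorD[OF q]
    have w: "primitive_root_of_unity (n div q) (\<omega> ^ q)"
      using pf n by (intro primitive_root_power[OF omega(1)])
    have "res \<tau> (\<omega> ^ q) (n div q) (F q) b \<in> gf T'" if "b < n div q" for b
    proof -
      have "Bf q b * u ^ (q * b) \<in> gf T'" using B_T'[OF Bf_B[of q b]] u_T' that pf by (intro gf_closed) auto
      thus ?thesis using u_nonzero that q pf by (auto simp: Bf_def)
    qed
    from res_inversion_gf[OF w gf_power[OF omega_T'] pf(5,7) this]
    show ?thesis by simp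
  qed
  \<comment> \<open>Cramer's rule for the block of q. Let g act on F q and
    \<open>W * Npoly n q\<close> on e: in the quotient the parts in y cancel, W kills the parts in z
    r for r \<noteq> q, and the polynomial left on z q is 1 modulo
    \<open>Xm1 (n div q)\<close>.\<close>
  have z_T': "z q \<in> gf T'" if q: "q \<in> prime_factors n" for q
  proof -
    let ?N = "W * Npoly n q"
    have 1: "pw \<tau> ?N (\<Prod>r\<in>prime_factors n. pw \<tau> (c r) (z r)) = pw \<tau> (of_nat q * W * c q) (z q)"
    proof -
      have "pw \<tau> ?N (\<Prod>r\<in>prime_factors n. pw \<tau> (c r) (z r)) = (\<Prod>r\<in>prime_factors n. pw \<tau> (?N * c r) (z r))"
        by (simp add: \<tau>.pw_prod_arg \<tau>.pw_mult[OF z0, symmetric] cong: prod.cong)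
      also have "\<dots> = (\<Prod>r\<in>prime_factors n. if r = q then pw \<tau> (?N * c q) (z q) else 1)"
      proof (rule prod.cong)
        fix r assume r: "r \<in> prime_factors n"
        show "pw \<tau> (?N * c r) (z r) = (if r = q then pw \<tau> (?N * c q) (z q) else 1)"
        proof (cases "r = q")
          case False
          have "Xm1 (n div r) dvd ?N * c r" using W[OF r q False] by (simp add: mult.commute dvd_mult2)
          from \<tau>.pw_eq_1[OF z0[OF r] z_period[OF r] this] False show ?thesis by simp
        qed auto
      qed auto
      also have "\<dots> = pw \<tau> (?N * c q) (z q)" using q by simp
      also have "\<dots> = pw \<tau> (of_nat q * W * c q) (z q)"
      proof (rule \<tau>.pw_cong[OF z0[OF q] z_period[OF q]])
        have "?N * c q - of_nat q * W * c q = (Npoly n q - of_nat q) * (W * c q)" by (simp add: algebra_simps)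
        thus "Xm1 (n div q) dvd ?N * c q - of_nat q * W * c q"
          using Xm1_dvd_Npoly_minus by simp
      qed
      finally show ?thesis .
    qed
    have "pw \<tau> ?N e = pw \<tau> (g * ?N) y * pw \<tau> (of_nat q * W * c q) (z q)"
      by (simp add: e_def \<tau>.pw_mult_arg 1 \<tau>.pw_mult[OF y0, symmetric] mult.commute)
    moreover have "pw \<tau> g (F q) = pw \<tau> (g * ?N) y * pw \<tau> (g * d q) (z q)"
      by (simp add: F_def \<tau>.pw_mult_arg \<tau>.pw_mult[OF y0, symmetric] \<tau>.pw_mult[OF z0[OF q], symmetric])
    ultimately have "pw \<tau> g (F q) / pw \<tau> ?N e = pw \<tau> (g * d q - of_nat q * W * c q) (z q)"
      using \<tau>.pw_nonzero[OF y0] by (simp add: \<tau>.pw_diff[OF z0[OF q]])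
    also have "\<dots> = z q" using \<tau>.pw_cong[OF z0[OF q] z_period[OF q] cd[OF q]] by simp
    finally show ?thesis using gf_divide[OF pw_T'[OF _ F_T'[OF q], of g] pw_T'[OF _ e_T', of ?N]] by simp
  qed
  have g_T': "pw \<tau> g y \<in> gf T'"
  proof -
    have "e / (\<Prod>q\<in>prime_factors n. pw \<tau> (c q) (z q)) \<in> gf T'"
      by (intro gf_closed e_T' pw_T' z_T')
    thus ?thesis using z0 by (simp add: e_def \<tau>.pw_nonzero)
  qed
  have N_T': "pw \<tau> (Npoly n q) y \<in> gf T'" if q: "q \<in> prime_factors n" for q
  proof -
    let ?N = "W * Npoly n q"
    have "F q / pw \<tau> (d q) (z q) \<in> gf T'"
      by (intro gf_closed F_T' pw_T' z_T' q)
    hence WN: "pw \<tau> ?N y \<in> gf T'" using z0[OF q] by (simp add: F_def \<tau>.pw_nonzero)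
    \<comment> \<open>Multiplied by \<open>Npoly n q\<close>, the congruence modulo
      \<open>Xm1 (n div q)\<close> becomes one modulo \<open>Xm1 n\<close>, which expresses
      \<open>Npoly n q\<close> through g and \<open>W * Npoly n q\<close>.\<close>
    obtain h where h: "g * d q - of_nat q * W * c q - 1 = Xm1 (n div q) * h" using cd[OF q] by (auto elim: dvdE)
    have "Npoly n q * d q * g - of_nat q * c q * ?N - Npoly n q = Npoly n q * (g * d q - of_nat q * W * c q - 1)"
      by (simp add: algebra_simps)
    also have "\<dots> = Xm1 n * h" unfolding h Npoly_mult[OF prime_factorD(1)[OF q], symmetric] by simp
    finally have "Xm1 n dvd (Npoly n q * d q * g - of_nat q * c q * ?N) - Npoly n q" by simp
    from \<tau>.pw_cong[OF y0 yn this]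
    have "pw \<tau> (Npoly n q) y = pw \<tau> (Npoly n q * d q) (pw \<tau> g y) / pw \<tau> (of_nat q * c q) (pw \<tau> ?N y)"
      by (simp only: \<tau>.pw_diff[OF y0] \<tau>.pw_mult[OF y0, of "_ * d q"] \<tau>.pw_mult[OF y0, of _ ?N])
    also have "\<dots> \<in> gf T'" by (intro gf_closed pw_T' g_T' WN)
    finally show ?thesis .
  qed
  have f_idl: "insert f (gens n) \<subseteq> idl (insert g (gens n))"
  proof -
    have "1 * g + - (g - f) \<in> idl (insert g (gens n))" by (intro idl_insertI idl_uminus g)
    thus ?thesis by (auto intro: idl_incl)
  qed
  have ideal_T': "pw \<tau> x y \<in> gf T'" if "x \<in> idl (insert f (gens n))" for x
  proof (rule \<tau>.pw_idl_closed[OF tau_T' y0])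
    show "x \<in> idl (insert g (gens n))" using that idl_least[OF f_idl] by blast
    show "pw \<tau> G y \<in> gf T'" if "G \<in> insert g (gens n)" for G
      using that g_T' N_T' \<tau>.pw_Xm1[OF y0 yn] by (auto simp: gens_def)
  qed
  \<comment> \<open>These are the two generators of (p, X - t). The first makes y a p-th root over
    \<open>gf T'\<close>; the second makes \<open>gf (insert y T')\<close> stable under \<tau>, so
    that it contains all conjugates of y.\<close>
  have yp: "y ^ p \<in> gf T'" using ideal_T'[OF f(1)] by (simp add: \<tau>.pw_of_nat)
  have yt: "\<tau> y / y ^ t \<in> gf T'" using ideal_T'[OF f(2)]
    by (simp add: \<tau>.pw_diff[OF y0] \<tau>.pw_of_nat \<tau>.pw_monom)
  have V_T': "V q b \<in> gf T'" if q: "q \<in> prime_factors n" and b: "b < n div q" for q b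
  proof -
    have "(\<tau> ^^ i) (z q) \<in> gf T'" for i by (induction i) (auto simp: z_T' q tau_T')
    hence "res \<tau> (\<omega> ^ q) (n div q) (z q) b / (of_nat (n div q) * u ^ (q * b)) \<in> gf T'"
      unfolding res_def by (intro gf_closed omega_T' u_T')
    thus ?thesis unfolding res_z[OF q b] using prime_factorD(7)[OF q] u_nonzero by simp
  qed
  have U_T': "U a b \<in> gf T'" if a: "a < p" "a \<noteq> 1" and b: "b < n" for a b
  proof -
    have "V a b \<in> gf T' \<Longrightarrow> U a b \<in> gf T'"
      using gf_mult[OF _ gf_power[OF u_T', of b], of "V a b"] u_nonzero by (simp add: V_def)
    moreover have "V a b \<in> gf T'" if "\<not> (a = 0 \<and> b = 1 mod n)"
      using that V_T'[of a b] B_T'[OF Bf_B[OF a(1) b]] a by (auto simp: Bf_def split: if_splits)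
    moreover have "U a b \<in> gf T'" if "a = 0 \<and> b = 1 mod n" using u_T' that by (simp add: u_def)
    ultimately show ?thesis by blast
  qed
  have k_T': "k \<subseteq> gf T'" by (auto simp: T'_def T_def intro: gf_incl)
  have Z_T': "Z a j \<in> gf T'" if "a < p" "a \<noteq> 1" for a j
    using Z_in_gf_U[OF k_T' U_T'] that by blast
  have gfT'': "gf T' \<subseteq> gf (insert y T')" by (intro gf_mono) auto
  have y_T'': "y \<in> gf (insert y T')" by (intro gf_incl) auto
  have Y1: "Y 1 j \<in> gf (insert y T')" for j
  proof -
    have "\<tau> x \<in> gf (insert y T')" if "x \<in> gf (insert y T')" for x
      using that
    proof (rule \<tau>.hom_gf_image)
      fix s assume "s \<in> insert y T'"
      thus "\<tau> s \<in> gf (insert y T')"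
      proof
        assume "s = y"
        have "(\<tau> y / y ^ t) * y ^ t \<in> gf (insert y T')"
          using yt gfT'' y_T'' by (intro gf_mult gf_power) auto
        thus ?thesis using y0 \<open>s = y\<close> by simp
      next
        assume "s \<in> T'"
        thus ?thesis using tau_T' gfT'' gf_incl by blast
      qed
    qed
    hence "(\<tau> ^^ j) y \<in> gf (insert y T')" by (induction j) (auto intro: y_T'')
    thus ?thesis by (simp add: y_funpow)
  qed
  have LT: "L \<subseteq> gf (insert y T')" unfolding L
  proof (intro gf_least subsetI)
    fix x assume "x \<in> k \<union> {Y a j |a j. a < p \<and> j < n}"
    then consider "x \<in> k" | a j where "x = Y a j" "a < p" by auto
    thus "x \<in> gf (insert y T')"
    proof cases
      case 1
      thus ?thesis using k_T' gfT'' by auto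
    next
      case 2
      show ?thesis
      proof (cases "a = 1")
        case False
        have "Z a j * Y 1 j ^ a \<in> gf (insert y T')"
          using Z_T'[OF 2(2) False] gfT'' Y1 by (intro gf_mult gf_power) auto
        thus ?thesis using Y_nonzero[OF p1] 2 by (simp add: Z_def)
      qed (use 2 Y1 in simp)
    qed
  qed
  \<comment> \<open>Two Kummer descents: invariance under \<sigma> removes y, then invariance under
    \<tau> removes u.\<close>
  have "{x \<in> L. \<sigma> x = x \<and> \<tau> x = x} \<subseteq> gf T"
  proof safe
    fix x assume x: "x \<in> L" "\<sigma> x = x" "\<tau> x = x"
    have "x \<in> gf T'"
    proof (rule \<sigma>.kummer_fixed[where z = \<zeta> and w = y and m = p])
      show "\<sigma> s = s" if "s \<in> T'" for s using that fix_B fix_k sigma_u by (auto simp: T'_def T_def)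
      show "\<sigma> y = \<zeta> * y" using sigma_Y[of 1 0] by (simp add: y_def)
    qed (use x LT zeta p1 yp omega_T gfT' in auto)
    hence x': "x \<in> gf (insert u T)" by (simp add: T'_def)
    show "x \<in> gf T"
    proof (rule \<tau>.kummer_fixed[where z = \<omega> and w = u and m = n])
      show "\<tau> s = s" if "s \<in> T" for s using that fix_B fix_k by (auto simp: T_def)
      have "Bf 0 (1 mod n) = u ^ n" by (simp add: Bf_def)
      hence "u ^ n \<in> B" using Bf_B[of 0 "1 mod n"] n by auto
      thus "u ^ n \<in> gf T" by (intro gf_incl) (auto simp: T_def)
    qed (use x x' n omega omega_T tau_u in auto)
  qed
  moreover have "gf T \<subseteq> {x \<in> L. \<sigma> x = x \<and> \<tau> x = x}"
  proof -
    have "gf T \<subseteq> L" unfolding L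
      using BL unfolding L T_def by (intro gf_least) (auto intro: gf_incl)
    moreover have "\<sigma> x = x" "\<tau> x = x" if "x \<in> gf T" for x
      using \<sigma>.hom_gf_fixed[OF that] \<tau>.hom_gf_fixed[OF that] fix_B fix_k by (auto simp: T_def)
    ultimately show ?thesis by auto
  qed
  ultimately show ?thesis using BL finB cardB unfolding T_def by blast
qed

end

subsection \<open>Algebraic dependence\<close>

definition alg :: "'a::field set \<Rightarrow> 'a \<Rightarrow> bool" where
  "alg S x \<longleftrightarrow> (\<exists>P. P \<noteq> 0 \<and> (\<forall>i. Polynomial.coeff P i \<in> gf S) \<and> poly P x = 0)"

lemma ring_of_type_algebra_eval:
  "ring.eval ring_of_type_algebra p (x::'a::field) = poly (Poly (rev p)) x"
proof -
  interpret R: Ring.field "ring_of_type_algebra :: 'a ring" by (rule field_from_type_algebra)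
  have pow: "x [^]\<^bsub>ring_of_type_algebra\<^esub> (m::nat) = x ^ m" for m
    by (induction m) (auto simp: ring_of_type_algebra_def mult.commute)
  show ?thesis
    by (induction p) (auto simp: Poly_append pow poly_monom,
        auto simp: ring_of_type_algebra_def poly_monom algebra_simps)
qed

lemma subfield_gf: "subfield (gf S) (ring_of_type_algebra :: 'a::field ring)"
proof -
  interpret R: Ring.field "ring_of_type_algebra :: 'a ring" by (rule field_from_type_algebra)
  show ?thesis by (rule R.generate_field_is_subfield) (simp add: ring_of_type_algebra_def)
qed

text \<open>Gives access to the theory of finite extensions, from which \<open>alg_trans\<close> is
  derived.\<close>

lemma alg_iff_algebraic:
  "alg S (x::'a::field) \<longleftrightarrow> (ring.algebraic ring_of_type_algebra over gf S) x"
proof -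
  let ?R = "ring_of_type_algebra :: 'a ring"
  interpret R: Ring.field ?R by (rule field_from_type_algebra)
  have carr: "p \<in> carrier (univ_poly ?R (gf S)) \<longleftrightarrow> p = [] \<or> (set p \<subseteq> gf S \<and> hd p \<noteq> 0)" for p
    by (simp add: univ_poly_def polynomial_def ring_of_type_algebra_def)
  show ?thesis
  proof
    assume "alg S x"
    then obtain P where P: "P \<noteq> 0" "\<And>i. Polynomial.coeff P i \<in> gf S" "poly P x = 0"
      unfolding alg_def by blast
    have "set (coeffs P) \<subseteq> gf S" using P(2) by (auto simp: coeffs_def)
    hence "rev (coeffs P) \<in> carrier (univ_poly ?R (gf S))"
      using P(1) by (simp add: carr hd_rev last_coeffs_eq_coeff_degree)
    thus "(R.algebraic over gf S) x"
      by (rule R.algebraicI) (use P in \<open>auto simp: ring_of_type_algebra_eval, auto simp: ring_of_type_algebra_def\<close>)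
  next
    assume *: "(R.algebraic over gf S) x"
    obtain p where p: "p \<in> carrier (univ_poly ?R (gf S))" "p \<noteq> []" "R.eval p x = \<zero>\<^bsub>?R\<^esub>"
      by (rule R.algebraicE[OF subfieldE(1)[OF subfield_gf] _ *]) (auto simp: ring_of_type_algebra_def)
    have "set p \<subseteq> gf S" "hd p \<noteq> 0" using p by (auto simp: carr)
    moreover have "Polynomial.coeff (Poly (rev p)) (length p - 1) = hd p"
      using p(2) by (simp add: nth_default_def rev_nth hd_conv_nth)
    ultimately have "Poly (rev p) \<noteq> 0" by (metis coeff_0)
    moreover have "Polynomial.coeff (Poly (rev p)) i \<in> gf S" for i
      using \<open>set p \<subseteq> gf S\<close> by (auto simp: nth_default_def rev_nth)
    moreover have "poly (Poly (rev p)) x = 0"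
      using p(3) by (simp add: ring_of_type_algebra_eval) (simp add: ring_of_type_algebra_def)
    ultimately show "alg S x" unfolding alg_def by blast
  qed
qed

lemma alg_gf: "x \<in> gf S \<Longrightarrow> alg S x"
  unfolding alg_def by (intro exI[of _ "[:-x, 1:]"]) (auto simp: coeff_pCons gf_uminus split: nat.splits)

lemma alg_mono: "alg S x \<Longrightarrow> S \<subseteq> gf T \<Longrightarrow> alg T x"
  unfolding alg_def using gf_least[of S T] by blast

text \<open>Only the finitely many coefficients of one equation for x matter: they generate a finite
  extension F of \<open>gf S\<close>, and x generates a finite extension of F, so x lies in a finite
  extension of \<open>gf S\<close>.\<close>

lemma alg_trans:
  assumes "alg T x" "\<And>y. y \<in> T \<Longrightarrow> alg S y"
  shows "alg S (x::'a::field)"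
proof -
  let ?R = "ring_of_type_algebra :: 'a ring"
  interpret R: Ring.field ?R by (rule field_from_type_algebra)
  have carr [simp]: "x \<in> carrier ?R" for x by (simp add: ring_of_type_algebra_def)
  define A where "A = {y \<in> carrier ?R. (R.algebraic over gf S) y}"
  have A: "subfield A ?R" unfolding A_def by (rule R.subfield_of_algebraics[OF subfield_gf])
  have "T \<subseteq> A" using assms(2) by (auto simp: A_def alg_iff_algebraic)
  hence TA: "gf T \<subseteq> A" using R.generate_field_min_subfield1[of T A] A by (metis UNIV_I carr subsetI)
  obtain P where P: "P \<noteq> 0" "\<And>i. Polynomial.coeff P i \<in> gf T" "poly P x = 0"
    using assms(1) unfolding alg_def by blast
  define xs where "xs = coeffs P"
  have xs: "(R.algebraic over gf S) y" if "y \<in> set xs" for y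
    using that P(2) TA by (auto simp: xs_def coeffs_def A_def split: if_splits)
  define F where "F = R.finite_extension (gf S) xs"
  have F: "subfield F ?R" "R.finite_dimension (gf S) F"
    unfolding F_def
    by (rule R.finite_extension_is_subfield[OF subfield_gf _ xs]
        R.finite_extension_finite_dimension(1)[OF subfield_gf _ xs]; simp add: subset_iff)+
  have memF: "set xs \<subseteq> F" unfolding F_def
    by (rule R.finite_extension_mem[OF subfieldE(1)[OF subfield_gf]]) auto
  have "gf F = F"
    using R.generate_field_min_subfield1[of F F] F(1) gf_incl[of _ F] by auto
  moreover have "Polynomial.coeff P i \<in> F" for i
  proof (cases "i \<le> Polynomial.degree P")
    case True
    thus ?thesis using memF coeff_in_coeffs[OF P(1)] by (auto simp: xs_def)
  next
    case False
    thus ?thesis using gf_zero[of F] \<open>gf F = F\<close> by (simp add: coeff_eq_0)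
  qed
  hence "alg F x" using P \<open>gf F = F\<close> unfolding alg_def by auto
  ultimately have xF: "(R.algebraic over F) x" by (simp add: alg_iff_algebraic)
  define E where "E = R.simple_extension F x"
  have "R.finite_dimension F E"
    unfolding E_def using R.finite_dimension_simple_extension[OF F(1)] xF by simp
  hence E: "R.finite_dimension (gf S) E"
    by (rule R.telescopic_base_dim(1)[OF subfield_gf F])
  have "subring E ?R" "x \<in> E"
    unfolding E_def using subfieldE(1)[OF F(1)]
    by (auto intro: R.simple_extension_is_subring R.simple_extension_mem)
  with E show ?thesis
    using R.finite_dimension_imp_algebraic[OF subfield_gf] by (simp add: alg_iff_algebraic)
qed

lemma common_denominator:
  assumes R: "(1::'a::field) \<in> R" "\<And>a b. a \<in> R \<Longrightarrow> b \<in> R \<Longrightarrow> a * b \<in> R"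
    and "finite I" "\<And>i. i \<in> I \<Longrightarrow> \<exists>a b. a \<in> R \<and> b \<in> R \<and> b \<noteq> 0 \<and> x i = a / b"
  shows "\<exists>d. d \<in> R \<and> d \<noteq> 0 \<and> (\<forall>i\<in>I. d * x i \<in> R)"
  using assms(3,4)
proof (induction I rule: finite_induct)
  case empty
  thus ?case using R(1) by (intro exI[of _ 1]) auto
next
  case (insert i I)
  then obtain d where d: "d \<in> R" "d \<noteq> 0" "\<forall>i\<in>I. d * x i \<in> R" by auto
  obtain a b where ab: "a \<in> R" "b \<in> R" "b \<noteq> 0" "x i = a / b" using insert.prems[of i] by auto
  have "b * d * x j \<in> R" if "j \<in> insert i I" for j
  proof (cases "j = i")
    case True
    have "b * d * x i = d * a" using ab by simp
    thus ?thesis unfolding True using R(2)[OF d(1) ab(1)] by (simp only:)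
  next
    case False
    hence "b * (d * x j) \<in> R" using that d by (intro R(2)[OF ab(2)]) auto
    thus ?thesis by (simp add: mult.assoc)
  qed
  thus ?case using d ab R(2) by (intro exI[of _ "b * d"]) auto
qed

text \<open>Clearing denominators gives a polynomial relation between x and y over
  \<open>gf S\<close>, which H regards as an equation for y. Were H zero, its j-th coefficient, the
  value at x of a nonzero polynomial K over \<open>gf S\<close>, would vanish, making x algebraic
  over S.\<close>

lemma alg_exchange:
  fixes x y :: "'a::field"
  assumes "alg (insert y S) x" "\<not> alg S x"
  shows "alg (insert x S) y"
proof -
  define R where "R = {poly P y | P. \<forall>i. Polynomial.coeff P i \<in> gf S}"
  have R_poly: "poly P y \<in> R" if "\<And>i. Polynomial.coeff P i \<in> gf S" for P
    using that unfolding R_def by blast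
  have R_elem: "\<exists>P. x = poly P y \<and> (\<forall>i. Polynomial.coeff P i \<in> gf S)" if "x \<in> R" for x
    using that unfolding R_def by blast
  have R_const: "a \<in> R" if "a \<in> gf S" for a
    using R_poly[of "[:a:]"] that by (auto simp: coeff_pCons split: nat.splits)
  have R_y: "y \<in> R"
    using R_poly[of "[:0, 1:]"] by (auto simp: coeff_pCons split: nat.splits)
  have R: "1 \<in> R" "\<And>a. a \<in> R \<Longrightarrow> - a \<in> R" "\<And>a b. a \<in> R \<Longrightarrow> b \<in> R \<Longrightarrow> a + b \<in> R"
      "\<And>a b. a \<in> R \<Longrightarrow> b \<in> R \<Longrightarrow> a * b \<in> R"
  proof -
    fix a b assume "a \<in> R" "b \<in> R"
    then obtain P Q where "a = poly P y" "\<forall>i. Polynomial.coeff P i \<in> gf S"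
      "b = poly Q y" "\<forall>i. Polynomial.coeff Q i \<in> gf S" using R_elem by metis
    thus "- a \<in> R" "a + b \<in> R" "a * b \<in> R"
      using R_poly[of "- P"] R_poly[of "P + Q"] R_poly[of "P * Q"]
      by (auto simp: coeff_mult intro: gf_closed)
  qed (auto intro: R_const)
  obtain P where P: "P \<noteq> 0" "\<And>i. Polynomial.coeff P i \<in> gf (insert y S)" "poly P x = 0"
    using assms(1) unfolding alg_def by blast
  have "insert y S \<subseteq> R" using R_y R_const gf_incl by auto
  from gf_fraction[OF R this] P(2)
  have "\<exists>d. d \<in> R \<and> d \<noteq> 0 \<and> (\<forall>i\<in>{..Polynomial.degree P}. d * Polynomial.coeff P i \<in> R)"
    by (intro common_denominator R) auto
  then obtain d where d: "d \<noteq> 0" "\<And>i. i \<le> Polynomial.degree P \<Longrightarrow> d * Polynomial.coeff P i \<in> R" by auto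
  have "\<forall>i\<in>{..Polynomial.degree P}. \<exists>Q. d * Polynomial.coeff P i = poly Q y \<and> (\<forall>j. Polynomial.coeff Q j \<in> gf S)"
    using d(2) R_elem by auto
  from bchoice[OF this] obtain Q where
    Q: "\<And>i. i \<le> Polynomial.degree P \<Longrightarrow> d * Polynomial.coeff P i = poly (Q i) y"
       "\<And>i j. i \<le> Polynomial.degree P \<Longrightarrow> Polynomial.coeff (Q i) j \<in> gf S" by auto
  define H where "H = (\<Sum>i\<le>Polynomial.degree P. smult (x ^ i) (Q i))"
  have coeff_H: "Polynomial.coeff H j = (\<Sum>i\<le>Polynomial.degree P. Polynomial.coeff (Q i) j * x ^ i)" for j
    by (simp add: H_def coeff_sum mult.commute)
  have "poly H y = (\<Sum>i\<le>Polynomial.degree P. d * (Polynomial.coeff P i * x ^ i))"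
    by (auto simp: H_def poly_sum Q(1)[symmetric] intro!: sum.cong)
  also have "\<dots> = d * poly P x" by (simp add: poly_altdef sum_distrib_left)
  finally have "poly H y = 0" using P(3) by simp
  moreover have "Polynomial.coeff H j \<in> gf (insert x S)" for j
  proof -
    have "gf S \<subseteq> gf (insert x S)" by (rule gf_mono) auto
    moreover have "x \<in> gf (insert x S)" by (rule gf_incl) auto
    ultimately show ?thesis unfolding coeff_H using Q(2) by (intro gf_sum gf_mult gf_power) auto
  qed
  moreover have "H \<noteq> 0"
  proof
    assume "H = 0"
    have "Q (Polynomial.degree P) \<noteq> 0"
    proof
      assume "Q (Polynomial.degree P) = 0"
      hence "d * lead_coeff P = 0" using Q(1)[of "Polynomial.degree P"] by simp
      thus False using d P by simp
    qed
    then obtain j where j: "Polynomial.coeff (Q (Polynomial.degree P)) j \<noteq> 0"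
      by (meson leading_coeff_0_iff)
    define K where "K = (\<Sum>i\<le>Polynomial.degree P. Polynomial.monom (Polynomial.coeff (Q i) j) i)"
    have coeff_K: "Polynomial.coeff K i = (if i \<le> Polynomial.degree P then Polynomial.coeff (Q i) j else 0)" for i
      by (simp add: K_def coeff_sum)
    have "K \<noteq> 0" using j coeff_K[of "Polynomial.degree P"] by auto
    moreover have "poly K x = Polynomial.coeff H j"
      by (simp add: K_def poly_sum poly_monom coeff_H)
    ultimately have "alg S x" unfolding alg_def
      using \<open>H = 0\<close> Q(2) by (intro exI[of _ K]) (auto simp: coeff_K)
    thus False using assms(2) by simp
  qed
  ultimately show ?thesis unfolding alg_def by blast
qed

text \<open>Steinitz exchange: elements of S outside A are traded for elements of A while the size
  of S stays the same.\<close>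

lemma steinitz_bound:
  fixes A S :: "'a::field set"
  assumes A: "finite A" "\<And>x. x \<in> A \<Longrightarrow> \<not> alg (k \<union> (A - {x})) x"
    and "finite S" "\<And>x. x \<in> A \<Longrightarrow> alg (k \<union> S) x"
  shows "card A \<le> card S"
  using assms(3,4)
proof (induction "card (A - S)" arbitrary: S rule: less_induct)
  case less
  show ?case
  proof (cases "A \<subseteq> S")
    case False
    then obtain x where x: "x \<in> A" "x \<notin> S" by blast
    \<comment> \<open>Minimality of C makes the exchange lemma applicable to any s in C outside A.
      Such an s exists, because A \<inter> S lies in A - {x}, over which x is not algebraic.\<close>
    have "\<exists>C. A \<inter> S \<subseteq> C \<and> C \<subseteq> S \<and> alg (k \<union> C) x" using less.prems x by blast
    then obtain C where C: "A \<inter> S \<subseteq> C" "C \<subseteq> S" "alg (k \<union> C) x"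
      and min: "\<And>D. A \<inter> S \<subseteq> D \<Longrightarrow> D \<subset> C \<Longrightarrow> \<not> alg (k \<union> D) x"
    proof -
      define c where "c = arg_min card (\<lambda>C. A \<inter> S \<subseteq> C \<and> C \<subseteq> S \<and> alg (k \<union> C) x)"
      have c: "A \<inter> S \<subseteq> c \<and> c \<subseteq> S \<and> alg (k \<union> c) x"
        unfolding c_def by (rule arg_min_natI[where P = "\<lambda>C. A \<inter> S \<subseteq> C \<and> C \<subseteq> S \<and> alg (k \<union> C) x", of S])
          (use less.prems x in auto)
      have "\<not> alg (k \<union> D) x" if D: "A \<inter> S \<subseteq> D" "D \<subset> c" for D
      proof
        assume "alg (k \<union> D) x"
        hence "card c \<le> card D" unfolding c_def
          using D c by (intro arg_min_nat_le) auto
        moreover have "card D < card c" using D c less.prems(1) finite_subset by (intro psubset_card_mono) auto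
        ultimately show False by simp
      qed
      with c that show ?thesis by blast
    qed
    have "C \<noteq> A \<inter> S"
    proof
      assume "C = A \<inter> S"
      hence "k \<union> C \<subseteq> gf (k \<union> (A - {x}))" using x by (auto intro: gf_incl)
      from alg_mono[OF C(3) this] A(2)[OF x(1)] show False by simp
    qed
    then obtain s where s: "s \<in> C" "s \<notin> A" using C by blast
    define S' where "S' = insert x (S - {s})"
    have "\<not> alg (k \<union> (C - {s})) x" using s C by (intro min) auto
    moreover have "alg (insert s (k \<union> (C - {s}))) x"
      by (rule alg_mono[OF C(3)]) (auto intro: gf_incl)
    ultimately have "alg (insert x (k \<union> (C - {s}))) s" by (rule alg_exchange[rotated])
    hence "alg (k \<union> S') s" by (rule alg_mono) (use C in \<open>auto simp: S'_def intro: gf_incl\<close>)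
    hence "alg (k \<union> S') y" if "y \<in> k \<union> S" for y
      using that by (cases "y = s") (auto simp: S'_def intro!: alg_gf gf_incl)
    hence "alg (k \<union> S') y" if "y \<in> A" for y
      using alg_trans[OF less.prems(2)[OF that]] by blast
    moreover have "A - S' \<subset> A - S" using x s C by (auto simp: S'_def)
    hence "card (A - S') < card (A - S)" using A by (intro psubset_card_mono) auto
    moreover have "finite S'" using less.prems by (simp add: S'_def)
    ultimately have "card A \<le> card S'" by (intro less.hyps) auto
    also have "card S' = card S"
      using s C x less.prems(1) by (simp add: S'_def card.insert_remove) (metis card_Suc_Diff1 subsetD)
    finally show ?thesis .
  qed (use less.prems in \<open>auto intro: card_mono\<close>)
qed

text \<open>Read as a polynomial in one b, the relation has coefficients in the field generated by
  the other elements, so transcendence of b kills each of them. The induction then treats the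
  monomials with one fixed exponent of b.\<close>

lemma matroid_independent_coeffs_zero:
  fixes B :: "'a::field set" and e :: "'i \<Rightarrow> 'a \<Rightarrow> nat"
  assumes B: "\<And>b. b \<in> B \<Longrightarrow> \<not> alg (k \<union> (B - {b})) b"
  shows "finite C \<Longrightarrow> C \<subseteq> B \<Longrightarrow> finite M \<Longrightarrow> (\<And>m. m \<in> M \<Longrightarrow> c m \<in> gf k) \<Longrightarrow>
    (\<And>m m'. m \<in> M \<Longrightarrow> m' \<in> M \<Longrightarrow> \<forall>b\<in>C. e m b = e m' b \<Longrightarrow> m = m') \<Longrightarrow>
    (\<Sum>m\<in>M. c m * (\<Prod>b\<in>C. b ^ e m b)) = 0 \<Longrightarrow> m0 \<in> M \<Longrightarrow> c m0 = 0"
proof (induction C arbitrary: M m0 rule: finite_induct)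
  case empty
  hence "M = {m0}" by auto
  thus ?case using empty by simp
next
  case (insert b C)
  define a where "a m = c m * (\<Prod>x\<in>C. x ^ e m x)" for m
  define Q where "Q = (\<Sum>m\<in>M. Polynomial.monom (a m) (e m b))"
  have coeff_Q: "Polynomial.coeff Q i = (\<Sum>m\<in>{m\<in>M. e m b = i}. a m)" for i
    using insert.prems(2) by (simp add: Q_def coeff_sum sum.inter_filter[symmetric] if_distrib)
  have "Polynomial.coeff Q i \<in> gf (k \<union> (B - {b}))" for i
  proof -
    have "c m \<in> gf (k \<union> (B - {b}))" if "m \<in> M" for m
      using insert.prems(3)[OF that] gf_mono[of k "k \<union> (B - {b})"] by auto
    moreover have "x \<in> gf (k \<union> (B - {b}))" if "x \<in> C" for x
      using that insert.prems(1) insert.hyps by (intro gf_incl) auto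
    ultimately show ?thesis unfolding coeff_Q a_def by (intro gf_sum gf_mult gf_prod gf_power) auto
  qed
  moreover have "poly Q b = 0"
    using insert.prems(5) insert.hyps by (simp add: Q_def poly_sum poly_monom a_def mult_ac)
  ultimately have "Q = 0" using B[of b] insert.prems(1) unfolding alg_def by auto
  define M' where "M' = {m\<in>M. e m b = e m0 b}"
  show ?case
  proof (rule insert.IH[of M' m0])
    show "(\<Sum>m\<in>M'. c m * (\<Prod>b\<in>C. b ^ e m b)) = 0"
      using coeff_Q[of "e m0 b"] \<open>Q = 0\<close> by (simp add: a_def M'_def)
  qed (use insert.prems in \<open>auto simp: M'_def\<close>)
qed

lemma alg_independentI:
  fixes B :: "'a::field set"
  assumes B: "\<And>b. b \<in> B \<Longrightarrow> \<not> alg (k \<union> (B - {b})) b"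
  shows "alg_independent k B"
  unfolding alg_independent_def
proof (intro allI impI)
  fix P :: "('a \<Rightarrow>\<^sub>0 nat) \<Rightarrow>\<^sub>0 'a"
  assume k: "\<forall>m. Poly_Mapping.lookup P m \<in> k"
    and keys: "\<forall>m\<in>Poly_Mapping.keys P. Poly_Mapping.keys m \<subseteq> B"
    and sum: "(\<Sum>m\<in>Poly_Mapping.keys P. Poly_Mapping.lookup P m *
           (\<Prod>b\<in>Poly_Mapping.keys m. b ^ Poly_Mapping.lookup m b)) = 0"
  define C where "C = (\<Union>m\<in>Poly_Mapping.keys P. Poly_Mapping.keys m)"
  have prod: "(\<Prod>b\<in>Poly_Mapping.keys m. b ^ Poly_Mapping.lookup m b) = (\<Prod>b\<in>C. b ^ Poly_Mapping.lookup m b)"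
    if "m \<in> Poly_Mapping.keys P" for m
    using that by (intro prod.mono_neutral_left) (auto simp: C_def in_keys_iff)
  have "Poly_Mapping.lookup P m = 0" if m: "m \<in> Poly_Mapping.keys P" for m
  proof (rule matroid_independent_coeffs_zero[OF B, of C "Poly_Mapping.keys P" "Poly_Mapping.lookup P" Poly_Mapping.lookup])
    show "(\<Sum>m\<in>Poly_Mapping.keys P. Poly_Mapping.lookup P m * (\<Prod>b\<in>C. b ^ Poly_Mapping.lookup m b)) = 0"
      using sum prod by simp
    fix m m' assume "m \<in> Poly_Mapping.keys P" "m' \<in> Poly_Mapping.keys P"
      and eq: "\<forall>b\<in>C. Poly_Mapping.lookup m b = Poly_Mapping.lookup m' b"
    have "Poly_Mapping.lookup m b = Poly_Mapping.lookup m' b" for b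
    proof (cases "b \<in> C")
      case False
      hence "b \<notin> Poly_Mapping.keys m" "b \<notin> Poly_Mapping.keys m'"
        using \<open>m \<in> _\<close> \<open>m' \<in> _\<close> by (auto simp: C_def)
      thus ?thesis by (simp add: in_keys_iff)
    qed (use eq in auto)
    thus "m = m'" by (rule poly_mapping_eqI)
  qed (use keys k m in \<open>auto simp: C_def intro: gf_incl\<close>)
  hence "Poly_Mapping.lookup P m = 0" for m by (cases "m \<in> Poly_Mapping.keys P") (auto simp: in_keys_iff)
  thus "P = 0" by (intro poly_mapping_eqI) simp
qed

subsection \<open>The regular action on rational functions\<close>

lemma poly_mapping_sum_single: "P = (\<Sum>m\<in>Poly_Mapping.keys P. Poly_Mapping.single m (Poly_Mapping.lookup P m))"
  by (rule poly_mapping_eqI)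
     (auto simp: lookup_sum lookup_single when_def in_keys_iff)

lemma poly_mapping_add_induct [case_names single add]:
  assumes "\<And>m c. Q (Poly_Mapping.single m c)" "\<And>P P'. Q P \<Longrightarrow> Q P' \<Longrightarrow> Q (P + P')"
  shows "Q (P :: 'a \<Rightarrow>\<^sub>0 'b::comm_monoid_add)"
proof -
  have "Q 0" using assms(1)[of undefined 0] by simp
  have "Q (\<Sum>m\<in>I. Poly_Mapping.single m (Poly_Mapping.lookup P m))" for I
    by (induction I rule: infinite_finite_induct) (auto simp: assms \<open>Q 0\<close>)
  thus ?thesis by (subst poly_mapping_sum_single)
qed

text \<open>Each \<open>map_key\<close> is a pullback. Applied to exponent vectors and then to
  polynomials it becomes covariant and sends the variable g to \<pi> g.\<close>

definition rename :: "('g \<Rightarrow> 'g) \<Rightarrow> (('g \<Rightarrow>\<^sub>0 nat) \<Rightarrow>\<^sub>0 'k::comm_ring_1) \<Rightarrow> ('g \<Rightarrow>\<^sub>0 nat) \<Rightarrow>\<^sub>0 'k" where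
  "rename \<pi> = Poly_Mapping.map_key (Poly_Mapping.map_key \<pi>)"

lemma inj_map_key: assumes "bij \<pi>" shows "inj (Poly_Mapping.map_key \<pi> :: ('g \<Rightarrow>\<^sub>0 nat) \<Rightarrow> _)"
proof (rule injI)
  fix m m' :: "'g \<Rightarrow>\<^sub>0 nat" assume eq: "Poly_Mapping.map_key \<pi> m = Poly_Mapping.map_key \<pi> m'"
  show "m = m'"
  proof (rule poly_mapping_eqI)
    fix g
    have "Poly_Mapping.lookup (Poly_Mapping.map_key \<pi> m) (inv_into UNIV \<pi> g) = Poly_Mapping.lookup (Poly_Mapping.map_key \<pi> m') (inv_into UNIV \<pi> g)"
      by (simp add: eq)
    thus "Poly_Mapping.lookup m g = Poly_Mapping.lookup m' g"
      using assms by (simp add: map_key.rep_eq bij_is_inj bij_is_surj surj_f_inv_f)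
  qed
qed

context
  fixes \<pi> :: "'g::linorder \<Rightarrow> 'g"
  assumes bij: "bij \<pi>"
begin

lemma rename_add: "rename \<pi> (P + Q) = rename \<pi> P + rename \<pi> Q"
  unfolding rename_def by (rule map_key_plus[OF inj_map_key[OF bij]])

lemma rename_0 [simp]: "rename \<pi> 0 = 0"
  unfolding rename_def by (rule map_key_zero[OF inj_map_key[OF bij]])

lemma map_key_inv: "Poly_Mapping.map_key \<pi> (Poly_Mapping.map_key (inv_into UNIV \<pi>) m) = m"
  using bij by (intro poly_mapping_eqI)
    (simp add: map_key.rep_eq bij_is_inj bij_imp_bij_inv)

lemma rename_single:
  "rename \<pi> (Poly_Mapping.single m c) = Poly_Mapping.single (Poly_Mapping.map_key (inv_into UNIV \<pi>) m) c"
  using map_key_single[OF inj_map_key[OF bij], of "Poly_Mapping.map_key (inv_into UNIV \<pi>) m" c]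
  by (simp add: rename_def map_key_inv)

lemma rename_mult: "rename \<pi> (P * Q) = rename \<pi> P * rename \<pi> Q"
proof (induction P rule: poly_mapping_add_induct)
  case (single m c)
  show ?case
  proof (induction Q rule: poly_mapping_add_induct)
    case (single n d)
    have "inj (inv_into UNIV \<pi>)" using bij by (simp add: bij_imp_bij_inv bij_is_inj)
    thus ?case by (simp add: rename_single mult_single map_key_plus)
  qed (simp add: distrib_left rename_add)
qed (simp add: distrib_right rename_add)

lemma rename_eq_0_iff [simp]: "rename \<pi> P = 0 \<longleftrightarrow> P = 0"
proof
  assume 0: "rename \<pi> P = 0"
  have "Poly_Mapping.lookup P m = Poly_Mapping.lookup (rename \<pi> P) (Poly_Mapping.map_key (inv_into UNIV \<pi>) m)" for m
    by (simp add: rename_def map_key.rep_eq inj_map_key bij map_key_inv)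
  thus "P = 0" by (intro poly_mapping_eqI) (simp add: 0)
qed simp

lemma rename_1 [simp]: "rename \<pi> 1 = 1"
  using rename_single[of 0 1] bij by (simp add: bij_imp_bij_inv bij_is_inj flip: single_one)

end

definition perm_vars :: "('g::linorder \<Rightarrow> 'g) \<Rightarrow> ('g, 'k::field) ratfun \<Rightarrow> ('g, 'k) ratfun" where
  "perm_vars \<pi> x = (THE y. \<exists>a b. b \<noteq> 0 \<and> x = Fract a b \<and> y = Fract (rename \<pi> a) (rename \<pi> b))"

lemma perm_vars_Fract:
  assumes "bij \<pi>" "b \<noteq> 0"
  shows "perm_vars \<pi> (Fract a b) = Fract (rename \<pi> a) (rename \<pi> b)"
  unfolding perm_vars_def
proof (rule the_equality)
  fix y assume "\<exists>a' b'. b' \<noteq> 0 \<and> Fract a b = Fract a' b' \<and> y = Fract (rename \<pi> a') (rename \<pi> b')"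
  then obtain a' b' where *: "b' \<noteq> 0" "Fract a b = Fract a' b'" "y = Fract (rename \<pi> a') (rename \<pi> b')" by blast
  hence "a * b' = a' * b" using assms by (simp add: eq_fract)
  hence "rename \<pi> a * rename \<pi> b' = rename \<pi> a' * rename \<pi> b"
    by (metis rename_mult[OF assms(1)])
  thus "y = Fract (rename \<pi> a) (rename \<pi> b)" using assms * by (simp add: eq_fract)
qed (use assms in blast)

lemma fhom_perm_vars:
  assumes "bij \<pi>" shows "fhom (perm_vars \<pi> :: ('g::linorder, 'k::field) ratfun \<Rightarrow> _)"
proof
  fix x y :: "('g, 'k) ratfun"
  obtain a b where x: "x = Fract a b" "b \<noteq> 0" by (cases x)
  obtain c d where y: "y = Fract c d" "d \<noteq> 0" by (cases y)
  show "perm_vars \<pi> (x + y) = perm_vars \<pi> x + perm_vars \<pi> y"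
    using assms x y by (simp add: perm_vars_Fract rename_add rename_mult)
  show "perm_vars \<pi> (x * y) = perm_vars \<pi> x * perm_vars \<pi> y"
    using assms x y by (simp add: perm_vars_Fract rename_mult)
  show "perm_vars \<pi> (1 :: ('g, 'k) ratfun) = 1"
    using assms by (simp add: One_fract_def perm_vars_Fract)
qed

lemma perm_vars_const [simp]: "bij \<pi> \<Longrightarrow> perm_vars \<pi> (rf_const c) = rf_const c"
  by (simp add: rf_const_def perm_vars_Fract rename_single bij_imp_bij_inv bij_is_inj)

lemma perm_vars_var [simp]: assumes "bij \<pi>" shows "perm_vars \<pi> (rf_var g) = rf_var (\<pi> g)"
proof -
  have "inj (inv_into UNIV \<pi>)" using assms by (simp add: bij_imp_bij_inv bij_is_inj)
  have "Poly_Mapping.map_key (inv_into UNIV \<pi>) (Poly_Mapping.single g (1::nat)) = Poly_Mapping.single (\<pi> g) 1"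
    using map_key_single[OF \<open>inj (inv_into UNIV \<pi>)\<close>, of "\<pi> g" "1::nat"] assms by (simp add: bij_is_inj)
  thus ?thesis using assms by (simp add: rf_var_def perm_vars_Fract rename_single)
qed

section \<open>Constants and variables\<close>

abbreviation consts_of :: "('g::linorder, 'k::field) ratfun set" where "consts_of \<equiv> range rf_const"

lemma rf_const_eq_iff [simp]: "rf_const c = rf_const d \<longleftrightarrow> c = d"
  by (auto simp: rf_const_def eq_fract dest: inj_onD[OF inj_single])

lemma rf_var_eq_iff [simp]: "rf_var g = (rf_var h :: ('g::linorder, 'k::field) ratfun) \<longleftrightarrow> g = h"
proof
  assume "rf_var g = (rf_var h :: ('g, 'k) ratfun)"
  hence "Poly_Mapping.single (Poly_Mapping.single g (1::nat)) (1::'k) = Poly_Mapping.single (Poly_Mapping.single h 1) 1"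
    by (simp add: rf_var_def eq_fract)
  hence "Poly_Mapping.keys (Poly_Mapping.single (Poly_Mapping.single g (1::nat)) (1::'k)) =
      Poly_Mapping.keys (Poly_Mapping.single (Poly_Mapping.single h 1) (1::'k))" by simp
  hence "Poly_Mapping.keys (Poly_Mapping.single g (1::nat)) = Poly_Mapping.keys (Poly_Mapping.single h (1::nat))" by simp
  thus "g = h" by simp
qed simp

lemma Fract_mult_1: "Fract (a * b) 1 = Fract a 1 * Fract b 1"
  by simp

lemma Fract_add_1: "Fract (a + b) 1 = Fract a 1 + Fract b 1"
  by simp

lemma Fract_sum_1: "Fract (\<Sum>i\<in>I. f i) 1 = (\<Sum>i\<in>I. Fract (f i) 1)"
proof (induction I rule: infinite_finite_induct)
  case (insert i I)
  show ?case unfolding sum.insert[OF insert.hyps(1,2)] Fract_add_1 insert.IH ..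
qed (simp_all add: Zero_fract_def)

lemma Fract_single_var:
  "Fract (Poly_Mapping.single (Poly_Mapping.single g i) 1) 1 = (rf_var g :: ('g::linorder, 'k::field) ratfun) ^ i"
proof (induction i)
  case 0
  thus ?case by (simp add: One_fract_def)
next
  case (Suc i)
  have "Poly_Mapping.single (Poly_Mapping.single g (Suc i)) (1::'k) =
      Poly_Mapping.single (Poly_Mapping.single g 1) 1 * Poly_Mapping.single (Poly_Mapping.single g i) 1"
    by (simp add: mult_single flip: single_add)
  thus ?case using Suc by (simp only: Fract_mult_1 power_Suc) (simp only: rf_var_def)
qed

text \<open>After clearing denominators the coefficients \<open>Q i\<close> are free of the variable
  g, so \<open>Q i\<close> times its i-th power has only monomials of degree i in it, and nothing
  cancels between different i.\<close>

lemma rf_var_not_alg: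
  "\<not> alg (consts_of \<union> rf_var ` (D - {g})) (rf_var g :: ('g::linorder, 'k::field) ratfun)"
proof
  assume "alg (consts_of \<union> rf_var ` (D - {g})) (rf_var g :: ('g, 'k) ratfun)"
  then obtain P where P: "P \<noteq> 0" "\<And>i. Polynomial.coeff P i \<in> gf (consts_of \<union> rf_var ` (D - {g}))"
    "poly P (rf_var g :: ('g, 'k) ratfun) = 0" unfolding alg_def by blast
  define free :: "(('g \<Rightarrow>\<^sub>0 nat) \<Rightarrow>\<^sub>0 'k) \<Rightarrow> bool" where
    "free Q \<longleftrightarrow> (\<forall>m\<in>Poly_Mapping.keys Q. Poly_Mapping.lookup m g = 0)" for Q
  define R where "R = {Fract Q 1 | Q. free Q}"
  have R_elem: "\<exists>Q. x = Fract Q 1 \<and> free Q" if "x \<in> R" for x using that by (auto simp: R_def)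
  have free_add: "free (Q + Q')" if "free Q" "free Q'" for Q Q'
    using that Poly_Mapping.keys_add[of Q Q'] by (auto simp: free_def)
  have free_mult: "free (Q * Q')" if "free Q" "free Q'" for Q Q'
    using that keys_mult[of Q Q'] by (fastforce simp: free_def lookup_add)
  have free_uminus: "free (- Q)" if "free Q" for Q
    using that by (simp add: free_def)
  have R: "1 \<in> R" "\<And>a. a \<in> R \<Longrightarrow> - a \<in> R" "\<And>a b. a \<in> R \<Longrightarrow> b \<in> R \<Longrightarrow> a + b \<in> R"
      "\<And>a b. a \<in> R \<Longrightarrow> b \<in> R \<Longrightarrow> a * b \<in> R"
  proof -
    have "free 1" by (simp add: free_def)
    thus "1 \<in> R" by (auto simp: R_def One_fract_def)
    fix a b assume "a \<in> R" "b \<in> R"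
    then obtain Q Q' where Q: "a = Fract Q 1" "free Q" "b = Fract Q' 1" "free Q'" using R_elem by metis
    show "- a \<in> R" using free_uminus[OF Q(2)] by (auto simp: R_def Q)
    show "a + b \<in> R" using free_add[OF Q(2,4)] by (auto simp: R_def Q)
    show "a * b \<in> R" using free_mult[OF Q(2,4)] by (auto simp: R_def Q)
  qed
  have "free (Poly_Mapping.single 0 c)" "h \<noteq> g \<Longrightarrow> free (Poly_Mapping.single (Poly_Mapping.single h 1) 1)" for c h
    by (auto simp: free_def lookup_single)
  hence "consts_of \<union> rf_var ` (D - {g}) \<subseteq> R"
    by (auto simp: R_def rf_const_def rf_var_def)
  from gf_fraction[OF R this] P(2)
  have "\<exists>d. d \<in> R \<and> d \<noteq> 0 \<and> (\<forall>i\<in>{..Polynomial.degree P}. d * Polynomial.coeff P i \<in> R)"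
    by (intro common_denominator R) auto
  then obtain d where d: "d \<noteq> 0" "\<And>i. i \<le> Polynomial.degree P \<Longrightarrow> d * Polynomial.coeff P i \<in> R" by auto
  have "\<forall>i\<in>{..Polynomial.degree P}. \<exists>Q. d * Polynomial.coeff P i = Fract Q 1 \<and> free Q"
    using d(2) R_elem by auto
  from bchoice[OF this] obtain Q where
    Q: "\<And>i. i \<le> Polynomial.degree P \<Longrightarrow> d * Polynomial.coeff P i = Fract (Q i) 1"
       "\<And>i. i \<le> Polynomial.degree P \<Longrightarrow> free (Q i)" by auto
  let ?N = "Polynomial.degree P"
  define H where "H = (\<Sum>i\<le>?N. Q i * Poly_Mapping.single (Poly_Mapping.single g i) 1)"
  have "Fract H 1 = (\<Sum>i\<le>?N. d * Polynomial.coeff P i * rf_var g ^ i)"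
    unfolding H_def Fract_sum_1 Fract_mult_1 Fract_single_var by (intro sum.cong) (auto simp: Q(1))
  also have "\<dots> = d * poly P (rf_var g)" by (simp add: poly_altdef sum_distrib_left mult.assoc)
  finally have "Fract H 1 = Fract 0 1" using P(3) by (simp add: Zero_fract_def[symmetric])
  hence "H = 0" by (simp add: eq_fract)
  have "Q ?N \<noteq> 0"
  proof
    assume "Q ?N = 0"
    hence "d * lead_coeff P = 0" using Q(1)[of ?N] by (simp add: Zero_fract_def)
    thus False using d P by simp
  qed
  then obtain m where m: "m \<in> Poly_Mapping.keys (Q ?N)" by (metis all_not_in_conv keys_eq_empty)
  hence mg: "Poly_Mapping.lookup m g = 0" using Q(2)[of ?N] by (auto simp: free_def)
  define n where "n = m + Poly_Mapping.single g ?N"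
  have "Poly_Mapping.lookup (Q i * Poly_Mapping.single (Poly_Mapping.single g i) 1) n =
      (if i = ?N then Poly_Mapping.lookup (Q ?N) m else 0)" if i: "i \<le> ?N" for i
  proof -
    have "Q i * Poly_Mapping.single (Poly_Mapping.single g i) 1 =
        (\<Sum>l\<in>Poly_Mapping.keys (Q i). Poly_Mapping.single (l + Poly_Mapping.single g i) (Poly_Mapping.lookup (Q i) l))"
      by (subst poly_mapping_sum_single[of "Q i"]) (simp add: sum_distrib_right mult_single)
    hence "Poly_Mapping.lookup (Q i * Poly_Mapping.single (Poly_Mapping.single g i) 1) n =
        (\<Sum>l\<in>Poly_Mapping.keys (Q i). if l + Poly_Mapping.single g i = n then Poly_Mapping.lookup (Q i) l else 0)"
      by (simp add: lookup_sum lookup_single when_def)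
    also have "\<dots> = (\<Sum>l\<in>Poly_Mapping.keys (Q i). if l = m \<and> i = ?N then Poly_Mapping.lookup (Q i) l else 0)"
    proof (rule sum.cong)
      fix l assume l: "l \<in> Poly_Mapping.keys (Q i)"
      hence lg: "Poly_Mapping.lookup l g = 0" using Q(2)[OF i] by (auto simp: free_def)
      have "l + Poly_Mapping.single g i = n \<longleftrightarrow> l = m \<and> i = ?N"
      proof
        assume eq: "l + Poly_Mapping.single g i = n"
        hence "Poly_Mapping.lookup (l + Poly_Mapping.single g i) g = Poly_Mapping.lookup n g" by simp
        hence "i = ?N" using lg mg by (simp add: n_def lookup_add)
        thus "l = m \<and> i = ?N" using eq by (simp add: n_def)
      qed (simp add: n_def)
      thus "(if l + Poly_Mapping.single g i = n then Poly_Mapping.lookup (Q i) l else 0) =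
          (if l = m \<and> i = ?N then Poly_Mapping.lookup (Q i) l else 0)" by simp
    qed auto
    also have "\<dots> = (if i = ?N then Poly_Mapping.lookup (Q ?N) m else 0)"
      using m by (cases "i = ?N") auto
    finally show ?thesis .
  qed
  hence "Poly_Mapping.lookup H n = (\<Sum>i\<le>?N. if i = ?N then Poly_Mapping.lookup (Q ?N) m else 0)"
    unfolding H_def lookup_sum by (intro sum.cong) auto
  also have "\<dots> = Poly_Mapping.lookup (Q ?N) m" by simp
  finally show False using m \<open>H = 0\<close> by (simp add: in_keys_iff)
qed

text \<open>Variables outside the carrier are fixed, so that the index map is a permutation of the
  whole type and the action an endomorphism of the full rational function field.\<close>

definition gact :: "('g::linorder, 'm) monoid_scheme \<Rightarrow> 'g \<Rightarrow> ('g, 'k::field) ratfun \<Rightarrow> ('g, 'k) ratfun" where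
  "gact G h = perm_vars (\<lambda>g. if g \<in> carrier G then h \<otimes>\<^bsub>G\<^esub> g else g)"

context
  fixes G :: "'g::linorder monoid"
  assumes G: "group G"
begin

interpretation G: group G by (rule G)

lemma bij_left_mult:
  assumes "h \<in> carrier G"
  shows "bij (\<lambda>g. if g \<in> carrier G then h \<otimes>\<^bsub>G\<^esub> g else g)"
proof (rule o_bij)
  show "(\<lambda>g. if g \<in> carrier G then inv\<^bsub>G\<^esub> h \<otimes>\<^bsub>G\<^esub> g else g) \<circ> (\<lambda>g. if g \<in> carrier G then h \<otimes>\<^bsub>G\<^esub> g else g) = id"
    using assms by (auto simp: fun_eq_iff G.m_assoc[symmetric])
  show "(\<lambda>g. if g \<in> carrier G then h \<otimes>\<^bsub>G\<^esub> g else g) \<circ> (\<lambda>g. if g \<in> carrier G then inv\<^bsub>G\<^esub> h \<otimes>\<^bsub>G\<^esub> g else g) = id"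
    using assms by (auto simp: fun_eq_iff G.m_assoc[symmetric])
qed

lemma fhom_gact: "h \<in> carrier G \<Longrightarrow> fhom (gact G h :: ('g, 'k::field) ratfun \<Rightarrow> _)"
  unfolding gact_def by (intro fhom_perm_vars bij_left_mult)

lemma gact_const: "h \<in> carrier G \<Longrightarrow> gact G h (rf_const c) = rf_const c"
  unfolding gact_def by (intro perm_vars_const bij_left_mult)

lemma gact_var: "h \<in> carrier G \<Longrightarrow> g \<in> carrier G \<Longrightarrow> gact G h (rf_var g) = rf_var (h \<otimes>\<^bsub>G\<^esub> g)"
  unfolding gact_def by (subst perm_vars_var) (auto intro: bij_left_mult)

lemma gact_closed:
  assumes "h \<in> carrier G" "x \<in> group_ratfun_field G"
  shows "gact G h x \<in> (group_ratfun_field G :: ('g, 'k::field) ratfun set)"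
proof -
  interpret fhom "gact G h :: ('g, 'k) ratfun \<Rightarrow> _" using fhom_gact[OF assms(1)] .
  show ?thesis using assms(2) unfolding group_ratfun_field_def
    by (rule hom_gf_image) (use assms(1) in \<open>auto simp: gact_const gact_var intro: gf_incl\<close>)
qed

lemma gact_mult:
  assumes "h \<in> carrier G" "h' \<in> carrier G" "x \<in> group_ratfun_field G"
  shows "gact G h (gact G h' x) = gact G (h \<otimes>\<^bsub>G\<^esub> h') (x :: ('g, 'k::field) ratfun)"
proof -
  have "fhom (\<lambda>x :: ('g, 'k) ratfun. gact G h (gact G h' x))"
    using fhom_gact[OF assms(1), where 'k = 'k] fhom_gact[OF assms(2), where 'k = 'k] by (simp add: fhom_def)
  thus ?thesis
    by (rule fhom_eq_on_gf[OF _ fhom_gact assms(3)[unfolded group_ratfun_field_def]])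
       (use assms in \<open>auto simp: gact_const gact_var G.m_assoc\<close>)
qed

lemma gact_one:
  assumes "x \<in> group_ratfun_field G"
  shows "gact G \<one>\<^bsub>G\<^esub> x = (x :: ('g, 'k::field) ratfun)"
proof -
  interpret fhom "gact G \<one>\<^bsub>G\<^esub> :: ('g, 'k) ratfun \<Rightarrow> _" by (intro fhom_gact) auto
  show ?thesis
    using assms unfolding group_ratfun_field_def
    by (rule hom_gf_fixed) (auto simp: gact_const gact_var)
qed

lemma gact_in_group_act:
  assumes h: "h \<in> carrier G"
  shows "(gact G h :: ('g, 'k::field) ratfun \<Rightarrow> _) \<in> group_act G h"
proof -
  let ?L = "group_ratfun_field G :: ('g, 'k) ratfun set"
  interpret fhom "gact G h :: ('g, 'k) ratfun \<Rightarrow> _" using fhom_gact[OF h] .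
  have "bij_betw (gact G h) ?L ?L"
  proof (rule bij_betw_byWitness[where f' = "gact G (inv\<^bsub>G\<^esub> h)"])
    show "\<forall>a\<in>?L. gact G (inv\<^bsub>G\<^esub> h) (gact G h a) = a" "\<forall>a\<in>?L. gact G h (gact G (inv\<^bsub>G\<^esub> h) a) = a"
      using h by (auto simp: gact_mult gact_one)
  qed (use h in \<open>auto intro: gact_closed\<close>)
  thus ?thesis
    using h by (auto simp: group_act_def ring_iso_def ring_hom_def ring_of_type_algebra_def
        hom_add hom_mult gact_const gact_var intro: gact_closed)
qed

text \<open>Members of \<open>group_act\<close> respect the operations only on the field itself, so
  the comparison is an induction over the generation of that field.\<close>

lemma group_act_eq_gact:
  assumes h: "h \<in> carrier G" and psi: "\<psi> \<in> group_act G h" and x: "x \<in> group_ratfun_field G"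
  shows "\<psi> x = gact G h (x :: ('g, 'k::field) ratfun)"
proof -
  let ?S = "consts_of \<union> rf_var ` carrier G :: ('g, 'k) ratfun set"
  interpret fhom "gact G h :: ('g, 'k) ratfun \<Rightarrow> _" using fhom_gact[OF h] .
  have psi_add: "\<psi> (a + b) = \<psi> a + \<psi> b" and psi_mult: "\<psi> (a * b) = \<psi> a * \<psi> b"
    if "a \<in> gf ?S" "b \<in> gf ?S" for a b
    using psi that by (auto simp: group_act_def ring_iso_def ring_hom_def ring_of_type_algebra_def group_ratfun_field_def)
  have psi_1: "\<psi> 1 = 1"
    using psi by (auto simp: group_act_def ring_iso_def ring_hom_def ring_of_type_algebra_def)
  have psi_0: "\<psi> 0 = 0" using psi_add[of 0 0] by (metis add_0 add_cancel_right_left gf_zero)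
  show ?thesis using x unfolding group_ratfun_field_def
  proof (induction rule: gf_induct)
    case (incl x)
    thus ?case using psi h by (auto simp: group_act_def gact_const gact_var)
  next
    case one
    thus ?case by (simp add: psi_1)
  next
    case (uminus x)
    have "\<psi> x + \<psi> (- x) = 0" using psi_add[of x "- x"] uminus psi_0 by (simp add: gf_uminus)
    thus ?case using uminus by (simp add: hom_uminus eq_neg_iff_add_eq_0 add.commute)
  next
    case (inverse x)
    have "\<psi> x * \<psi> (inverse x) = 1" using psi_mult[of x "inverse x"] inverse psi_1 by (simp add: gf_inverse)
    hence "gact G h x * \<psi> (inverse x) = 1" using inverse by simp
    thus ?case by (simp add: hom_inverse inverse_unique)
  qed (auto simp: psi_add psi_mult hom_add hom_mult)
qed

lemma noether_field_altdef:
  "noether_field G = {x \<in> group_ratfun_field G. \<forall>h\<in>carrier G. gact G h x = (x :: ('g, 'k::field) ratfun)}"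
  unfolding noether_field_def using gact_in_group_act group_act_eq_gact by fastforce

end

subsection \<open>The structure of the metacyclic group\<close>

lemma pres_cong_context: "pres_cong Rel u v \<Longrightarrow> pres_cong Rel (a @ u @ b) (a @ v @ b)"
proof (induction rule: pres_cong.induct)
  case (cancel u s c v)
  show ?case using pres_cong.cancel[of Rel "a @ u" s c "v @ b"] by simp
next
  case (rel l r u v)
  from pres_cong.rel[OF this, of "a @ u" "v @ b"] show ?case by simp
qed (auto intro: pres_cong.intros)

lemma pres_cong_append: "pres_cong Rel u u' \<Longrightarrow> pres_cong Rel v v' \<Longrightarrow> pres_cong Rel (u @ v) (u' @ v')"
  using pres_cong_context[of Rel u u' "[]" v] pres_cong_context[of Rel v v' u' "[]"]
  by (auto intro: pres_cong.trans)

locale presented =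
  fixes G :: "('g, 'm) monoid_scheme" and Rel :: "('s word \<times> 's word) set"
  assumes G: "group G" and iso: "G \<cong> presented_group Rel"
begin

sublocale G: group G by (rule G)

definition cls where "cls w = {v. pres_cong Rel w v}"

lemma cls_eq_iff: "cls w = cls v \<longleftrightarrow> pres_cong Rel w v"
  unfolding cls_def by (blast intro: pres_cong.intros)

lemma carrier_presented: "carrier (presented_group Rel) = range cls"
  by (auto simp: presented_group_def quotient_def cls_def)

lemma mult_presented: "cls a \<otimes>\<^bsub>presented_group Rel\<^esub> cls b = cls (a @ b)"
  unfolding presented_group_def cls_def
  by (auto intro: pres_cong.intros pres_cong_append[THEN pres_cong.trans])

definition iso_map where "iso_map = (SOME h. h \<in> Group.iso G (presented_group Rel))"

lemma iso_map: "iso_map \<in> Group.iso G (presented_group Rel)"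
  using iso unfolding is_iso_def iso_map_def by (metis all_not_in_conv someI_ex)

text \<open>Words are evaluated in G itself through a chosen isomorphism, since G is only isomorphic
  to the presented group.\<close>

definition wrd where "wrd w = inv_into (carrier G) iso_map (cls w)"

lemma iso_map_bij: "bij_betw iso_map (carrier G) (range cls)"
  using iso_map by (simp add: Group.iso_def carrier_presented)

lemma iso_map_wrd: "iso_map (wrd w) = cls w"
  unfolding wrd_def using iso_map_bij by (intro f_inv_into_f) (auto simp: bij_betw_def)

lemma wrd_closed [simp]: "wrd w \<in> carrier G"
  unfolding wrd_def using iso_map_bij by (intro inv_into_into) (auto simp: bij_betw_def)

lemma wrd_eq_iff: "wrd u = wrd v \<longleftrightarrow> pres_cong Rel u v"
  by (metis iso_map_wrd cls_eq_iff wrd_def)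

lemma wrd_append: "wrd (u @ v) = wrd u \<otimes>\<^bsub>G\<^esub> wrd v"
proof -
  have "iso_map (wrd u \<otimes>\<^bsub>G\<^esub> wrd v) = iso_map (wrd (u @ v))"
    using iso_map hom_mult[of iso_map G "presented_group Rel" "wrd u" "wrd v"]
    by (simp add: Group.iso_def iso_map_wrd mult_presented)
  thus ?thesis using iso_map_bij by (auto simp: bij_betw_def dest: inj_onD)
qed

lemma wrd_Nil [simp]: "wrd [] = \<one>\<^bsub>G\<^esub>"
  using wrd_append[of "[]" "[]"] by (metis G.l_cancel_one' append_Nil wrd_closed)

lemma wrd_surj: "x \<in> carrier G \<Longrightarrow> \<exists>w. x = wrd w"
proof -
  assume x: "x \<in> carrier G"
  hence "iso_map x \<in> range cls" using iso_map_bij by (auto simp: bij_betw_def)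
  then obtain w where "iso_map x = cls w" by blast
  hence "iso_map x = iso_map (wrd w)" by (simp add: iso_map_wrd)
  thus ?thesis using iso_map_bij x by (auto simp: bij_betw_def dest: inj_onD)
qed

lemma wrd_Cons: "wrd (l # w) = wrd [l] \<otimes>\<^bsub>G\<^esub> wrd w"
  using wrd_append[of "[l]" w] by simp

lemma wrd_inverse: "wrd [(s, True)] = inv\<^bsub>G\<^esub> (wrd [(s, False)])"
proof -
  have "pres_cong Rel [(s, True), (s, False)] []"
    using pres_cong.cancel[of Rel "[]" s True "[]"] by simp
  hence "wrd [(s, True)] \<otimes>\<^bsub>G\<^esub> wrd [(s, False)] = \<one>\<^bsub>G\<^esub>"
    by (simp flip: wrd_eq_iff wrd_Nil wrd_append)
  thus ?thesis by (simp add: G.inv_equality)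
qed

lemma wrd_replicate: "wrd (replicate m l) = wrd [l] [^]\<^bsub>G\<^esub> m"
proof (induction m)
  case (Suc m)
  have "wrd (replicate (Suc m) l) = wrd (replicate m l) \<otimes>\<^bsub>G\<^esub> wrd [l]"
    by (subst replicate_Suc, subst replicate_append_same[symmetric], subst wrd_append) simp
  thus ?case by (simp add: Suc)
qed simp

lemma wrd_word_pow: "wrd (word_pow s i) = wrd [(s, False)] [^]\<^bsub>G\<^esub> (i::int)"
proof (cases "i < 0")
  case True
  hence "word_pow s i = replicate (nat (- i)) (s, True)" by (simp add: word_pow_def)
  hence "wrd (word_pow s i) = (inv\<^bsub>G\<^esub> wrd [(s, False)]) [^]\<^bsub>G\<^esub> nat (- i)"
    by (simp only: wrd_replicate wrd_inverse)
  thus ?thesis using True by (simp only: int_pow_def2 G.nat_pow_inv wrd_closed if_True)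
next
  case False
  hence "word_pow s i = replicate (nat i) (s, False)" by (simp add: word_pow_def)
  thus ?thesis using False by (simp only: wrd_replicate int_pow_def2 if_False)
qed

end

text \<open>Words act on \<open>\<int>/p\<close> with \<open>\<sigma>\<close> as translation by 1 and \<open>\<tau>\<close> as multiplication by \<open>s\<close>, where
  \<open>s t \<equiv> 1\<close>. These affine maps separate the elements \<open>\<sigma>\<^sup>i \<tau>\<^sup>j\<close>, so the presented group has full
  order \<open>p n\<close>.\<close>

fun letter_act :: "int \<Rightarrow> int \<Rightarrow> gen \<times> bool \<Rightarrow> int \<Rightarrow> int" where
  "letter_act s t (Sigma, False) x = x + 1"
| "letter_act s t (Sigma, True) x = x - 1"
| "letter_act s t (Tau, False) x = s * x"
| "letter_act s t (Tau, True) x = t * x"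

definition word_act :: "int \<Rightarrow> int \<Rightarrow> gen word \<Rightarrow> int \<Rightarrow> int" where
  "word_act s t w x = foldr (letter_act s t) w x"

lemma word_act_append: "word_act s t (u @ v) x = word_act s t u (word_act s t v x)"
  by (simp add: word_act_def)

lemma letter_act_cong:
  "[x = y] (mod m) \<Longrightarrow> [letter_act s t l x = letter_act s t l y] (mod m)"
  by (cases "(s, t, l, x)" rule: letter_act.cases) (auto intro: cong_add cong_diff cong_mult cong_refl)

lemma word_act_cong:
  "[x = y] (mod m) \<Longrightarrow> [word_act s t w x = word_act s t w y] (mod m)"
  by (induction w) (auto simp: word_act_def intro: letter_act_cong)

lemma word_act_replicate:
  "word_act s t (replicate i (Sigma, False)) x = x + int i"
  "word_act s t (replicate i (Sigma, True)) x = x - int i"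
  "word_act s t (replicate i (Tau, False)) x = s ^ i * x"
  by (induction i) (auto simp: word_act_def)

lemma word_act_word_pow_Sigma: "word_act s t (word_pow Sigma i) x = x + i"
  by (cases "i < 0") (auto simp: word_pow_def word_act_replicate)

text \<open>From s t \<equiv> 1 come cancellation and the conjugation relation, where t(sx + 1)
  \<equiv> x + t; from s^n \<equiv> 1 comes the relation for \<tau>^n.\<close>

lemma word_act_pres_cong:
  assumes "pres_cong {(word_pow Sigma (int p), []), (word_pow Tau (int n), []),
      (word_pow Tau (- 1) @ word_pow Sigma 1 @ word_pow Tau 1, word_pow Sigma t)} u v"
    and st: "[s * t = 1] (mod int p)" "[s ^ n = 1] (mod int p)"
  shows "[word_act s t u x = word_act s t v x] (mod int p)"
  using assms(1)
proof (induction arbitrary: x rule: pres_cong.induct)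
  case (cancel u a b v)
  define y where "y = word_act s t v x"
  have "[t * (s * y) = y] (mod int p)" "[s * (t * y) = y] (mod int p)"
    using cong_mult[OF st(1) cong_refl[of y]] by (simp_all add: mult_ac)
  hence "[word_act s t [(a, b), (a, \<not> b)] y = y] (mod int p)"
    by (cases a; cases b) (auto simp: word_act_def)
  thus ?case unfolding word_act_append y_def by (rule word_act_cong)
next
  case (rel l r u v)
  define y where "y = word_act s t v x"
  have "[word_act s t l y = word_act s t r y] (mod int p)"
    using rel
  proof (elim insertE emptyE Pair_inject)
    assume "l = word_pow Sigma (int p)" "r = []"
    thus ?thesis by (simp add: word_act_word_pow_Sigma) (simp add: word_act_def cong_def)
  next
    assume "l = word_pow Tau (int n)" "r = []"
    thus ?thesis using cong_mult[OF st(2) cong_refl[of y]]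
      by (simp add: word_pow_def word_act_replicate) (simp add: word_act_def)
  next
    assume lr: "l = word_pow Tau (- 1) @ word_pow Sigma 1 @ word_pow Tau 1" "r = word_pow Sigma t"
    have "word_act s t l y = t * (s * y + 1)" by (simp add: lr word_pow_def word_act_def)
    moreover have "[(s * t) * y + t = 1 * y + t] (mod int p)"
      by (intro cong_add cong_mult st cong_refl)
    ultimately show ?thesis by (simp add: lr word_act_word_pow_Sigma algebra_simps)
  qed
  thus ?case unfolding word_act_append y_def by (rule word_act_cong)
qed (auto intro: cong_sym cong_trans)

lemma metacyclic_structure:
  fixes G :: "('g, 'm) monoid_scheme"
  assumes G: "group G" "G \<cong> metacyclic_group p n t"
    and p: "1 < p" and n: "0 < n" and t': "t' = nat (t mod int p)"
    and st: "[int (s * t') = 1] (mod int p)"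
    and ord: "\<And>j. [int (t' ^ j) = 1] (mod int p) \<longleftrightarrow> n dvd j"
  obtains \<sigma> \<tau> where "\<sigma> \<in> carrier G" "\<tau> \<in> carrier G" "\<sigma> [^]\<^bsub>G\<^esub> p = \<one>\<^bsub>G\<^esub>" "\<tau> [^]\<^bsub>G\<^esub> n = \<one>\<^bsub>G\<^esub>"
    "\<sigma> \<otimes>\<^bsub>G\<^esub> \<tau> = \<tau> \<otimes>\<^bsub>G\<^esub> \<sigma> [^]\<^bsub>G\<^esub> t'"
    "bij_betw (\<lambda>(i, j). \<sigma> [^]\<^bsub>G\<^esub> i \<otimes>\<^bsub>G\<^esub> \<tau> [^]\<^bsub>G\<^esub> j) ({..<p} \<times> {..<n}) (carrier G)"
proof -
  define Rel :: "(gen word \<times> gen word) set" where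
    "Rel = {(word_pow Sigma (int p), []), (word_pow Tau (int n), []),
      (word_pow Tau (- 1) @ word_pow Sigma 1 @ word_pow Tau 1, word_pow Sigma t)}"
  have Rel: "(word_pow Sigma (int p), []) \<in> Rel" "(word_pow Tau (int n), []) \<in> Rel"
    "(word_pow Tau (- 1) @ word_pow Sigma 1 @ word_pow Tau 1, word_pow Sigma t) \<in> Rel"
    by (auto simp: Rel_def)
  interpret presented G Rel
    by (rule presented.intro) (use G in \<open>simp_all add: metacyclic_group_def Rel_def\<close>)
  define \<sigma> where "\<sigma> = wrd [(Sigma, False)]"
  define \<tau> where "\<tau> = wrd [(Tau, False)]"
  have closed [simp]: "\<sigma> \<in> carrier G" "\<tau> \<in> carrier G" by (auto simp: \<sigma>_def \<tau>_def)
  have rel: "wrd l = wrd r" if "(l, r) \<in> Rel" for l r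
    using pres_cong.rel[OF that, of "[]" "[]"] by (simp add: wrd_eq_iff)
  have \<sigma>p: "\<sigma> [^]\<^bsub>G\<^esub> p = \<one>\<^bsub>G\<^esub>"
    using rel[OF Rel(1)] by (simp add: wrd_word_pow \<sigma>_def int_pow_int)
  have \<tau>n: "\<tau> [^]\<^bsub>G\<^esub> n = \<one>\<^bsub>G\<^esub>"
    using rel[OF Rel(2)] by (simp add: wrd_word_pow \<tau>_def int_pow_int)
  have t: "t = int p * (t div int p) + int t'" using p by (simp add: t')
  have "inv\<^bsub>G\<^esub> \<tau> \<otimes>\<^bsub>G\<^esub> (\<sigma> \<otimes>\<^bsub>G\<^esub> \<tau>) = \<sigma> [^]\<^bsub>G\<^esub> t"
    using rel[OF Rel(3)]
    by (simp add: wrd_append wrd_word_pow \<sigma>_def \<tau>_def G.int_pow_neg)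
  also have "\<sigma> [^]\<^bsub>G\<^esub> t = \<sigma> [^]\<^bsub>G\<^esub> t'"
  proof -
    have "\<sigma> [^]\<^bsub>G\<^esub> (int p * (t div int p) + int t') =
        (\<sigma> [^]\<^bsub>G\<^esub> int p) [^]\<^bsub>G\<^esub> (t div int p) \<otimes>\<^bsub>G\<^esub> \<sigma> [^]\<^bsub>G\<^esub> int t'"
      by (simp only: G.int_pow_mult G.int_pow_pow closed)
    thus ?thesis using t by (simp add: int_pow_int \<sigma>p)
  qed
  finally have comm: "\<sigma> \<otimes>\<^bsub>G\<^esub> \<tau> = \<tau> \<otimes>\<^bsub>G\<^esub> \<sigma> [^]\<^bsub>G\<^esub> t'"
    by (metis G.inv_solve_left G.m_closed G.nat_pow_closed closed)
  have pow_mod: "\<sigma> [^]\<^bsub>G\<^esub> i = \<sigma> [^]\<^bsub>G\<^esub> (i mod p)" "\<tau> [^]\<^bsub>G\<^esub> i = \<tau> [^]\<^bsub>G\<^esub> (i mod n)" for i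
  proof -
    have "\<sigma> [^]\<^bsub>G\<^esub> (p * (i div p) + i mod p) = \<sigma> [^]\<^bsub>G\<^esub> (i mod p)"
      by (subst G.nat_pow_mult[symmetric]) (simp_all add: \<sigma>p flip: G.nat_pow_pow)
    thus "\<sigma> [^]\<^bsub>G\<^esub> i = \<sigma> [^]\<^bsub>G\<^esub> (i mod p)" by simp
    have "\<tau> [^]\<^bsub>G\<^esub> (n * (i div n) + i mod n) = \<tau> [^]\<^bsub>G\<^esub> (i mod n)"
      by (subst G.nat_pow_mult[symmetric]) (simp_all add: \<tau>n flip: G.nat_pow_pow)
    thus "\<tau> [^]\<^bsub>G\<^esub> i = \<tau> [^]\<^bsub>G\<^esub> (i mod n)" by simp
  qed
  have comm_pow: "\<sigma> [^]\<^bsub>G\<^esub> i \<otimes>\<^bsub>G\<^esub> \<tau> = \<tau> \<otimes>\<^bsub>G\<^esub> \<sigma> [^]\<^bsub>G\<^esub> (t' * i)" for i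
  proof (induction i)
    case (Suc i)
    have "\<sigma> [^]\<^bsub>G\<^esub> Suc i \<otimes>\<^bsub>G\<^esub> \<tau> = \<sigma> [^]\<^bsub>G\<^esub> i \<otimes>\<^bsub>G\<^esub> (\<sigma> \<otimes>\<^bsub>G\<^esub> \<tau>)" by (simp add: G.m_assoc)
    also have "\<dots> = (\<sigma> [^]\<^bsub>G\<^esub> i \<otimes>\<^bsub>G\<^esub> \<tau>) \<otimes>\<^bsub>G\<^esub> \<sigma> [^]\<^bsub>G\<^esub> t'" by (simp add: comm G.m_assoc)
    also have "\<dots> = \<tau> \<otimes>\<^bsub>G\<^esub> \<sigma> [^]\<^bsub>G\<^esub> (t' * i + t')" by (simp add: Suc G.m_assoc G.nat_pow_mult)
    finally show ?case by (simp add: add.commute)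
  qed simp
  \<comment> \<open>These normal forms are closed under left multiplication by the generators and
    their inverses, so they contain every word.\<close>
  define E where "E = {\<sigma> [^]\<^bsub>G\<^esub> i \<otimes>\<^bsub>G\<^esub> \<tau> [^]\<^bsub>G\<^esub> j |(i::nat) (j::nat). True}"
  have E\<sigma>: "\<sigma> \<otimes>\<^bsub>G\<^esub> x \<in> E" if "x \<in> E" for x
  proof -
    from that obtain i j where x: "x = \<sigma> [^]\<^bsub>G\<^esub> (i::nat) \<otimes>\<^bsub>G\<^esub> \<tau> [^]\<^bsub>G\<^esub> (j::nat)" unfolding E_def by blast
    have "\<sigma> \<otimes>\<^bsub>G\<^esub> x = \<sigma> [^]\<^bsub>G\<^esub> Suc i \<otimes>\<^bsub>G\<^esub> \<tau> [^]\<^bsub>G\<^esub> j"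
      by (subst G.nat_pow_Suc2) (simp_all add: x G.m_assoc)
    thus ?thesis unfolding E_def by blast
  qed
  have E\<tau>: "\<tau> \<otimes>\<^bsub>G\<^esub> x \<in> E" if "x \<in> E" for x
  proof -
    from that obtain i j where x: "x = \<sigma> [^]\<^bsub>G\<^esub> (i::nat) \<otimes>\<^bsub>G\<^esub> \<tau> [^]\<^bsub>G\<^esub> (j::nat)" unfolding E_def by blast
    \<comment> \<open>Moving \<tau> past a power of \<sigma> multiplies the exponent by t', so the
      exponent i is first written as t'(s i).\<close>
    have "[int (t' * (s * i)) = int i] (mod int p)"
      using cong_mult[OF st cong_refl[of "int i"]] by (simp add: mult_ac)
    hence "(t' * (s * i)) mod p = i mod p" by (simp only: cong_int_iff) (simp add: cong_def)
    hence "\<sigma> [^]\<^bsub>G\<^esub> i = \<sigma> [^]\<^bsub>G\<^esub> (t' * (s * i))" using pow_mod(1) by metis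
    hence "\<tau> \<otimes>\<^bsub>G\<^esub> x = \<sigma> [^]\<^bsub>G\<^esub> (s * i) \<otimes>\<^bsub>G\<^esub> (\<tau> \<otimes>\<^bsub>G\<^esub> \<tau> [^]\<^bsub>G\<^esub> j)"
      using comm_pow[of "s * i"] by (simp add: x G.m_assoc[symmetric])
    also have "\<tau> \<otimes>\<^bsub>G\<^esub> \<tau> [^]\<^bsub>G\<^esub> j = \<tau> [^]\<^bsub>G\<^esub> Suc j" by (simp only: G.nat_pow_Suc2 closed)
    finally show ?thesis unfolding E_def by blast
  qed
  have Epow: "a [^]\<^bsub>G\<^esub> (m::nat) \<otimes>\<^bsub>G\<^esub> x \<in> E" if "\<And>x. x \<in> E \<Longrightarrow> a \<otimes>\<^bsub>G\<^esub> x \<in> E" "a \<in> carrier G" "x \<in> E" "E \<subseteq> carrier G" for a m x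
  proof (induction m)
    case (Suc m)
    have "x \<in> carrier G" using that by auto
    hence "a [^]\<^bsub>G\<^esub> Suc m \<otimes>\<^bsub>G\<^esub> x = a \<otimes>\<^bsub>G\<^esub> (a [^]\<^bsub>G\<^esub> m \<otimes>\<^bsub>G\<^esub> x)"
      using that(2) by (subst G.nat_pow_Suc2) (simp_all add: G.m_assoc)
    thus ?case using that(1)[OF Suc] by simp
  qed (use that in auto)
  have EG: "E \<subseteq> carrier G" by (auto simp: E_def)
  have inv_pow: "inv\<^bsub>G\<^esub> \<sigma> = \<sigma> [^]\<^bsub>G\<^esub> (p - 1)" "inv\<^bsub>G\<^esub> \<tau> = \<tau> [^]\<^bsub>G\<^esub> (n - 1)"
  proof -
    have "\<sigma> [^]\<^bsub>G\<^esub> (p - 1) \<otimes>\<^bsub>G\<^esub> \<sigma> = \<one>\<^bsub>G\<^esub>" using \<sigma>p p by (metis G.nat_pow_Suc One_nat_def Suc_pred less_trans zero_less_one)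
    thus "inv\<^bsub>G\<^esub> \<sigma> = \<sigma> [^]\<^bsub>G\<^esub> (p - 1)" by (simp add: G.inv_equality)
    have "\<tau> [^]\<^bsub>G\<^esub> (n - 1) \<otimes>\<^bsub>G\<^esub> \<tau> = \<one>\<^bsub>G\<^esub>" using \<tau>n n by (metis G.nat_pow_Suc One_nat_def Suc_pred)
    thus "inv\<^bsub>G\<^esub> \<tau> = \<tau> [^]\<^bsub>G\<^esub> (n - 1)" by (simp add: G.inv_equality)
  qed
  have wrd_E: "wrd w \<in> E" for w
  proof (induction w)
    case Nil
    have "\<one>\<^bsub>G\<^esub> = \<sigma> [^]\<^bsub>G\<^esub> (0::nat) \<otimes>\<^bsub>G\<^esub> \<tau> [^]\<^bsub>G\<^esub> (0::nat)" by simp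
    thus ?case unfolding E_def wrd_Nil by blast
  next
    case (Cons l w)
    have "wrd [l] \<otimes>\<^bsub>G\<^esub> wrd w \<in> E"
    proof (cases l)
      case (Pair a b)
      show ?thesis
        using E\<sigma>[OF Cons] E\<tau>[OF Cons] Epow[OF E\<sigma> _ Cons EG, of "p - 1", folded inv_pow]
          Epow[OF E\<tau> _ Cons EG, of "n - 1", folded inv_pow]
        unfolding Pair by (cases a; cases b) (simp_all add: wrd_inverse flip: \<sigma>_def \<tau>_def)
    qed
    thus ?case by (simp add: wrd_Cons[of l w])
  qed
  let ?f = "\<lambda>(i, j). \<sigma> [^]\<^bsub>G\<^esub> i \<otimes>\<^bsub>G\<^esub> \<tau> [^]\<^bsub>G\<^esub> j"
  have "inj_on ?f ({..<p} \<times> {..<n})"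
  proof (rule inj_onI, clarify)
    fix i j i' j' assume ij: "i < p" "j < n" "i' < p" "j' < n"
      and eq: "\<sigma> [^]\<^bsub>G\<^esub> i \<otimes>\<^bsub>G\<^esub> \<tau> [^]\<^bsub>G\<^esub> j = \<sigma> [^]\<^bsub>G\<^esub> i' \<otimes>\<^bsub>G\<^esub> \<tau> [^]\<^bsub>G\<^esub> j'"
    define w where "w i j = replicate i (Sigma, False) @ replicate j (Tau, False)" for i j
    have "wrd (w i j) = wrd (w i' j')"
      using eq by (simp add: w_def wrd_append wrd_replicate \<sigma>_def \<tau>_def)
    hence pc: "pres_cong Rel (w i j) (w i' j')" by (simp add: wrd_eq_iff)
    have stt: "[int s * t = 1] (mod int p)"
    proof -
      have "[int s * t = int s * int t'] (mod int p)"
        using p by (intro cong_mult cong_refl) (simp add: t' cong_def)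
      thus ?thesis using st by (auto intro: cong_trans)
    qed
    have spow: "[int s ^ m * int t' ^ m = 1] (mod int p)" for m
      using cong_pow[OF st, of m] by (simp add: power_mult_distrib)
    have sn: "[int s ^ m = 1] (mod int p) \<longleftrightarrow> [int t' ^ m = 1] (mod int p)" for m
    proof -
      have "[b = 1] (mod int p)" if "[a * b = 1] (mod int p)" "[a = 1] (mod int p)" for a b
        using cong_trans[OF cong_sym[OF cong_mult[OF that(2) cong_refl[of b]]] that(1)] by simp
      from this[of "int s ^ m" "int t' ^ m"] this[of "int t' ^ m" "int s ^ m"] spow[of m]
      show ?thesis by (auto simp: mult.commute)
    qed
    have "[int s ^ n = 1] (mod int p)" using ord[of n] by (simp add: sn)
    from word_act_pres_cong[OF pc[unfolded Rel_def] stt this]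
    have wa: "[int s ^ j * x + int i = int s ^ j' * x + int i'] (mod int p)" for x
      by (simp add: w_def word_act_append word_act_replicate)
    \<comment> \<open>The affine map determines both exponents: its value at 0 gives i, and its
      value at 1 then gives s^j and so j modulo n.\<close>
    from wa[of 0] ij have i: "i = i'" by (simp add: cong_int_iff cong_less_modulus_unique_nat)
    from wa[of 1] have "[int s ^ j = int s ^ j'] (mod int p)" unfolding i mult_1_right
      by (simp only: cong_add_rcancel)
    moreover have "j1 = j2" if "[int s ^ j1 = int s ^ j2] (mod int p)" "j1 \<le> j2" "j2 < n" for j1 j2
    proof -
      have "[int s ^ j1 * int t' ^ j1 = int s ^ j2 * int t' ^ j1] (mod int p)"
        by (intro cong_mult that cong_refl)
      also have "int s ^ j2 * int t' ^ j1 = int s ^ (j2 - j1) * (int s ^ j1 * int t' ^ j1)"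
        using that(2) by (simp add: mult.assoc[symmetric] flip: power_add)
      also have "[\<dots> = int s ^ (j2 - j1) * 1] (mod int p)" by (intro cong_mult spow cong_refl)
      finally have "[int s ^ (j2 - j1) = 1] (mod int p)"
        using spow[of j1] by (auto intro: cong_trans cong_sym)
      hence "n dvd j2 - j1" using ord by (simp add: sn)
      hence "j2 - j1 = 0" using that by (metis dvd_imp_le less_imp_diff_less not_gr_zero not_less)
      thus ?thesis using that(2) by simp
    qed
    ultimately have "j = j'" using ij by (metis cong_sym nat_le_linear)
    with i show "i = i' \<and> j = j'" by simp
  qed
  moreover have "?f ` ({..<p} \<times> {..<n}) = carrier G"
  proof
    show "carrier G \<subseteq> ?f ` ({..<p} \<times> {..<n})"
    proof
      fix x assume "x \<in> carrier G"
      then obtain w where "x = wrd w" using wrd_surj by blast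
      hence "x \<in> E" using wrd_E by simp
      then obtain i j where "x = \<sigma> [^]\<^bsub>G\<^esub> (i::nat) \<otimes>\<^bsub>G\<^esub> \<tau> [^]\<^bsub>G\<^esub> (j::nat)" unfolding E_def by blast
      hence "x = ?f (i mod p, j mod n)" using pow_mod[of i] pow_mod[of j] by simp
      thus "x \<in> ?f ` ({..<p} \<times> {..<n})" using p n by (intro image_eqI[of _ _ "(i mod p, j mod n)"]) auto
    qed
  qed auto
  ultimately have "bij_betw ?f ({..<p} \<times> {..<n}) (carrier G)" by (simp add: bij_betw_def)
  from that[OF closed \<sigma>p \<tau>n comm this] show thesis .
qed

subsection \<open>Integer polynomials at roots of unity\<close>

definition ev :: "int poly \<Rightarrow> 'a::comm_ring_1 \<Rightarrow> 'a" where
  "ev F x = fold_coeffs (\<lambda>c r. of_int c + x * r) F 0"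

lemma ev_0 [simp]: "ev 0 x = 0"
  by (simp add: ev_def)

lemma ev_pCons: "ev (pCons c F) x = of_int c + x * ev F x"
  by (cases "F = 0 \<and> c = 0") (auto simp: ev_def)

lemma ev_add: "ev (F + G) x = ev F x + ev G x"
  by (induction F G rule: poly_induct2) (auto simp: ev_pCons algebra_simps)

lemma ev_smult: "ev (smult c F) x = of_int c * ev F x"
  by (induction F) (auto simp: ev_pCons algebra_simps)

lemma ev_uminus: "ev (- F) x = - ev F x"
  using ev_smult[of "-1" F x] by simp

lemma ev_diff: "ev (F - G) x = ev F x - ev G x"
  using ev_add[of F "- G" x] by (simp add: ev_uminus)

lemma ev_mult: "ev (F * G) x = ev F x * ev G x"
  by (induction F) (auto simp: ev_pCons ev_add ev_smult algebra_simps)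

lemma ev_1 [simp]: "ev 1 x = 1"
  unfolding one_pCons by (simp add: ev_pCons)

lemma ev_monom: "ev (monom c i) x = of_int c * x ^ i"
  by (induction i) (simp_all add: monom_0 monom_Suc ev_pCons mult_ac)

lemma ev_of_nat: "ev (of_nat i) x = of_nat i"
  by (simp add: of_nat_poly ev_pCons)

lemma ev_of_int: "ev (of_int i) x = of_int i"
  by (simp add: of_int_poly ev_pCons)

lemma ev_power: "ev (F ^ i) x = ev F x ^ i"
  by (induction i) (auto simp: ev_mult)

lemma ev_sum: "ev (\<Sum>i\<in>I. F i) x = (\<Sum>i\<in>I. ev (F i) x)"
  by (induction I rule: infinite_finite_induct) (auto simp: ev_add)

lemma ev_prod: "ev (\<Prod>i\<in>I. F i) x = (\<Prod>i\<in>I. ev (F i) x)"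
  by (induction I rule: infinite_finite_induct) (auto simp: ev_mult)

lemma ev_pcompose: "ev (F \<circ>\<^sub>p G) x = ev F (ev G x)"
  by (induction F) (auto simp: pcompose_pCons ev_pCons ev_add ev_mult)

lemma ev_of_int_arg: "ev F (of_int i) = of_int (poly F i)"
  by (induction F) (auto simp: ev_pCons)

lemmas ev_simps = ev_add ev_diff ev_uminus ev_mult ev_smult ev_monom ev_of_nat ev_of_int ev_power
  ev_sum ev_prod ev_pcompose

lemma ev_idl_eq_0:
  assumes "F \<in> idl S" "\<And>G. G \<in> S \<Longrightarrow> ev G x = 0"
  shows "ev F x = 0"
  using assms(1) by (induction rule: idl.induct) (auto simp: ev_simps assms(2))

lemma dvd_ev_diff: "\<exists>G. ev F (ev A x) - ev F (ev B x) = (ev A x - ev B x) * ev G x"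
proof (induction F)
  case (pCons c F)
  then obtain G where G: "ev F (ev A x) - ev F (ev B x) = (ev A x - ev B x) * ev G x" by blast
  have "ev (pCons c F) (ev A x) - ev (pCons c F) (ev B x) =
     (ev A x - ev B x) * ev F (ev A x) + ev B x * (ev F (ev A x) - ev F (ev B x))"
    by (simp add: ev_pCons algebra_simps)
  also have "\<dots> = (ev A x - ev B x) * ev (F \<circ>\<^sub>p A + B * G) x"
    unfolding G by (simp add: ev_simps algebra_simps)
  finally show ?case by blast
qed (auto intro: exI[of _ 0])

section \<open>Frobenius congruences\<close>

lemma prime_dvd_add_power:
  fixes u v :: "'a::comm_ring_1"
  assumes "Factorial_Ring.prime (l::nat)"
  shows "of_nat l dvd (u + v) ^ l - u ^ l - v ^ l"
proof -
  have l: "0 < l" using assms by (rule prime_gt_0_nat)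
  have "{..l} = insert 0 (insert l {0<..<l})" using l by auto
  hence "(u + v) ^ l = u ^ l + v ^ l + (\<Sum>k\<in>{0<..<l}. of_nat (l choose k) * u ^ k * v ^ (l - k))"
    using l by (simp add: binomial_ring add_ac)
  moreover have "of_nat l dvd (\<Sum>k\<in>{0<..<l}. of_nat (l choose k) * u ^ k * v ^ (l - k))"
  proof (rule dvd_sum)
    fix k assume "k \<in> {0<..<l}"
    hence "l dvd l choose k" using assms by (intro dvd_choose_prime) auto
    then obtain r where "l choose k = l * r" by (auto elim: dvdE)
    thus "of_nat l dvd of_nat (l choose k) * u ^ k * v ^ (l - k)" by (simp add: mult.assoc)
  qed
  ultimately show ?thesis by simp
qed

text \<open>Modulo l, raising to the l-th power is additive and, by Fermat, fixes constants.\<close>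

lemma frobenius_int_poly:
  assumes "Factorial_Ring.prime (l::nat)"
  shows "of_nat l dvd F ^ l - F \<circ>\<^sub>p (monom 1 l :: int poly)"
proof (induction F)
  case 0
  thus ?case using assms by (simp add: zero_power prime_gt_0_nat)
next
  case (pCons c F)
  let ?X = "monom 1 1 :: int poly"
  have c: "of_nat l dvd [:c:] ^ l - [:c:]"
  proof -
    have "[c ^ l = c] (mod int l)"
    proof (cases "int l dvd c")
      case True
      thus ?thesis using assms by (auto simp: cong_def mod_eq_0_iff_dvd prime_gt_0_nat intro: dvd_trans dvd_power)
    next
      case False
      define d where "d = nat (c mod int l)"
      have l0: "0 < l" using assms by (rule prime_gt_0_nat)
      have d: "[c = int d] (mod int l)" using l0 by (simp add: d_def cong_def)
      have "\<not> l dvd d"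
        using False d l0 by (metis cong_dvd_iff int_dvd_int_iff)
      hence "[d ^ (l - 1) = 1] (mod l)" using assms by (rule fermat_theorem[rotated])
      hence "[int d ^ (l - 1) = 1] (mod int l)" by (metis cong_int_iff of_nat_1 of_nat_power)
      from cong_mult[OF this cong_refl[of "int d"]] have "[int d ^ l = int d] (mod int l)"
        using l0 by (simp flip: power_Suc2)
      thus ?thesis using d cong_pow[OF d, of l] by (meson cong_sym cong_trans)
    qed
    hence "int l dvd c ^ l - c" by (simp add: cong_iff_dvd_diff)
    then obtain r where "c ^ l - c = int l * r" by (auto elim: dvdE)
    hence "[:c:] ^ l - [:c:] = of_nat l * [:r:]"
      by (simp add: poly_const_pow of_nat_poly)
    thus ?thesis by (simp only: dvd_triv_left)
  qed
  have eq: "pCons c F = [:c:] + ?X * F" by (simp add: monom_Suc monom_0)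
  have 1: "pCons c F \<circ>\<^sub>p monom 1 l = [:c:] + ?X ^ l * (F \<circ>\<^sub>p monom 1 l)"
    by (simp add: pcompose_pCons monom_power)
  have "pCons c F ^ l - pCons c F \<circ>\<^sub>p monom 1 l =
     (([:c:] + ?X * F) ^ l - [:c:] ^ l - (?X * F) ^ l) + ([:c:] ^ l - [:c:]) + ?X ^ l * (F ^ l - F \<circ>\<^sub>p monom 1 l)"
    unfolding 1 power_mult_distrib by (subst eq) (simp add: algebra_simps)
  also have "of_nat l dvd \<dots>"
    by (intro dvd_add prime_dvd_add_power[OF assms] c dvd_mult pCons.IH)
  finally show ?case .
qed

lemma frobenius_ev:
  assumes "Factorial_Ring.prime (l::nat)"
  shows "\<exists>G. ev F x ^ l - ev F (x ^ l) = of_nat l * ev G x"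
proof -
  obtain G where "F ^ l - F \<circ>\<^sub>p monom 1 l = of_nat l * G" using frobenius_int_poly[OF assms] by (auto elim: dvdE)
  from arg_cong[OF this, of "\<lambda>H. ev H x"] show ?thesis by (auto simp: ev_simps)
qed

section \<open>Minimal integer polynomials and Galois conjugation\<close>

lemma Xm1_monic:
  assumes "0 < n" shows "lead_coeff (Xm1 n) = 1" "degree (Xm1 n) = n"
proof -
  have "Xm1 n = monom 1 n + - 1" by (simp add: Xm1_def)
  also have "degree \<dots> = n" using assms by (subst degree_add_eq_left) (auto simp: degree_monom_eq)
  finally show "degree (Xm1 n) = n" .
  thus "lead_coeff (Xm1 n) = 1" using assms by (simp add: Xm1_def)
qed

text \<open>Of least degree and content 1 rather than monic: by pseudo-division and Gauss's lemma
  such an f divides every integer polynomial vanishing at z, without rational coefficients.\<close>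

definition minimal_ipoly :: "int poly \<Rightarrow> complex \<Rightarrow> bool" where
  "minimal_ipoly f z \<longleftrightarrow> f \<noteq> 0 \<and> ev f z = 0 \<and> content f = 1 \<and>
     (\<forall>g. ev g z = 0 \<longrightarrow> degree g < degree f \<longrightarrow> g = 0)"

lemma minimal_ipoly_exists:
  assumes "g \<noteq> 0" "ev g z = 0"
  shows "\<exists>f. minimal_ipoly f z"
proof -
  define f0 where "f0 = arg_min degree (\<lambda>g. g \<noteq> 0 \<and> ev g z = 0)"
  have f0: "f0 \<noteq> 0 \<and> ev f0 z = 0"
    unfolding f0_def by (rule arg_min_natI[where P = "\<lambda>g. g \<noteq> 0 \<and> ev g z = 0", of g]) (use assms in auto)
  have min: "degree f0 \<le> degree h" if "h \<noteq> 0" "ev h z = 0" for h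
    unfolding f0_def using that by (intro arg_min_nat_le) auto
  define f where "f = primitive_part f0"
  have "smult (content f0) f = f0" by (simp add: f_def)
  hence "of_int (content f0) * ev f z = 0" using f0 ev_smult by metis
  moreover have "content f0 \<noteq> 0" using f0 by simp
  ultimately have "ev f z = 0" by simp
  moreover have "f \<noteq> 0" "content f = 1" using f0 by (simp_all add: f_def)
  moreover have "degree f = degree f0" by (simp add: f_def)
  ultimately show ?thesis unfolding minimal_ipoly_def using min by (metis leD)
qed

lemma dvd_smult_content:
  assumes "content f = 1" "f dvd smult c F" "c \<noteq> 0"
  shows "f dvd (F :: int poly)"
proof -
  from assms(2) obtain g where g: "smult c F = f * g" by (auto elim: dvdE)
  have "content (smult c F) = content g" by (simp add: g content_mult assms(1))
  hence "c dvd content g" by (metis content_smult dvd_mult2 dvd_normalize_iff dvd_refl mult_dvd_mono normalize_mult dvd_triv_left)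
  hence "[:c:] dvd g" by (simp add: const_poly_dvd_iff_dvd_content)
  then obtain g' where "g = smult c g'" by (auto elim: dvdE)
  hence "smult c F = smult c (f * g')" using g by simp
  hence "smult c (F - f * g') = 0" by (simp add: smult_diff_right)
  hence "F = f * g'" using assms(3) by simp
  thus ?thesis by simp
qed

lemma minimal_ipoly_dvd:
  assumes f: "minimal_ipoly f z" and F: "ev F z = 0"
  shows "f dvd F"
proof -
  obtain q r where qr: "pseudo_divmod F f = (q, r)" by force
  have f0: "f \<noteq> 0" using f by (simp add: minimal_ipoly_def)
  define c where "c = Polynomial.coeff f (degree f) ^ (Suc (degree F) - degree f)"
  have *: "smult c F = f * q + r" "r = 0 \<or> degree r < degree f"
    using pseudo_divmod[OF f0 qr] by (auto simp: c_def)
  have "ev r z = 0"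
    using arg_cong[OF *(1), of "\<lambda>H. ev H z"] F f by (simp add: ev_simps minimal_ipoly_def)
  hence "r = 0" using *(2) f by (auto simp: minimal_ipoly_def)
  hence "f dvd smult c F" using *(1) by simp
  moreover have "c \<noteq> 0" using f0 by (simp add: c_def)
  ultimately show ?thesis using f dvd_smult_content by (auto simp: minimal_ipoly_def)
qed

text \<open>The classical argument behind the irreducibility of cyclotomic polynomials. If z^l is no
  root of f, where X^n - 1 = f h, then h(z^l) = 0, so l divides h(z)^l by the Frobenius congruence.
  The derivative n z^(n-1) = f'(z) h(z) turns this into l dividing n^l in \<int>[z].\<close>

lemma galois_conj_prime:
  assumes n: "0 < n" and z: "z ^ n = 1" and F: "ev F z = 0"
    and l: "Factorial_Ring.prime l" "\<not> l dvd n"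
  shows "ev F (z ^ l :: complex) = 0"
proof (rule ccontr)
  assume F': "ev F (z ^ l) \<noteq> 0"
  have X: "ev (Xm1 n) z = 0" using z by (simp add: Xm1_def ev_simps)
  have X0: "Xm1 n \<noteq> 0"
  proof
    assume "Xm1 n = 0"
    hence "Polynomial.coeff (Xm1 n) n = 0" by simp
    thus False using n by (simp add: Xm1_def)
  qed
  obtain f where f: "minimal_ipoly f z" using minimal_ipoly_exists[OF X0 X] by blast
  obtain h where h: "Xm1 n = f * h" using minimal_ipoly_dvd[OF f X] by (auto elim: dvdE)
  obtain F1 where F1: "F = f * F1" using minimal_ipoly_dvd[OF f F] by (auto elim: dvdE)
  have "ev (Xm1 n) (z ^ l) = 0"
    using z by (simp add: Xm1_def ev_simps) (metis mult.commute power_mult power_one)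
  hence "ev h (z ^ l) = 0" using F' by (simp add: h F1 ev_simps)
  then obtain G where G: "ev h z ^ l = of_nat l * ev G z" using frobenius_ev[OF l(1), of h z] by auto
  have fz: "ev f z = 0" using f by (simp add: minimal_ipoly_def)
  have "pderiv (Xm1 n) = of_nat n * monom 1 (n - 1)"
    by (simp add: Xm1_def pderiv_diff pderiv_monom of_nat_poly smult_monom)
  hence "of_nat n * z ^ (n - 1) = ev (pderiv f) z * ev h z"
    using arg_cong[OF h, of "\<lambda>H. ev (pderiv H) z"] fz by (simp add: pderiv_mult ev_simps)
  hence "(of_nat n * z ^ (n - 1)) ^ l * z ^ l = of_nat l * ev (pderiv f ^ l * G * monom 1 l) z"
    by (simp add: power_mult_distrib G ev_simps mult_ac)
  moreover have "(of_nat n * z ^ (n - 1)) ^ l * z ^ l = (of_nat n * (z ^ (n - 1) * z)) ^ l"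
    by (simp add: power_mult_distrib mult_ac)
  moreover have "z ^ (n - 1) * z = 1" using z n by (simp flip: power_Suc2)
  ultimately have "\<exists>R. of_nat (n ^ l) = of_nat l * ev R z" by (metis mult.right_neutral of_nat_power)
  then obtain R where R: "of_nat (n ^ l) = of_nat l * ev R z" ..
  \<comment> \<open>From \<int>[z] back to the integers: the leading coefficient of f is a unit, so
    R can be reduced below the degree of f, where by minimality the relation at z holds between
    polynomials and constant terms can be compared.\<close>
  have f0: "f \<noteq> 0" using f by (simp add: minimal_ipoly_def)
  obtain q r where qr: "pseudo_divmod R f = (q, r)" by force
  define c where "c = Polynomial.coeff f (degree f) ^ (Suc (degree R) - degree f)"
  have *: "smult c R = f * q + r" "r = 0 \<or> degree r < degree f"
    using pseudo_divmod[OF f0 qr] by (auto simp: c_def)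
  have "lead_coeff f * lead_coeff h = 1"
  proof -
    have "lead_coeff (Xm1 n) = 1" using n by (rule Xm1_monic)
    thus ?thesis by (simp add: h lead_coeff_mult)
  qed
  hence "lead_coeff f dvd 1" by (metis dvd_triv_left)
  hence c1: "\<bar>c\<bar> = 1" by (simp add: c_def power_abs)
  have df: "0 < degree f"
  proof (rule ccontr)
    assume "\<not> 0 < degree f"
    then obtain a where "f = [:a:]" by (metis degree_eq_zeroE gr0I)
    thus False using f0 fz by (simp add: ev_pCons)
  qed
  have "ev (smult (int l) r - [:c * int (n ^ l):]) z = 0"
    using arg_cong[OF *(1), of "\<lambda>H. ev H z"] R fz by (simp add: ev_simps ev_pCons algebra_simps)
  moreover have "degree (smult (int l) r - [:c * int (n ^ l):]) < degree f"
    using df *(2) by (intro degree_diff_less) auto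
  ultimately have "smult (int l) r = [:c * int (n ^ l):]" using f by (auto simp: minimal_ipoly_def)
  hence "Polynomial.coeff (smult (int l) r) 0 = c * int (n ^ l)" by simp
  hence "int l dvd c * int (n ^ l)" by (metis coeff_smult dvd_triv_left)
  hence "int l dvd int (n ^ l)" using c1 by (metis dvd_abs_iff abs_mult mult_1)
  hence "l dvd n ^ l" by (simp only: int_dvd_int_iff)
  thus False using l prime_dvd_power by blast
qed

text \<open>The prime factors of j are prime to n, and \<open>galois_conj_prime\<close> applies to
  them in turn.\<close>

lemma galois_conj:
  assumes n: "0 < n" and z: "z ^ n = 1" and F: "ev F z = 0" and j: "coprime j n" "0 < j"
  shows "ev F (z ^ j :: complex) = 0"
  using j(2,1)
proof (induction j rule: nat_less_induct)
  case (1 j)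
  show ?case
  proof (cases "j = 1")
    case False
    then obtain l where l: "Factorial_Ring.prime l" "l dvd j" using prime_factor_nat by blast
    then obtain i where i: "j = l * i" by (auto elim: dvdE)
    have "i < j" "0 < i" "coprime i n" "coprime l n" using 1 l prime_gt_1_nat[OF l(1)] by (auto simp: i)
    hence "ev F (z ^ i) = 0" using 1 by blast
    moreover have "(z ^ i) ^ n = 1" using z by (metis mult.commute power_mult power_one)
    moreover have "\<not> l dvd n" using \<open>coprime l n\<close> l(1) by (metis coprime_common_divisor_nat dvd_refl not_prime_1)
    ultimately have "ev F ((z ^ i) ^ l) = 0" using galois_conj_prime[OF n] l(1) by blast
    thus ?thesis by (simp add: i mult.commute flip: power_mult)
  qed (use F in auto)
qed

section \<open>The ideal of the primitive roots of unity\<close>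

lemma monom_pcompose_monom: "monom (1::int) i \<circ>\<^sub>p monom 1 V = monom 1 (V * i)"
  by (induction i) (simp_all add: monom_0 monom_Suc pcompose_pCons mult_monom)

lemma primitive_mult:
  assumes a: "primitive_root_of_unity a (x::complex)" and b: "primitive_root_of_unity b y"
    and ab: "coprime a b" "0 < a" "0 < b"
  shows "primitive_root_of_unity (a * b) (x * y)"
proof -
  have x: "x ^ a = 1" and y: "y ^ b = 1" using a b by (auto simp: primitive_root_of_unity_def)
  have "a * b dvd j" if "(x * y) ^ j = 1" for j
  proof -
    have "(x * y) ^ (j * b) = 1" "(x * y) ^ (j * a) = 1" using that by (simp_all add: power_mult)
    moreover have "y ^ (j * b) = 1" "x ^ (j * a) = 1" using x y by (simp_all add: mult.commute[of j] power_mult)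
    ultimately have "x ^ (j * b) = 1" "y ^ (j * a) = 1" by (auto simp: power_mult_distrib)
    hence "a dvd j * b" "b dvd j * a"
      using primitive_power_eq_1_iff[OF a ab(2)] primitive_power_eq_1_iff[OF b ab(3)] by auto
    hence "a dvd j" "b dvd j" using ab(1) by (auto simp: coprime_dvd_mult_left_iff coprime_commute)
    thus ?thesis using ab(1) by (rule divides_mult)
  qed
  hence "(x * y) ^ j \<noteq> 1" if "0 < j" "j < a * b" for j
    using that by (metis dvd_imp_le not_less)
  moreover have "(x * y) ^ (a * b) = 1"
  proof -
    have "(x * y) ^ (a * b) = (x ^ a) ^ b * (y ^ b) ^ a"
      by (simp add: power_mult_distrib mult.commute[of a] flip: power_mult)
    thus ?thesis using x y by simp
  qed
  ultimately show ?thesis by (simp add: primitive_root_of_unity_def)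
qed

lemma primitive_prime_power_iff:
  assumes q: "Factorial_Ring.prime (q::nat)"
  shows "primitive_root_of_unity (q ^ Suc e) (w::complex) \<longleftrightarrow> w ^ (q ^ Suc e) = 1 \<and> w ^ (q ^ e) \<noteq> 1"
proof
  assume "primitive_root_of_unity (q ^ Suc e) w"
  thus "w ^ (q ^ Suc e) = 1 \<and> w ^ (q ^ e) \<noteq> 1"
    using prime_gt_1_nat[OF q] by (auto simp: primitive_root_of_unity_def)
next
  assume w: "w ^ (q ^ Suc e) = 1 \<and> w ^ (q ^ e) \<noteq> 1"
  have "w ^ j \<noteq> 1" if j: "0 < j" "j < q ^ Suc e" for j
  proof
    assume wj: "w ^ j = 1"
    have "gcd j (q ^ Suc e) dvd q ^ Suc e" by simp
    then obtain i where i: "i \<le> Suc e" "gcd j (q ^ Suc e) = q ^ i"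
      using divides_primepow_nat[OF q] by blast
    have "i \<noteq> Suc e"
    proof
      assume "i = Suc e"
      hence "q ^ Suc e dvd j" using i(2) by (metis gcd_dvd1)
      thus False using j by (auto dest: dvd_imp_le)
    qed
    hence "gcd j (q ^ Suc e) dvd q ^ e" using i by (simp add: le_imp_power_dvd)
    moreover obtain x y where "j * x = q ^ Suc e * y + gcd j (q ^ Suc e)"
      using bezout_nat[of j "q ^ Suc e"] j by auto
    hence "w ^ (j * x) = w ^ (q ^ Suc e * y) * w ^ gcd j (q ^ Suc e)" by (simp add: power_add)
    hence "w ^ gcd j (q ^ Suc e) = 1" using w wj by (simp add: power_mult del: power_Suc)
    moreover from calculation(1) obtain k where "q ^ e = gcd j (q ^ Suc e) * k" by (rule dvdE)
    hence "w ^ (q ^ e) = (w ^ gcd j (q ^ Suc e)) ^ k" by (simp only: power_mult)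
    ultimately show False using w by simp
  qed
  thus "primitive_root_of_unity (q ^ Suc e) w" using w by (simp add: primitive_root_of_unity_def)
qed

lemma card_primitive_prime_power:
  assumes q: "Factorial_Ring.prime (q::nat)"
  shows "card {w::complex. primitive_root_of_unity (q ^ Suc e) w} = q ^ Suc e - q ^ e"
proof -
  have q0: "0 < q" using q by (rule prime_gt_0_nat)
  have "{w::complex. primitive_root_of_unity (q ^ Suc e) w} = {w. w ^ (q ^ Suc e) = 1} - {w. w ^ (q ^ e) = 1}"
    using primitive_prime_power_iff[OF q] by blast
  moreover have "{w::complex. w ^ (q ^ e) = 1} \<subseteq> {w. w ^ (q ^ Suc e) = 1}"
    by (auto simp: mult.commute[of q] power_mult)
  ultimately show ?thesis using q0
    by (simp add: card_Diff_subset card_roots_unity_eq finite_roots_unity del: power_Suc)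
qed

lemma Xm1_dvd_monom_diff:
  assumes "[i = j] (mod n)" shows "Xm1 n dvd monom 1 i - monom 1 j"
proof -
  have *: "Xm1 n dvd monom 1 (j + n * k) - monom 1 j" for j k
  proof -
    have "monom 1 (j + n * k) - monom 1 j = monom (1::int) j * Xm1 (n * k)"
      by (simp add: Xm1_def mult_monom algebra_simps)
    thus ?thesis using Xm1_dvd_mult by simp
  qed
  have "i = i mod n + n * (i div n)" by simp
  moreover have "j = i mod n + n * (j div n)" using assms by (metis cong_def mod_mult_div_eq)
  ultimately
  have "Xm1 n dvd (monom 1 i - monom 1 (i mod n)) - (monom 1 j - monom 1 (i mod n))"
    using dvd_diff[OF *[of "i mod n" "i div n"] *[of "i mod n" "j div n"]] by metis
  thus ?thesis by simp
qed

text \<open>Substituting X^V multiplies the exponents by V = c V'. As V' is prime to r, this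
  permutes the r multiples of c m/r modulo c m.\<close>

lemma Npoly_pcompose_cong:
  assumes r: "r dvd m" "0 < m" "Factorial_Ring.prime r" and V: "[V = 1] (mod m)" "c dvd V"
  shows "Xm1 (c * m) dvd Npoly m r \<circ>\<^sub>p monom 1 V - Npoly (c * m) r"
proof -
  obtain V' where V': "V = c * V'" using V(2) by (auto elim: dvdE)
  obtain s where s: "m = r * s" using r by (auto elim: dvdE)
  have r0: "0 < r" using r(3) by (rule prime_gt_0_nat)
  have ms: "m div r = s" "c * m div r = c * s" using r0 by (simp_all add: s)
  have "coprime V' r"
  proof -
    have "coprime V m" using cong_imp_coprime[OF cong_sym[OF V(1)]] by simp
    thus ?thesis using r(1) by (auto simp: V' coprime_divisors)
  qed
  have 1: "Npoly m r \<circ>\<^sub>p monom 1 V = (\<Sum>i<r. monom 1 (c * s * (V' * i)))"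
    unfolding Npoly_def ms pcompose_sum
  proof (rule sum.cong)
    fix i
    show "monom (1::int) (s * i) \<circ>\<^sub>p monom 1 V = monom 1 (c * s * (V' * i))"
      by (simp add: monom_pcompose_monom V' mult_ac)
  qed auto
  have "bij_betw (\<lambda>i. V' * i mod r) {..<r} {..<r}"
  proof -
    have "inj_on (\<lambda>i. V' * i mod r) {..<r}"
    proof (rule inj_onI)
      fix i j assume ij: "i \<in> {..<r}" "j \<in> {..<r}" "V' * i mod r = V' * j mod r"
      hence "[V' * i = V' * j] (mod r)" by (simp add: cong_def)
      hence "[i = j] (mod r)" using \<open>coprime V' r\<close> by (simp add: cong_mult_lcancel_nat)
      thus "i = j" using ij by (simp add: cong_def)
    qed
    moreover have "(\<lambda>i. V' * i mod r) ` {..<r} \<subseteq> {..<r}" using r0 by auto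
    ultimately show ?thesis by (simp add: bij_betw_def endo_inj_surj)
  qed
  hence 2: "Npoly (c * m) r = (\<Sum>i<r. monom 1 (c * s * (V' * i mod r)))"
    unfolding Npoly_def ms by (rule sum.reindex_bij_betw[symmetric])
  have "Xm1 (c * m) dvd (\<Sum>i<r. monom 1 (c * s * (V' * i)) - monom 1 (c * s * (V' * i mod r)))"
  proof (rule dvd_sum, rule Xm1_dvd_monom_diff)
    fix i
    have "c * s * (V' * i mod r) = (c * s * (V' * i)) mod (c * s * r)" by (rule mult_mod_right)
    hence "[c * s * (V' * i) = c * s * (V' * i mod r)] (mod c * s * r)"
      unfolding cong_def by (metis mod_mod_trivial)
    thus "[c * s * (V' * i) = c * s * (V' * i mod r)] (mod c * m)" by (simp add: s mult_ac)
  qed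
  thus ?thesis by (simp add: 1 2 sum_subtractf)
qed

lemma idl_pcompose:
  assumes "F \<in> idl S" "\<And>G. G \<in> S \<Longrightarrow> G \<circ>\<^sub>p H \<in> idl (T :: int poly set)"
  shows "F \<circ>\<^sub>p H \<in> idl T"
  using assms(1)
  by (induction rule: idl.induct) (auto simp: pcompose_add pcompose_mult intro: idl.zero idl_add idl_mult assms(2))

text \<open>The product of \<open>Npoly n q\<close> and X^(n/q) - 1 vanishes at z, and the second
  factor does not.\<close>

lemma ev_gens_primitive:
  assumes n: "0 < n" and z: "primitive_root_of_unity n (z::'a::field)" and G: "G \<in> gens n"
  shows "ev G z = 0"
proof -
  have X: "ev (Xm1 n) z = 0" using z by (simp add: Xm1_def ev_simps primitive_root_of_unity_def)
  moreover have "ev (Npoly n q) z = 0" if q: "q \<in> prime_factors n" for q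
  proof -
    have qn: "q dvd n" "Factorial_Ring.prime q" using q by (auto simp: in_prime_factors_iff)
    have "ev (Npoly n q) z * ev (Xm1 (n div q)) z = 0"
      using X by (simp add: Npoly_mult[OF qn(1)] flip: ev_mult)
    moreover have "\<not> n dvd n div q"
    proof
      assume "n dvd n div q"
      moreover have "0 < n div q" using qn n by (auto elim!: dvdE)
      ultimately have "n \<le> n div q" by (rule dvd_imp_le)
      thus False using qn n prime_gt_1_nat[OF qn(2)] by (metis div_less_dividend not_less)
    qed
    hence "ev (Xm1 (n div q)) z \<noteq> 0"
      using primitive_power_eq_1_iff[OF z n] by (simp add: Xm1_def ev_simps)
    ultimately show ?thesis by simp
  qed
  ultimately show ?thesis using G by (auto simp: gens_def)
qed

text \<open>With \<open>n = q\<^sup>e m\<close>, every polynomial is modulo \<open>gens n\<close> a combination \<open>\<Sum>\<^sub>i Y\<^sup>i F\<^sub>i(Z)\<close>,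
  where \<open>Y\<close> and \<open>Z\<close> are the powers of \<open>X\<close> that project to the \<open>q\<close>-part and the prime-to-\<open>q\<close> part.\<close>

lemma vanish_primitive_imp_idl:
  assumes "0 < n" "\<And>z::complex. primitive_root_of_unity n z \<Longrightarrow> ev F z = 0"
  shows "F \<in> idl (gens n)"
  using assms
proof (induction n arbitrary: F rule: nat_less_induct)
  case (1 n)
  show ?case
  proof (cases "n = 1")
    case True
    have "primitive_root_of_unity n (1::complex)" by (auto simp: primitive_root_of_unity_def True)
    hence "ev F (1::complex) = 0" by (rule "1.prems"(2))
    hence "complex_of_int (poly F 1) = 0" using ev_of_int_arg[of F 1, where 'a = complex] by simp
    hence "[:-1, 1:] dvd F" by (simp add: poly_eq_0_iff_dvd)
    moreover have "[:-1, 1:] = Xm1 n" by (simp add: Xm1_def True monom_Suc monom_0 one_pCons)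
    ultimately show ?thesis by (auto intro!: idl_dvd[OF idl_incl] simp: gens_def)
  next
    case False
    then obtain q where q: "Factorial_Ring.prime q" "q dvd n" using prime_factor_nat by blast
    have n0: "0 < n" by fact
    define e' where "e' = multiplicity q n"
    have "e' \<noteq> 0" using prime_multiplicity_gt_zero_iff[of q n] q n0 by (auto simp: e'_def)
    then obtain e where e: "e' = Suc e" by (cases e') auto
    define Q where "Q = q ^ Suc e"
    obtain m where m: "n = Q * m" "\<not> q dvd m"
      using multiplicity_decompose'[of n q] q n0 prime_gt_1_nat[OF q(1)]
      by (metis Q_def e e'_def not_less_zero not_prime_unit)
    have m0: "0 < m" using m n0 by (cases m) auto
    have q1: "1 < q" using q(1) by (rule prime_gt_1_nat)
    have Q1: "1 < Q" unfolding Q_def using one_less_power[OF q1, of "Suc e"] by blast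
    hence Q1: "1 < Q" "0 < Q" by auto
    have co: "coprime Q m" using q(1) m(2) by (simp add: Q_def prime_imp_coprime coprime_power_left_iff del: power_Suc)
    have mn: "m < n" using m0 Q1 by (simp add: m)
    \<comment> \<open>U and V are the idempotents modulo n that belong to the factorisation n = Q m;
      X^U and X^V are Y and Z.\<close>
    obtain U where U: "[U = 1] (mod Q)" "[U = 0] (mod m)" using binary_chinese_remainder_nat[OF co] by blast
    obtain V where V: "[V = 0] (mod Q)" "[V = 1] (mod m)" using binary_chinese_remainder_nat[OF co] by blast
    have UV: "[U + V = 1] (mod n)"
      unfolding m using co cong_add[OF U(1) V(1)] cong_add[OF U(2) V(2)]
      by (intro coprime_cong_mult_nat) auto
    \<comment> \<open>The totient of Q, that is, the number of primitive Q-th roots of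
      unity.\<close>
    define \<phi> where "\<phi> = Q - q ^ e"
    define I where "I = idl (gens n)"
    define comb where "comb c = (\<Sum>i<\<phi>. monom 1 (U * i) * (c i \<circ>\<^sub>p monom 1 V))" for c :: "nat \<Rightarrow> int poly"
    define S where "S = {H. \<exists>c. H - comb c \<in> I}"
    have comb_add: "comb (\<lambda>i. c i + d i) = comb c + comb d" for c d
      by (simp add: comb_def pcompose_add distrib_left sum.distrib)
    have S_add: "H + H' \<in> S" if "H \<in> S" "H' \<in> S" for H H'
    proof -
      from that obtain c d where "H - comb c \<in> I" "H' - comb d \<in> I" by (auto simp: S_def)
      hence "(H - comb c) + (H' - comb d) \<in> I" unfolding I_def by (rule idl_add)
      hence "H + H' - comb (\<lambda>i. c i + d i) \<in> I" by (simp add: comb_add algebra_simps)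
      thus ?thesis by (auto simp: S_def)
    qed
    have S_mult: "(G \<circ>\<^sub>p monom 1 V) * H \<in> S" if "H \<in> S" for G H
    proof -
      from that obtain c where "H - comb c \<in> I" by (auto simp: S_def)
      hence "(G \<circ>\<^sub>p monom 1 V) * (H - comb c) \<in> I" unfolding I_def by (rule idl_mult)
      moreover have "(G \<circ>\<^sub>p monom 1 V) * comb c = comb (\<lambda>i. G * c i)"
        by (simp add: comb_def sum_distrib_left pcompose_mult mult_ac)
      ultimately have "(G \<circ>\<^sub>p monom 1 V) * H - comb (\<lambda>i. G * c i) \<in> I" by (simp add: right_diff_distrib)
      thus ?thesis by (auto simp: S_def)
    qed
    have S_I: "H \<in> S" if "H' \<in> S" "H - H' \<in> I" for H H'
    proof -
      from that obtain c where "H' - comb c \<in> I" by (auto simp: S_def)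
      from idl_add[OF that(2)[unfolded I_def] this[unfolded I_def]]
      show ?thesis by (auto simp: S_def I_def)
    qed
    have S_uminus: "- H \<in> S" if "H \<in> S" for H using S_mult[OF that, of "[:-1:]"] by simp
    have S_0: "0 \<in> S" unfolding S_def I_def
      by (intro CollectI exI[of _ "\<lambda>_. 0"]) (simp add: comb_def idl.zero)
    have S_sum: "(\<Sum>i\<in>A. f i) \<in> S" if "\<And>i. i \<in> A \<Longrightarrow> f i \<in> S" for A :: "nat set" and f
      using that by (induction A rule: infinite_finite_induct) (auto intro: S_add S_0)
    have XI: "Xm1 n \<in> I" and NI: "Npoly n q \<in> I"
      unfolding I_def using q n0 by (auto intro!: idl_incl simp: gens_def in_prime_factors_iff)
    have monom_I: "monom 1 i - monom 1 j \<in> I" if "[i = j] (mod n)" for i j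
      using idl_dvd[OF XI[unfolded I_def] Xm1_dvd_monom_diff[OF that]] by (simp add: I_def)
    have qe: "q ^ e * q = Q" by (simp add: Q_def)
    \<comment> \<open>The norm element of q, rewritten in Y, has top exponent q^e (q - 1) = \<phi>,
      so it lowers every exponent from \<phi> upwards.\<close>
    have Y_S: "monom 1 (U * i) \<in> S" for i
    proof (induction i rule: nat_less_induct)
      case (1 i)
      show ?case
      proof (cases "i < \<phi>")
        case True
        have "comb (\<lambda>j. if j = i then 1 else 0) = monom 1 (U * i)"
          using True by (simp add: comb_def pcompose_1 if_distrib[of "\<lambda>c. _ * (c \<circ>\<^sub>p _)"] cong: if_cong)
        thus ?thesis unfolding S_def I_def by (auto intro!: exI[of _ "\<lambda>j. if j = i then 1 else 0"] simp: idl.zero)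
      next
        case False
        define k where "k = i - \<phi>"
        have i: "i = k + \<phi>" using False by (simp add: k_def)
        have \<phi>: "\<phi> = q ^ e * (q - 1)" by (simp add: \<phi>_def Q_def algebra_simps)
        have "(\<Sum>j<q. monom 1 (U * (k + q ^ e * j))) \<in> I"
        proof -
          have "Npoly Q q \<circ>\<^sub>p monom 1 U - Npoly (m * Q) q \<in> I"
            using Npoly_pcompose_cong[of q Q U m] U q(1) Q1
            by (intro idl_dvd[OF XI[unfolded I_def], folded I_def])
               (auto simp: m mult.commute cong_0_iff Q_def)
          from idl_add[OF this[unfolded I_def] NI[unfolded I_def]]
          have "Npoly Q q \<circ>\<^sub>p monom 1 U \<in> I" by (simp add: m mult.commute I_def)
          hence "monom 1 (U * k) * (Npoly Q q \<circ>\<^sub>p monom 1 U) \<in> I" unfolding I_def by (rule idl_mult)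
          moreover have "monom 1 (U * k) * (Npoly Q q \<circ>\<^sub>p monom 1 U) = (\<Sum>j<q. monom 1 (U * (k + q ^ e * j)))"
            unfolding Npoly_def pcompose_sum sum_distrib_left
          proof (rule sum.cong)
            fix j
            have "Q div q = q ^ e" using q1 by (simp add: Q_def)
            thus "monom 1 (U * k) * (monom (1::int) (Q div q * j) \<circ>\<^sub>p monom 1 U) = monom 1 (U * (k + q ^ e * j))"
              by (simp add: monom_pcompose_monom mult_monom distrib_left)
          qed auto
          ultimately show ?thesis by simp
        qed
        moreover have "{..<q} = insert (q - 1) {..<q - 1}" using q1 by auto
        ultimately have "monom 1 (U * i) - - (\<Sum>j<q - 1. monom 1 (U * (k + q ^ e * j))) \<in> I"
          by (simp add: i \<phi>)
        moreover have "k + q ^ e * j < i" if "j < q - 1" for j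
          using that q1 by (simp add: i \<phi>)
        hence "- (\<Sum>j<q - 1. monom 1 (U * (k + q ^ e * j))) \<in> S"
          using 1 by (intro S_uminus S_sum) auto
        ultimately show ?thesis using S_I by blast
      qed
    qed
    have X_S: "monom 1 i \<in> S" for i
    proof -
      have "(monom 1 i \<circ>\<^sub>p monom 1 V) * monom 1 (U * i) \<in> S" by (intro S_mult Y_S)
      moreover have "(monom 1 i \<circ>\<^sub>p monom 1 V) * monom 1 (U * i) = monom (1::int) ((U + V) * i)"
        by (simp add: monom_pcompose_monom mult_monom distrib_right add.commute)
      moreover have "[i = (U + V) * i] (mod n)"
        using cong_mult[OF UV cong_refl[of i]] by (simp add: cong_sym)
      from monom_I[OF this] have "monom 1 i - monom 1 ((U + V) * i) \<in> I" .
      ultimately show ?thesis using S_I by metis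
    qed
    have "F \<in> S"
    proof -
      have "F = (\<Sum>i\<le>degree F. ([:Polynomial.coeff F i:] \<circ>\<^sub>p monom 1 V) * monom 1 i)"
        by (subst poly_as_sum_of_monoms[symmetric]) (simp add: smult_monom)
      also have "\<dots> \<in> S" by (intro S_sum S_mult X_S)
      finally show ?thesis .
    qed
    then obtain c where c: "F - comb c \<in> I" by (auto simp: S_def)
    have "c i \<in> idl (gens m)" if i: "i < \<phi>" for i
    proof -
      have "ev (c i) \<eta> = 0" if \<eta>: "primitive_root_of_unity m (\<eta>::complex)" for \<eta>
      proof -
        \<comment> \<open>At the product of \<eta> and a primitive Q-th root w, the combination
          becomes P(w). Its degree is below \<phi> and it has \<phi> roots, so P is zero and the
          induction hypothesis applies to each \<open>c i\<close>.\<close>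
        define P where "P = (\<Sum>i<\<phi>. monom (ev (c i) \<eta>) i)"
        have "poly P w = 0" if w: "primitive_root_of_unity Q w" for w
        proof -
          have z: "primitive_root_of_unity n (w * \<eta>)"
            unfolding m(1) using primitive_mult[OF w \<eta> co] Q1 m0 by simp
          have wQ: "w ^ Q = 1" and \<eta>m: "\<eta> ^ m = 1" using w \<eta> by (auto simp: primitive_root_of_unity_def)
          have pow_cong: "x ^ i = x ^ j" if "x ^ r = 1" "[i = j] (mod r)" for x :: complex and i j r
          proof -
            have "x ^ i = x ^ (i mod r)" for i
              using that(1) by (metis mult_div_mod_eq power_add power_mult power_one mult_1)
            thus ?thesis using that(2) by (metis cong_def)
          qed
          have wU: "(w * \<eta>) ^ U = w" "(w * \<eta>) ^ V = \<eta>"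
            using pow_cong[OF wQ U(1)] pow_cong[OF \<eta>m U(2)] pow_cong[OF wQ V(1)] pow_cong[OF \<eta>m V(2)]
            by (simp_all add: power_mult_distrib)
          hence wUi: "(w * \<eta>) ^ (U * i) = w ^ i" for i by (simp only: power_mult)
          have "ev (F - comb c) (w * \<eta>) = 0"
            using ev_idl_eq_0[OF c[unfolded I_def]] ev_gens_primitive[OF n0 z] by blast
          hence "ev (comb c) (w * \<eta>) = 0" using "1.prems"(2)[OF z] by (simp add: ev_simps)
          thus ?thesis by (simp add: comb_def P_def ev_simps poly_sum poly_monom wU wUi
            mult.commute[of "ev _ \<eta>"])
        qed
        moreover have "P = 0"
        proof (rule ccontr)
          assume P0: "P \<noteq> 0"
          have "card {w::complex. primitive_root_of_unity Q w} \<le> card {w. poly P w = 0}"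
            using calculation P0 by (intro card_mono poly_roots_finite) auto
          also have "\<dots> \<le> degree P" using P0 by (rule card_poly_roots_bound)
          also have "\<dots> < \<phi>" using i unfolding P_def by (intro degree_sum_less) (auto intro: le_less_trans[OF degree_monom_le])
          finally show False using card_primitive_prime_power[OF q(1), of e] by (simp add: \<phi>_def Q_def)
        qed
        moreover have "Polynomial.coeff P i = ev (c i) \<eta>" using i by (simp add: P_def coeff_sum)
        ultimately show ?thesis by simp
      qed
      thus ?thesis using "1.IH" mn m0 by blast
    qed
    moreover have "G \<circ>\<^sub>p monom 1 V \<in> idl (gens n)" if "G \<in> gens m" for G
    proof -
      have "Xm1 m \<circ>\<^sub>p monom 1 V = Xm1 (V * m)"
        by (simp add: Xm1_def pcompose_diff pcompose_1 monom_pcompose_monom)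
      moreover have "Q dvd V" using V(1) by (simp add: cong_0_iff)
      hence "n dvd V * m" by (simp add: m mult_dvd_mono)
      ultimately have "Xm1 m \<circ>\<^sub>p monom 1 V \<in> idl (gens n)"
        using idl_dvd[OF XI[unfolded I_def]] Xm1_dvd by simp
      moreover have "Npoly m r \<circ>\<^sub>p monom 1 V \<in> idl (gens n)" if r: "r \<in> prime_factors m" for r
      proof -
        have "Xm1 n dvd Npoly m r \<circ>\<^sub>p monom 1 V - Npoly n r"
          unfolding m using r V(2) m0 \<open>Q dvd V\<close> by (intro Npoly_pcompose_cong) (auto simp: in_prime_factors_iff)
        from idl_dvd[OF XI[unfolded I_def] this] have 1: "Npoly m r \<circ>\<^sub>p monom 1 V - Npoly n r \<in> idl (gens n)" .
        have 2: "Npoly n r \<in> idl (gens n)"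
          using r n0 by (intro idl_incl) (auto simp: gens_def in_prime_factors_iff m)
        show ?thesis using idl_add[OF 1 2] by simp
      qed
      ultimately show ?thesis using that by (auto simp: gens_def)
    qed
    ultimately have "comb c \<in> I"
      unfolding comb_def I_def by (intro idl_sum idl_mult) (auto intro: idl_pcompose)
    from idl_add[OF c[unfolded I_def] this[unfolded I_def]] show ?thesis by simp
  qed
qed

subsection \<open>Cyclotomic integers\<close>

lemma power_mod_order: "(x::'a::monoid_mult) ^ n = 1 \<Longrightarrow> x ^ i = x ^ (i mod n)"
  by (metis mult_div_mod_eq power_add power_mult power_one mult_1)

lemma card_powers_primitive:
  assumes "primitive_root_of_unity N (w::complex)" "0 < N"
  shows "(\<lambda>s. w ^ s) ` {..<N} = {x. x ^ N = 1}" "inj_on (\<lambda>s. w ^ s) {..<N}"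
proof -
  have w0: "w \<noteq> 0" using assms by (auto simp: primitive_root_of_unity_def power_0_left)
  show inj: "inj_on (\<lambda>s. w ^ s) {..<N}"
  proof (rule linorder_inj_onI')
    fix i j assume ij: "i \<in> {..<N}" "j \<in> {..<N}" "i < j"
    show "w ^ i \<noteq> w ^ j"
    proof
      assume "w ^ i = w ^ j"
      also have "w ^ j = w ^ i * w ^ (j - i)" using ij by (simp flip: power_add)
      finally have "w ^ (j - i) = 1" using w0 by simp
      hence "N dvd j - i" using primitive_power_eq_1_iff[OF assms] by simp
      thus False using ij by (auto dest: dvd_imp_le)
    qed
  qed
  have "(\<lambda>s. w ^ s) ` {..<N} \<subseteq> {x. x ^ N = 1}"
    using assms by (auto simp: primitive_root_of_unity_def) (metis mult.commute power_mult power_one)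
  thus "(\<lambda>s. w ^ s) ` {..<N} = {x. x ^ N = 1}"
    using inj assms(2) by (intro card_subset_eq) (auto simp: card_image card_roots_unity_eq finite_roots_unity)
qed

lemma root_of_unity_power_of_primitive:
  assumes "primitive_root_of_unity N (w::complex)" "0 < N" "x ^ N = 1"
  shows "\<exists>s<N. x = w ^ s"
  using card_powers_primitive(1)[OF assms(1,2)] assms(3) by blast

lemma monic_eq_prod_roots:
  fixes P :: "'a::idom poly"
  assumes "finite A" "\<And>a. a \<in> A \<Longrightarrow> poly P a = 0" "card A = degree P" "lead_coeff P = 1"
  shows "P = (\<Prod>a\<in>A. [:-a, 1:])"
  using assms
proof (induction A arbitrary: P rule: finite_induct)
  case empty
  then obtain c where "P = [:c:]" by (metis card.empty degree_eq_zeroE)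
  thus ?case using empty by (simp add: one_pCons)
next
  case (insert a A)
  have "[:-a, 1:] dvd P" using insert.prems(1)[of a] by (simp add: poly_eq_0_iff_dvd)
  then obtain Q where Q: "P = [:-a, 1:] * Q" by (auto elim: dvdE)
  have "Q \<noteq> 0" using Q insert.prems by auto
  hence "degree P = Suc (degree Q)" unfolding Q by (subst degree_mult_eq) auto
  moreover have "lead_coeff Q = 1" using insert.prems(3) unfolding Q lead_coeff_mult by simp
  moreover have "poly Q b = 0" if "b \<in> A" for b
    using insert.prems(1)[of b] insert.hyps that by (auto simp: Q)
  ultimately have "Q = (\<Prod>a\<in>A. [:-a, 1:])" using insert by (intro insert.IH) auto
  thus ?case using insert.hyps by (simp add: Q)
qed

lemma prod_one_minus_roots:
  assumes "0 < l" "c \<noteq> 0"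
  shows "(\<Prod>\<eta>\<in>{\<eta>::complex. \<eta> ^ l = c}. 1 - \<eta>) = 1 - c"
proof -
  define P where "P = monom 1 l + [:-c:]"
  have deg: "degree P = l" unfolding P_def
    using assms by (subst degree_add_eq_left) (auto simp: degree_monom_eq)
  have "P = (\<Prod>\<eta>\<in>{\<eta>. \<eta> ^ l = c}. [:-\<eta>, 1:])"
    using assms card_nth_roots[of c l] deg
    by (intro monic_eq_prod_roots finite_nth_roots) (auto simp: P_def poly_monom coeff_pCons split: nat.split)
  from arg_cong[OF this, of "\<lambda>P. poly P 1"] show ?thesis
    by (simp add: P_def poly_monom poly_prod)
qed

text \<open>The polynomial 1 + X + ... + X^(l-1) has exactly these roots and takes the value l at
  1.\<close>

lemma prod_one_minus_nontrivial_roots: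
  assumes "0 < l" shows "(\<Prod>\<eta>\<in>{\<eta>::complex. \<eta> ^ l = 1} - {1}. 1 - \<eta>) = of_nat l"
proof -
  define P where "P = (\<Sum>i<l. monom (1::complex) i)"
  have coeff: "Polynomial.coeff P i = (if i < l then 1 else 0)" for i by (simp add: P_def coeff_sum)
  have deg: "degree P = l - 1"
    using assms by (intro antisym degree_le le_degree) (auto simp: coeff)
  have root: "poly P \<eta> = 0" if "\<eta> ^ l = 1" "\<eta> \<noteq> 1" for \<eta>
    using that by (simp add: P_def poly_sum poly_monom geometric_sum)
  have "P = (\<Prod>\<eta>\<in>{\<eta>. \<eta> ^ l = 1} - {1}. [:-\<eta>, 1:])"
    using assms root finite_roots_unity[of l, where 'a = complex]
    by (intro monic_eq_prod_roots) (auto simp: deg coeff card_Diff_subset card_roots_unity_eq)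
  from arg_cong[OF this, of "\<lambda>P. poly P 1"] show ?thesis
    by (simp add: P_def poly_sum poly_monom poly_prod)
qed

text \<open>Divisibility in the ring \<int>[z], kept as a relation on complex numbers.\<close>

definition dvz :: "complex \<Rightarrow> complex \<Rightarrow> complex \<Rightarrow> bool" where
  "dvz z a b \<longleftrightarrow> (\<exists>Q. b = a * ev Q z)"

lemma dvz_mult: "dvz z a b \<Longrightarrow> dvz z a (b * ev Q z)"
  unfolding dvz_def by (metis ev_mult mult.assoc)

lemma dvz_add: "dvz z a b \<Longrightarrow> dvz z a c \<Longrightarrow> dvz z a (b + c)"
  unfolding dvz_def by (metis ev_add distrib_left)

lemma dvz_uminus: "dvz z a b \<Longrightarrow> dvz z a (- b)"
  unfolding dvz_def by (metis ev_uminus mult_minus_right)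

lemma dvz_diff: "dvz z a b \<Longrightarrow> dvz z a c \<Longrightarrow> dvz z a (b - c)"
  using dvz_add[of z a b "- c"] by (simp add: dvz_uminus)

lemma dvz_trans: "dvz z a b \<Longrightarrow> dvz z b c \<Longrightarrow> dvz z a c"
  unfolding dvz_def by (metis ev_mult mult.assoc)

lemma dvz_refl: "dvz z a a"
  unfolding dvz_def by (metis ev_1 mult_1_right)

lemma dvz_ev_diff: "dvz z (ev A z - ev B z) (ev F (ev A z) - ev F (ev B z))"
  unfolding dvz_def by (rule dvd_ev_diff)

lemma dvz_power_diff:
  assumes "dvz z a (ev A z - ev B z)" shows "dvz z a (ev A z ^ i - ev B z ^ i)"
  using dvz_trans[OF assms dvz_ev_diff[of z A B "monom 1 i"]] by (simp add: ev_simps)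

lemma frobenius_iterated:
  assumes "Factorial_Ring.prime (l::nat)"
  shows "dvz z (of_nat l) (ev F z ^ (l ^ N) - ev F (z ^ (l ^ N)))"
proof (induction N)
  case 0
  show ?case by (auto simp: dvz_def intro: exI[of _ 0])
next
  case (Suc N)
  have "dvz z (of_nat l) (ev (F ^ (l ^ N)) z - ev (F \<circ>\<^sub>p monom 1 (l ^ N)) z)"
    using Suc by (simp add: ev_simps)
  from dvz_power_diff[OF this, of l]
  have "dvz z (of_nat l) (ev F z ^ (l ^ Suc N) - ev F (z ^ (l ^ N)) ^ l)"
    by (simp add: ev_simps mult.commute flip: power_mult)
  moreover have "dvz z (of_nat l) (ev F (z ^ (l ^ N)) ^ l - ev F (z ^ (l ^ Suc N)))"
  proof -
    obtain G where "ev F (z ^ (l ^ N)) ^ l - ev F ((z ^ (l ^ N)) ^ l) = of_nat l * ev G (z ^ (l ^ N))"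
      using frobenius_ev[OF assms] by blast
    hence "ev F (z ^ (l ^ N)) ^ l - ev F (z ^ (l ^ Suc N)) = of_nat l * ev (G \<circ>\<^sub>p monom 1 (l ^ N)) z"
      by (simp add: ev_simps mult.commute flip: power_mult)
    thus ?thesis unfolding dvz_def by blast
  qed
  ultimately show ?case using dvz_add by fastforce
qed

text \<open>A modulus \<open>\<mu>\<close> over the prime \<open>l\<close> such that a power of the Frobenius map is the identity
  modulo \<open>\<mu>\<close> is radical, since then \<open>x \<equiv> x\<^bsup>l\<^sup>N\<^esup>\<close> for all \<open>x\<close>.\<close>

definition radical_mod :: "complex \<Rightarrow> complex \<Rightarrow> bool" where
  "radical_mod z \<mu> \<longleftrightarrow> \<mu> \<noteq> 0 \<and> \<mu> \<in> range (\<lambda>F. ev F z) \<and> (\<forall>F d. dvz z \<mu> (ev F z ^ d) \<longrightarrow> dvz z \<mu> (ev F z))"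

lemma radicalI:
  assumes l: "Factorial_Ring.prime (l::nat)" and N: "0 < N"
    and lam: "\<mu> \<noteq> 0" "\<mu> \<in> range (\<lambda>F. ev F z)" "dvz z \<mu> (of_nat l)" "dvz z \<mu> (z ^ (l ^ N) - z)"
  shows "radical_mod z \<mu>"
  unfolding radical_mod_def
proof (intro conjI allI impI lam)
  fix F d assume d: "dvz z \<mu> (ev F z ^ d)"
  have "dvz z \<mu> (ev F (ev (monom 1 (l ^ N)) z) - ev F (ev (monom 1 1) z))"
    by (rule dvz_trans[OF _ dvz_ev_diff]) (use lam in \<open>simp add: ev_simps\<close>)
  hence "dvz z \<mu> (ev F (z ^ (l ^ N)) - ev F z)" by (simp add: ev_simps)
  from dvz_add[OF dvz_trans[OF lam(3) frobenius_iterated[OF l, of z F N]] this]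
  have 1: "dvz z \<mu> (ev F z ^ (l ^ N) - ev F z)" by simp
  have 2: "dvz z \<mu> (ev F z ^ ((l ^ N) ^ j) - ev F z)" for j
  proof (induction j)
    case 0
    show ?case by (auto simp: dvz_def intro: exI[of _ 0])
  next
    case (Suc j)
    have "dvz z \<mu> (ev (F ^ ((l ^ N) ^ j)) z - ev F z)" using Suc by (simp add: ev_simps)
    from dvz_power_diff[OF this, of "l ^ N"]
    have "dvz z \<mu> (ev F z ^ ((l ^ N) ^ Suc j) - ev F z ^ (l ^ N))"
      by (simp add: ev_simps mult.commute flip: power_mult)
    from dvz_add[OF this 1] show ?case by simp
  qed
  \<comment> \<open>An iterate of the l^N-th power has exponent at least d; it is then divisible by
    \<mu> and still congruent to \<open>ev F z\<close>.\<close>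
  have "1 < l ^ N" using one_less_power[OF prime_gt_1_nat[OF l] N] .
  hence "d \<le> (l ^ N) ^ d" using power_gt_expt[of "l ^ N" d] by simp
  then obtain r where "(l ^ N) ^ d = d + r" by (metis le_Suc_ex)
  hence "ev F z ^ ((l ^ N) ^ d) = ev F z ^ d * ev (F ^ r) z" by (simp add: ev_simps power_add)
  hence "dvz z \<mu> (ev F z ^ ((l ^ N) ^ d))" using dvz_mult[OF d] by simp
  from dvz_diff[OF this 2[of d]] show "dvz z \<mu> (ev F z)" by simp
qed

text \<open>If \<open>x / (\<mu>\<^sub>1 \<cdots> \<mu>\<^sub>r)\<close> is integral, then the \<open>\<mu>\<^sub>i\<close> can be cancelled one at a time.\<close>

lemma integral_descent:
  assumes "\<And>\<mu>. \<mu> \<in> set ls \<Longrightarrow> radical_mod z \<mu>"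
    and "ev F z ^ d + (\<Sum>i<d. of_int (c i) * prod_list ls ^ (d - i) * ev F z ^ i) = 0"
  shows "dvz z (prod_list ls) (ev F z)"
  using assms
proof (induction ls arbitrary: F)
  case (Cons \<mu> ls)
  define D where "D = prod_list ls"
  have "D \<in> range (\<lambda>F. ev F z)"
    unfolding D_def using Cons.prems(1)
  proof (induction ls)
    case Nil
    show ?case using ev_1[of z] by (metis rangeI prod_list.Nil)
  next
    case (Cons x ls)
    hence "x \<in> range (\<lambda>F. ev F z)" "prod_list ls \<in> range (\<lambda>F. ev F z)"
      by (auto simp: radical_mod_def)
    then obtain A B where "x = ev A z" "prod_list ls = ev B z" by blast
    thus ?case by (auto simp flip: ev_mult)
  qed
  then obtain Q where Q: "D = ev Q z" by blast
  have lam: "radical_mod z \<mu>" using Cons.prems by simp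
  \<comment> \<open>All terms except the leading one are multiples of \<mu>, so \<mu> divides
    \<open>ev F z\<close> by radicality, and the quotient satisfies the same equation for the
    remaining product D.\<close>
  have "dvz z \<mu> (\<Sum>i<d. of_int (c i) * (\<mu> * D) ^ (d - i) * ev F z ^ i)"
  proof -
    have "\<mu> \<in> range (\<lambda>F. ev F z)" using lam by (simp add: radical_mod_def)
    then obtain A where A: "\<mu> = ev A z" by blast
    have "(\<Sum>i<d. of_int (c i) * (\<mu> * D) ^ (d - i) * ev F z ^ i) =
       \<mu> * (\<Sum>i<d. of_int (c i) * (\<mu> ^ (d - i - 1) * D ^ (d - i)) * ev F z ^ i)"
      unfolding sum_distrib_left
    proof (rule sum.cong)
      fix i assume "i \<in> {..<d}"
      hence "\<mu> ^ (d - i) = \<mu> * \<mu> ^ (d - i - 1)"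
        by (simp flip: power_Suc add: Suc_diff_Suc)
      thus "of_int (c i) * (\<mu> * D) ^ (d - i) * ev F z ^ i =
         \<mu> * (of_int (c i) * (\<mu> ^ (d - i - 1) * D ^ (d - i)) * ev F z ^ i)"
        by (simp add: power_mult_distrib)
    qed auto
    also have "\<dots> = \<mu> * ev (\<Sum>i<d. of_int (c i) * (A ^ (d - i - 1) * Q ^ (d - i)) * F ^ i) z"
      by (simp add: ev_simps A Q)
    finally show ?thesis unfolding dvz_def by blast
  qed
  moreover have "ev F z ^ d = - (\<Sum>i<d. of_int (c i) * (\<mu> * D) ^ (d - i) * ev F z ^ i)"
    using Cons.prems(2) by (simp add: D_def eq_neg_iff_add_eq_0)
  ultimately have "dvz z \<mu> (ev F z ^ d)" using dvz_uminus by simp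
  hence "dvz z \<mu> (ev F z)" using lam by (auto simp: radical_mod_def)
  then obtain G where G: "ev F z = \<mu> * ev G z" by (auto simp: dvz_def)
  have "\<mu> ^ d * (ev G z ^ d + (\<Sum>i<d. of_int (c i) * D ^ (d - i) * ev G z ^ i)) =
     ev F z ^ d + (\<Sum>i<d. of_int (c i) * (\<mu> * D) ^ (d - i) * ev F z ^ i)"
  proof -
    have "\<mu> ^ d * (of_int (c i) * D ^ (d - i) * ev G z ^ i) = of_int (c i) * (\<mu> * D) ^ (d - i) * ev F z ^ i"
      if "i < d" for i
    proof -
      have "\<mu> ^ d = \<mu> ^ (d - i) * \<mu> ^ i" using that by (simp flip: power_add)
      thus ?thesis by (simp add: G power_mult_distrib)
    qed
    hence "(\<Sum>i<d. \<mu> ^ d * (of_int (c i) * D ^ (d - i) * ev G z ^ i)) =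
        (\<Sum>i<d. of_int (c i) * (\<mu> * D) ^ (d - i) * ev F z ^ i)"
      by (intro sum.cong) auto
    thus ?thesis by (simp only: distrib_left sum_distrib_left) (simp add: G power_mult_distrib)
  qed
  also have "\<dots> = 0" using Cons.prems(2) by (simp add: D_def)
  finally have "ev G z ^ d + (\<Sum>i<d. of_int (c i) * D ^ (d - i) * ev G z ^ i) = 0"
    using lam by (simp add: radical_mod_def)
  hence "dvz z D (ev G z)" unfolding D_def using Cons by simp
  thus ?case unfolding dvz_def G D_def by (auto simp: mult.assoc)
qed (auto simp: dvz_def)

definition radical_prod :: "complex \<Rightarrow> complex \<Rightarrow> bool" where
  "radical_prod z x \<longleftrightarrow> (\<exists>ls. (\<forall>\<mu>\<in>set ls. radical_mod z \<mu>) \<and> x = prod_list ls)"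

lemma radical_prod_1: "radical_prod z 1"
  unfolding radical_prod_def by (intro exI[of _ "[]"]) auto

lemma radical_prod_mult: "radical_prod z x \<Longrightarrow> radical_prod z y \<Longrightarrow> radical_prod z (x * y)"
  unfolding radical_prod_def by (metis Un_iff prod_list.append set_append)

lemma radical_prod_prod: "(\<And>i. i \<in> I \<Longrightarrow> radical_prod z (f i)) \<Longrightarrow> radical_prod z (\<Prod>i\<in>I. f i)"
  by (induction I rule: infinite_finite_induct) (auto intro: radical_prod_1 radical_prod_mult)

lemma radical_imp_radical_prod: "radical_mod z x \<Longrightarrow> radical_prod z x"
  unfolding radical_prod_def by (intro exI[of _ "[x]"]) auto

text \<open>If l does not divide n, a power of Frobenius fixes z, so l itself is radical. If l
  divides n, then l is the product of the 1 - \<eta> over the nontrivial l-th roots of unity, and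
  each 1 - w is in turn the product of the 1 - \<eta> with \<eta>^l = w. This stops at roots whose
  order is the full power of l in n, where 1 - w is radical.\<close>

lemma radical_prod_prime:
  assumes z: "primitive_root_of_unity n z" and n: "0 < n" and l: "Factorial_Ring.prime (l::nat)"
  shows "radical_prod z (of_nat l)"
proof (cases "l dvd n")
  case False
  have l0: "l \<noteq> 0" using l by auto
  have "coprime l n" using l False by (simp add: prime_imp_coprime)
  hence "[l ^ totient n = 1] (mod n)" by (rule euler_theorem)
  moreover have "z ^ n = 1" using z by (simp add: primitive_root_of_unity_def)
  ultimately have "z ^ (l ^ totient n) = z ^ 1"
    using power_mod_order[of z n "l ^ totient n"] power_mod_order[of z n 1] by (simp add: cong_def)
  moreover have "of_nat l \<in> range (\<lambda>F. ev F z)" using ev_of_nat[of l z] by (metis rangeI)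
  moreover have "dvz z (of_nat l) 0" unfolding dvz_def by (intro exI[of _ 0]) simp
  ultimately have "radical_mod z (of_nat l)"
    using l0 n by (intro radicalI[OF l, of "totient n"]) (auto simp: dvz_refl)
  thus ?thesis by (rule radical_imp_radical_prod)
next
  case True
  define e' where "e' = multiplicity l n"
  have "e' \<noteq> 0" using prime_multiplicity_gt_zero_iff[of l n] True n l by (auto simp: e'_def)
  then obtain e where e: "e' = Suc e" by (cases e') auto
  obtain m where m: "n = l ^ Suc e * m" "\<not> l dvd m"
    using multiplicity_decompose'[of n l] n prime_gt_1_nat[OF l]
    by (metis e e'_def not_less_zero not_prime_unit l)
  have m0: "0 < m" using m n by (cases m) auto
  have l0: "0 < l" using l by (rule prime_gt_0_nat)
  have root_ev: "\<exists>k. x = z ^ k" if "x ^ n = 1" for x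
    using root_of_unity_power_of_primitive[OF z n that] by blast
  have unit_pow: "x ^ n = 1" if "x ^ (l ^ a) = 1" "a \<le> Suc e" for x :: complex and a
  proof -
    have "l ^ a dvd n" using that(2) unfolding m(1) by (intro dvd_mult2 le_imp_power_dvd)
    thus ?thesis using that(1) by (auto elim!: dvdE simp: power_mult)
  qed
  have dvz_pow: "dvz z (1 - w) (1 - w ^ s)" if "w ^ n = 1" for w s
  proof -
    obtain k where "w = z ^ k" using root_ev[OF \<open>w ^ n = 1\<close>] by blast
    thus ?thesis using dvz_power_diff[of z "1 - w" 1 "monom 1 k" s] by (simp add: ev_simps dvz_refl)
  qed
  have good: "radical_mod z (1 - w)" if w: "primitive_root_of_unity (l ^ Suc e) w" for w
  proof (rule radicalI[OF l])
    have wl: "w ^ (l ^ Suc e) = 1" using w by (simp add: primitive_root_of_unity_def)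
    have wn: "w ^ n = 1" using unit_pow[OF wl] by simp
    have "w ^ (l ^ e) \<noteq> 1" using w primitive_prime_power_iff[OF l] by blast
    hence "w \<noteq> 1" by auto
    thus "1 - w \<noteq> 0" by simp
    obtain k where k: "w = z ^ k" using root_ev[OF wn] by blast
    have "1 - w = ev (1 - monom 1 k) z" by (simp add: ev_simps k)
    thus "1 - w \<in> range (\<lambda>F. ev F z)" by blast
    show "0 < totient m" using m0 by simp
    \<comment> \<open>m divides the exponent, so x has order a power of l and is a power of w. Hence
      x is 1 modulo 1 - w, and a power of Frobenius fixes z modulo 1 - w.\<close>
    define x where "x = z ^ (l ^ totient m - 1)"
    have "coprime l m" using l m by (simp add: prime_imp_coprime)
    hence "[l ^ totient m = 1] (mod m)" by (rule euler_theorem)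
    hence "m dvd l ^ totient m - 1" by (rule cong_to_1_nat)
    then obtain r where r: "l ^ totient m - 1 = m * r" by (auto elim: dvdE)
    have "x ^ (l ^ Suc e) = (z ^ n) ^ r"
      unfolding x_def r m(1) by (simp add: mult_ac flip: power_mult)
    hence "x ^ (l ^ Suc e) = 1" using z by (simp add: primitive_root_of_unity_def)
    then obtain s where s: "x = w ^ s"
      using root_of_unity_power_of_primitive[OF w] l0 by auto
    have "z ^ (l ^ totient m) = x * z" unfolding x_def using l0 by (simp flip: power_Suc2)
    hence "z ^ (l ^ totient m) - z = - ((1 - w ^ s) * ev (monom 1 1) z)"
      by (simp add: s ev_simps algebra_simps)
    thus "dvz z (1 - w) (z ^ (l ^ totient m) - z)" using dvz_uminus dvz_mult[OF dvz_pow[OF wn]] by simp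
    \<comment> \<open>\<open>w ^ (l ^ e)\<close> is a nontrivial l-th root of unity; 1 minus it is a
      factor of l and a multiple of 1 - w.\<close>
    have "of_nat l = (1 - w ^ (l ^ e)) * (\<Prod>\<eta>\<in>{\<eta>::complex. \<eta> ^ l = 1} - {1} - {w ^ (l ^ e)}. 1 - \<eta>)"
      unfolding prod_one_minus_nontrivial_roots[OF l0, symmetric]
    proof (rule prod.remove)
      have "(w ^ (l ^ e)) ^ l = 1" using wl by (simp add: mult.commute flip: power_mult)
      thus "w ^ (l ^ e) \<in> {\<eta>. \<eta> ^ l = 1} - {1}" using \<open>w ^ (l ^ e) \<noteq> 1\<close> by simp
    qed (use l0 in \<open>auto intro: finite_roots_unity\<close>)
    moreover have rng: "(\<Prod>\<eta>\<in>A. 1 - \<eta>) \<in> range (\<lambda>F. ev F z)" if "A \<subseteq> {\<eta>. \<eta> ^ l = 1}" for A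
    proof -
      have "\<forall>\<eta>\<in>A. \<exists>k. \<eta> = z ^ k" using that root_ev unit_pow[of _ 1] by auto
      from bchoice[OF this] obtain g where "\<forall>\<eta>\<in>A. \<eta> = z ^ g \<eta>" ..
      hence "(\<Prod>\<eta>\<in>A. 1 - \<eta>) = ev (\<Prod>\<eta>\<in>A. 1 - monom 1 (g \<eta>)) z"
        unfolding ev_prod by (intro prod.cong) (auto simp: ev_simps)
      thus ?thesis by blast
    qed
    obtain Q where "(\<Prod>\<eta>\<in>{\<eta>::complex. \<eta> ^ l = 1} - {1} - {w ^ (l ^ e)}. 1 - \<eta>) = ev Q z"
      using rng[of "{\<eta>. \<eta> ^ l = 1} - {1} - {w ^ (l ^ e)}"] by (auto simp del: One_nat_def)
    ultimately have "of_nat l = (1 - w ^ (l ^ e)) * ev Q z" by simp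
    hence "dvz z (1 - w ^ (l ^ e)) (of_nat l)" unfolding dvz_def by blast
    thus "dvz z (1 - w) (of_nat l)" using dvz_trans[OF dvz_pow[OF wn]] by blast
  qed
  have "radical_prod z (1 - w)" if "a \<le> e" "primitive_root_of_unity (l ^ Suc a) w" for a w
    using that
  proof (induction a arbitrary: w rule: inc_induct)
    case base
    thus ?case by (intro radical_imp_radical_prod good)
  next
    case (step a)
    have w: "w ^ (l ^ Suc a) = 1" "w ^ (l ^ a) \<noteq> 1"
      using step.prems primitive_prime_power_iff[OF l] by auto
    have "radical_prod z (1 - \<eta>)" if "\<eta> ^ l = w" for \<eta>
    proof (rule step.IH)
      have "\<eta> ^ (l ^ Suc b) = w ^ (l ^ b)" for b by (simp add: power_mult that)
      thus "primitive_root_of_unity (l ^ Suc (Suc a)) \<eta>"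
        using w by (simp only: primitive_prime_power_iff[OF l]) simp
    qed
    moreover have "w \<noteq> 0" using w l0 by (auto simp: power_0_left)
    ultimately show ?case
      using radical_prod_prod[of "{\<eta>. \<eta> ^ l = w}" z "\<lambda>\<eta>. 1 - \<eta>"] prod_one_minus_roots[OF l0, of w] by simp
  qed
  from this[of 0] have "radical_prod z (1 - \<eta>)" if "\<eta> ^ l = 1" "\<eta> \<noteq> 1" for \<eta>
    using that primitive_prime_power_iff[OF l, of 0 \<eta>] by simp
  hence "radical_prod z (\<Prod>\<eta>\<in>{\<eta>::complex. \<eta> ^ l = 1} - {1}. 1 - \<eta>)" by (intro radical_prod_prod) auto
  thus ?thesis by (simp add: prod_one_minus_nontrivial_roots[OF l0])
qed

lemma radical_prod_nat:
  assumes z: "primitive_root_of_unity n z" and n: "0 < n"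
  shows "0 < D \<Longrightarrow> radical_prod z (of_nat D)"
proof (induction D rule: nat_less_induct)
  case (1 D)
  show ?case
  proof (cases "D = 1")
    case False
    then obtain l where l: "Factorial_Ring.prime l" "l dvd D" using prime_factor_nat by blast
    then obtain i where i: "D = l * i" by (auto elim: dvdE)
    hence "i < D" "0 < i" using 1 prime_gt_1_nat[OF l(1)] by auto
    thus ?thesis using 1 radical_prod_prime[OF z n l(1)] by (simp add: i radical_prod_mult)
  qed (simp add: radical_prod_1)
qed

text \<open>Euclidean descent: pseudo-division of the minimal f by B leaves a remainder of smaller
  degree whose value at z is a multiple of B(z), and minimality of f keeps this value from being
  zero. A constant is reached in the end.\<close>

lemma ev_inverse:
  assumes z: "z ^ n = 1" "0 < n" and B: "ev B (z::complex) \<noteq> 0"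
  shows "\<exists>C r. r \<noteq> 0 \<and> ev B z * ev C z = of_int r"
proof -
  have X: "ev (Xm1 n) z = 0" using z by (simp add: Xm1_def ev_simps)
  have "Xm1 n \<noteq> 0" using Xm1_monic[OF z(2)] by auto
  then obtain f where f: "minimal_ipoly f z" using minimal_ipoly_exists[OF _ X] by blast
  have f0: "f \<noteq> 0" "ev f z = 0" using f by (auto simp: minimal_ipoly_def)
  have small: "\<exists>C r. r \<noteq> 0 \<and> ev B z * ev C z = of_int r" if "degree B < degree f" "ev B z \<noteq> 0" for B
    using that
  proof (induction "degree B" arbitrary: B rule: less_induct)
    case less
    have B0: "B \<noteq> 0" using less.prems by auto
    show ?case
    proof (cases "degree B = 0")
      case True
      then obtain b where "B = [:b:]" by (rule degree_eq_zeroE)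
      thus ?thesis using less.prems(2) by (intro exI[of _ 1] exI[of _ b]) (auto simp: ev_pCons)
    next
      case False
      obtain q r where qr: "pseudo_divmod f B = (q, r)" by force
      define c where "c = Polynomial.coeff B (degree B) ^ (Suc (degree f) - degree B)"
      have *: "smult c f = B * q + r" "r = 0 \<or> degree r < degree B"
        using pseudo_divmod[OF B0 qr] by (auto simp: c_def)
      have c0: "c \<noteq> 0" using B0 by (simp add: c_def)
      have r: "ev r z = - (ev B z * ev q z)"
        using arg_cong[OF *(1), of "\<lambda>H. ev H z"] f0 by (simp add: ev_simps eq_neg_iff_add_eq_0 add.commute)
      have "ev r z \<noteq> 0"
      proof
        assume "ev r z = 0"
        hence "r = 0" using *(2) less.prems f by (auto simp: minimal_ipoly_def)
        hence eq: "smult c f = B * q" using *(1) by simp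
        have "q \<noteq> 0" using eq f0 c0 by auto
        hence "degree f = degree B + degree q" using eq B0 c0 by (metis degree_mult_eq degree_smult_eq)
        hence "degree q < degree f" using False by simp
        moreover have "ev q z = 0" using r \<open>ev r z = 0\<close> less.prems by simp
        ultimately show False using f \<open>q \<noteq> 0\<close> by (auto simp: minimal_ipoly_def)
      qed
      moreover have "degree r < degree B" using *(2) False by auto
      ultimately obtain C s where "s \<noteq> 0" "ev r z * ev C z = of_int s"
        using less.hyps[of r] less.prems by auto
      hence "ev B z * ev (- (q * C)) z = of_int s" by (simp add: r ev_simps mult.assoc)
      thus ?thesis using \<open>s \<noteq> 0\<close> by blast
    qed
  qed
  obtain q r where qr: "pseudo_divmod B f = (q, r)" by force
  define c where "c = Polynomial.coeff f (degree f) ^ (Suc (degree B) - degree f)"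
  have *: "smult c B = f * q + r" "r = 0 \<or> degree r < degree f"
    using pseudo_divmod[OF f0(1) qr] by (auto simp: c_def)
  have c0: "c \<noteq> 0" using f0 by (simp add: c_def)
  have r: "ev r z = of_int c * ev B z"
    using arg_cong[OF *(1), of "\<lambda>H. ev H z"] f0 by (simp add: ev_simps)
  hence "ev r z \<noteq> 0" using c0 B by simp
  hence "degree r < degree f" using *(2) by auto
  from small[OF this \<open>ev r z \<noteq> 0\<close>] obtain C s where "s \<noteq> 0" "ev r z * ev C z = of_int s" by blast
  hence "ev B z * ev (smult c C) z = of_int s" by (simp add: r ev_simps mult_ac)
  thus ?thesis using \<open>s \<noteq> 0\<close> by blast
qed

lemma cyclotomic_field_elem:
  assumes z: "z ^ n = 1" "0 < n" and x: "x \<in> gf {z::complex}"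
  shows "\<exists>D G. 0 < D \<and> of_nat D * x = ev G z"
proof -
  define R where "R = range (\<lambda>F. ev F z)"
  have "\<exists>a b. a \<in> R \<and> b \<in> R \<and> b \<noteq> 0 \<and> x = a / b"
  proof (rule gf_fraction[OF _ _ _ _ _ x])
    show "1 \<in> R" unfolding R_def using ev_1[of z] by (metis rangeI)
    show "{z} \<subseteq> R" unfolding R_def using ev_monom[of 1 1 z] by (auto simp: image_iff intro!: exI[of _ "monom 1 1"])
  qed (auto simp: R_def simp flip: ev_uminus ev_add ev_mult)
  then obtain A B where AB: "ev B z \<noteq> 0" "x = ev A z / ev B z" by (auto simp: R_def)
  then obtain C r where r: "r \<noteq> 0" "ev B z * ev C z = of_int r" using ev_inverse[OF z] by blast
  have "of_int r * x = ev (A * C) z"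
    using AB by (simp add: ev_simps flip: r(2))
  moreover have "of_nat (nat \<bar>r\<bar>) = of_int (sgn r) * (of_int r :: complex)"
    by (metis abs_ge_zero abs_sgn mult.commute of_int_mult of_int_of_nat_eq nat_0_le)
  ultimately have "of_nat (nat \<bar>r\<bar>) * x = ev (smult (sgn r) (A * C)) z"
    by (simp add: ev_simps mult.assoc)
  thus ?thesis using r by (intro exI[of _ "nat \<bar>r\<bar>"]) auto
qed

lemma cis_primitive: assumes "0 < n" shows "primitive_root_of_unity n (cis (2 * pi / real n))"
proof -
  have "inj_on (\<lambda>k. cis (2 * pi * real k / real n)) {..<n}"
    using bij_betw_roots_unity[OF assms] by (simp add: bij_betw_def)
  moreover have "cis (2 * pi / real n) ^ k = cis (2 * pi * real k / real n)" for k
    by (simp add: DeMoivre mult.commute)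
  ultimately have "cis (2 * pi / real n) ^ j \<noteq> 1" if "0 < j" "j < n" for j
    using inj_onD[of _ "{..<n}" j 0] that by fastforce
  moreover have "cis (2 * pi / real n) ^ n = 1" using assms by (simp add: DeMoivre)
  ultimately show ?thesis by (simp add: primitive_root_of_unity_def)
qed

text \<open>Write x as G(z)/D with a positive integer D. As D is a product of radical elements,
  \<open>integral_descent\<close> cancels it from G(z); this takes the place of a discriminant
  computation.\<close>

lemma cyclotomic_integers_eq:
  assumes n: "0 < n" and x: "x \<in> cyclotomic_integers n"
  shows "\<exists>F. x = ev F (cis (2 * pi / real n))"
proof -
  define z where "z = cis (2 * pi / real n)"
  have z: "primitive_root_of_unity n z" unfolding z_def by (rule cis_primitive[OF n])
  have zn: "z ^ n = 1" using z by (simp add: primitive_root_of_unity_def)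
  have "x \<in> gf {z}" "algebraic_int x"
    using x by (auto simp: cyclotomic_integers_def cyclotomic_field_def z_def)
  then obtain D G where DG: "0 < D" "of_nat D * x = ev G z" using cyclotomic_field_elem[OF zn n] by blast
  obtain P :: "int poly" where P: "poly (map_poly of_int P) x = 0" "lead_coeff P = 1"
    using \<open>algebraic_int x\<close> algebraic_int_altdef_ipoly by blast
  define d where "d = degree P"
  have "(\<Sum>i\<le>d. of_int (Polynomial.coeff P i) * x ^ i) = 0"
    using P(1) by (simp add: poly_altdef coeff_map_poly degree_map_poly d_def)
  hence 1: "x ^ d + (\<Sum>i<d. of_int (Polynomial.coeff P i) * x ^ i) = 0"
    using P(2) by (simp add: d_def lessThan_Suc_atMost[symmetric] add.commute)
  obtain ls where ls: "\<And>\<mu>. \<mu> \<in> set ls \<Longrightarrow> radical_mod z \<mu>" "of_nat D = prod_list ls"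
    using radical_prod_nat[OF z n DG(1)] by (auto simp: radical_prod_def)
  have "dvz z (prod_list ls) (ev G z)"
  proof (rule integral_descent[OF ls(1)])
    have "of_int c * of_nat D ^ (d - i) * ev G z ^ i = of_nat D ^ d * (of_int c * x ^ i)" if "i < d" for i c
    proof -
      have "(of_nat D :: complex) ^ d = of_nat D ^ (d - i) * of_nat D ^ i" using that by (simp flip: power_add)
      thus ?thesis by (simp add: DG(2)[symmetric] power_mult_distrib)
    qed
    hence "(\<Sum>i<d. of_int (Polynomial.coeff P i) * of_nat D ^ (d - i) * ev G z ^ i) =
        (\<Sum>i<d. of_nat D ^ d * (of_int (Polynomial.coeff P i) * x ^ i))"
      by (intro sum.cong) auto
    hence "ev G z ^ d + (\<Sum>i<d. of_int (Polynomial.coeff P i) * of_nat D ^ (d - i) * ev G z ^ i) =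
        of_nat D ^ d * (x ^ d + (\<Sum>i<d. of_int (Polynomial.coeff P i) * x ^ i))"
      by (simp add: distrib_left sum_distrib_left power_mult_distrib flip: DG(2))
    thus "ev G z ^ d + (\<Sum>i<d. of_int (Polynomial.coeff P i) * prod_list ls ^ (d - i) * ev G z ^ i) = 0"
      by (simp add: 1 flip: ls(2))
  qed auto
  then obtain Q where "ev G z = of_nat D * ev Q z" by (auto simp: dvz_def simp flip: ls(2))
  hence "of_nat D * x = of_nat D * ev Q z" using DG by simp
  thus ?thesis using DG(1) unfolding z_def by auto
qed

subsection \<open>The prime above \<open>p\<close>\<close>

lemma primitive_power_iff_coprime:
  assumes z: "primitive_root_of_unity n (z::'a::field)" and n: "0 < n"
  shows "primitive_root_of_unity n (z ^ j) \<longleftrightarrow> coprime j n"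
proof
  assume *: "primitive_root_of_unity n (z ^ j)"
  define g where "g = gcd j n"
  have g: "g dvd j" "g dvd n" "0 < g" using n by (auto simp: g_def)
  have "n dvd j * (n div g)" using g by (auto elim!: dvdE)
  hence "(z ^ j) ^ (n div g) = 1" using primitive_power_eq_1_iff[OF z n] by (simp flip: power_mult)
  hence "n dvd n div g" using primitive_power_eq_1_iff[OF * n] by simp
  moreover have "0 < n div g" using g n by (auto elim!: dvdE)
  ultimately have "n \<le> n div g" by (auto dest: dvd_imp_le)
  have "g = 1"
  proof (rule ccontr)
    assume "g \<noteq> 1"
    hence "1 < g" using g by simp
    hence "n div g < n" using n by simp
    thus False using \<open>n \<le> n div g\<close> by simp
  qed
  thus "coprime j n" unfolding g_def by (simp only: coprime_iff_gcd_eq_1)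
next
  assume *: "coprime j n"
  have "n dvd i" if "(z ^ j) ^ i = 1" for i
    using that * primitive_power_eq_1_iff[OF z n]
    by (simp add: coprime_dvd_mult_right_iff coprime_commute flip: power_mult)
  hence "(z ^ j) ^ i \<noteq> 1" if "0 < i" "i < n" for i using that by (metis dvd_imp_le not_less)
  moreover have "z ^ n = 1" using z by (simp add: primitive_root_of_unity_def)
  hence "(z ^ j) ^ n = 1" by (metis mult.commute power_mult power_one)
  ultimately show "primitive_root_of_unity n (z ^ j)" by (simp add: primitive_root_of_unity_def)
qed

lemma mod_eq_imp_eq_pos:
  fixes i j n :: nat
  assumes "0 < i" "i \<le> n" "0 < j" "j \<le> n" "i mod n = j mod n"
  shows "i = j"
  using assms by (cases "i = n"; cases "j = n") auto

lemma bij_betw_totatives_primitive: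
  assumes z: "primitive_root_of_unity n (z::complex)" and n: "0 < n"
  shows "bij_betw (\<lambda>j. z ^ j) (totatives n) {c::complex. primitive_root_of_unity n c}"
proof (rule bij_betw_imageI)
  have zmod: "z ^ j = z ^ (j mod n)" for j
    using z by (intro power_mod_order) (simp add: primitive_root_of_unity_def)
  show "inj_on (\<lambda>j. z ^ j) (totatives n)"
  proof (rule inj_onI)
    fix i j assume ij: "i \<in> totatives n" "j \<in> totatives n" "z ^ i = z ^ j"
    hence "z ^ (i mod n) = z ^ (j mod n)" using zmod by metis
    hence "i mod n = j mod n" using card_powers_primitive(2)[OF z n] n by (auto dest: inj_onD)
    thus "i = j" using ij by (intro mod_eq_imp_eq_pos[of i n j]) (auto simp: totatives_def)
  qed
  show "(\<lambda>j. z ^ j) ` totatives n = {c::complex. primitive_root_of_unity n c}"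
  proof (intro equalityI subsetI)
    fix c assume c: "c \<in> {c::complex. primitive_root_of_unity n c}"
    hence "c ^ n = 1" by (simp add: primitive_root_of_unity_def)
    then obtain s where s: "s < n" "c = z ^ s" using root_of_unity_power_of_primitive[OF z n] by blast
    hence co: "coprime s n" using primitive_power_iff_coprime[OF z n] c by simp
    show "c \<in> (\<lambda>j. z ^ j) ` totatives n"
    proof (cases "s = 0")
      case True
      hence "n = 1" using co by simp
      thus ?thesis using z s True by (auto simp: totatives_def primitive_root_of_unity_def)
    next
      case False
      thus ?thesis using s co by (auto simp: totatives_def)
    qed
  next
    fix c assume "c \<in> (\<lambda>j. z ^ j) ` totatives n"
    thus "c \<in> {c::complex. primitive_root_of_unity n c}"
      using primitive_power_iff_coprime[OF z n] by (auto simp: totatives_def)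
  qed
qed

section \<open>Embeddings of the cyclotomic field and the norm\<close>

context
  fixes n :: nat and z :: complex
  assumes n: "0 < n" and z: "primitive_root_of_unity n z"
begin

lemma zn: "z ^ n = 1"
  using z by (simp add: primitive_root_of_unity_def)

lemma ev_in_gf: "ev F z \<in> gf {z}"
proof (induction F)
  case (pCons c F)
  have "of_int c \<in> gf {z}" by (cases c rule: int_cases2) (auto intro: gf_of_nat gf_uminus)
  thus ?case using pCons by (auto simp: ev_pCons intro: gf_add gf_mult gf_incl)
qed auto

lemma embeddings_hom:
  assumes "\<phi> \<in> embeddings (gf {z})" "x \<in> gf {z}" "y \<in> gf {z}"
  shows "\<phi> (x + y) = \<phi> x + \<phi> y" "\<phi> (x * y) = \<phi> x * \<phi> y"
  using assms by (auto simp: embeddings_def ring_hom_def ring_of_type_algebra_def)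

lemma embeddings_1: "\<phi> \<in> embeddings (gf {z}) \<Longrightarrow> \<phi> 1 = 1"
  by (auto simp: embeddings_def ring_hom_def ring_of_type_algebra_def)

lemma embeddings_ev:
  assumes "\<phi> \<in> embeddings (gf {z})"
  shows "\<phi> (ev F z) = ev F (\<phi> z)"
proof -
  note hom = embeddings_hom[OF assms]
  have 0: "\<phi> 0 = 0" using hom(1)[of 0 0] by simp
  have nat: "\<phi> (of_nat i) = of_nat i" for i
    by (induction i) (auto simp: 0 hom embeddings_1[OF assms] gf_of_nat)
  have neg: "\<phi> (- x) = - \<phi> x" if "x \<in> gf {z}" for x
    using hom(1)[of x "- x"] that 0 by (simp add: gf_uminus eq_neg_iff_add_eq_0 add.commute)
  have int: "\<phi> (of_int i) = of_int i" for i
    by (cases i rule: int_cases2) (auto simp: nat neg gf_of_nat)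
  have int_in: "of_int i \<in> gf {z}" for i
    by (cases i rule: int_cases2) (auto intro: gf_of_nat gf_uminus)
  have zz: "z \<in> gf {z}" by (rule gf_incl) simp
  show ?thesis
    by (induction F) (auto simp: 0 ev_pCons hom int int_in gf_mult ev_in_gf zz)
qed

text \<open>An embedding is determined by the image of z. Conversely, for a primitive root c,
  sending G(z)/D to G(c)/D is well defined, because relations at z persist at c by
  \<open>galois_conj\<close>.\<close>

lemma bij_betw_embeddings:
  "bij_betw (\<lambda>\<phi>. \<phi> z) (embeddings (gf {z})) {c::complex. primitive_root_of_unity n c}"
proof (rule bij_betw_imageI)
  let ?K = "gf {z}"
  have elem: "\<exists>D G. 0 < D \<and> of_nat D * x = ev G z" if "x \<in> ?K" for x
    using cyclotomic_field_elem[OF zn n that] .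
  show "inj_on (\<lambda>\<phi>. \<phi> z) (embeddings ?K)"
  proof (rule inj_onI)
    fix \<phi> \<psi> assume *: "\<phi> \<in> embeddings ?K" "\<psi> \<in> embeddings ?K" "\<phi> z = \<psi> z"
    have "\<phi> x = \<psi> x" if x: "x \<in> ?K" for x
    proof -
      obtain D G where DG: "0 < D" "of_nat D * x = ev G z" using elem[OF x] by blast
      have "of_nat D * \<phi> x = of_nat D * \<psi> x"
        using embeddings_hom(2)[OF *(1) gf_of_nat x, of D] embeddings_hom(2)[OF *(2) gf_of_nat x, of D]
          embeddings_ev[OF *(1), of G] embeddings_ev[OF *(2), of G]
          embeddings_ev[OF *(1), of "of_nat D"] embeddings_ev[OF *(2), of "of_nat D"] *(3)
        by (simp add: DG(2) ev_simps)
      thus ?thesis using DG(1) by simp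
    qed
    thus "\<phi> = \<psi>" using * by (intro extensionalityI[of _ ?K]) (auto simp: embeddings_def)
  qed
  show "(\<lambda>\<phi>. \<phi> z) ` embeddings ?K = {c::complex. primitive_root_of_unity n c}"
  proof (intro equalityI subsetI)
    fix c assume "c \<in> (\<lambda>\<phi>. \<phi> z) ` embeddings ?K"
    then obtain \<phi> where \<phi>: "\<phi> \<in> embeddings ?K" "c = \<phi> z" by blast
    have 0: "\<phi> 0 = 0" using embeddings_ev[OF \<phi>(1), of 0] by simp
    have "c ^ n = 1" using embeddings_ev[OF \<phi>(1), of "monom 1 n"] embeddings_1[OF \<phi>(1)] zn
      by (auto simp: ev_simps \<phi>)
    moreover have "c ^ j \<noteq> 1" if j: "0 < j" "j < n" for j
    proof
      assume "c ^ j = 1"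
      have 1: "ev (monom 1 j - 1) z \<noteq> 0" using z j by (auto simp: ev_simps primitive_root_of_unity_def)
      have "inverse (ev (monom 1 j - 1) z) \<in> ?K" by (intro gf_inverse ev_in_gf)
      from embeddings_hom(2)[OF \<phi>(1) ev_in_gf this, of "monom 1 j - 1"]
      have "\<phi> 1 = \<phi> (ev (monom 1 j - 1) z) * \<phi> (inverse (ev (monom 1 j - 1) z))" using 1 by simp
      also have "\<phi> (ev (monom 1 j - 1) z) = 0"
        using \<open>c ^ j = 1\<close> by (simp only: embeddings_ev[OF \<phi>(1)]) (simp add: ev_simps \<phi>)
      finally show False using embeddings_1[OF \<phi>(1)] by (metis mult_zero_left zero_neq_one gf_one)
    qed
    ultimately show "c \<in> {c::complex. primitive_root_of_unity n c}" by (simp add: primitive_root_of_unity_def)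
  next
    fix c assume "c \<in> {c::complex. primitive_root_of_unity n c}"
    then obtain j where j: "j \<in> totatives n" "c = z ^ j"
      using bij_betw_totatives_primitive[OF z n] by (auto simp: bij_betw_def)
    have conj: "ev F c = 0" if "ev F z = 0" for F
      using galois_conj[OF n zn that] j by (auto simp: totatives_def)
    have "\<forall>x\<in>?K. \<exists>DG. 0 < fst DG \<and> of_nat (fst DG) * x = ev (snd DG) z" using elem by auto
    from bchoice[OF this] obtain DG where
      DG: "\<And>x. x \<in> ?K \<Longrightarrow> 0 < fst (DG x) \<and> of_nat (fst (DG x)) * x = ev (snd (DG x)) z" by blast
    define \<phi> where "\<phi> = restrict (\<lambda>x. ev (snd (DG x)) c / of_nat (fst (DG x))) ?K"
    have \<phi>: "\<phi> x = ev G c / of_nat D" if x: "x \<in> ?K" and D: "0 < D" "of_nat D * x = ev G z" for x D G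
    proof -
      have "ev (smult (int D) (snd (DG x)) - smult (int (fst (DG x))) G) z = 0"
        using DG[OF x] D by (simp add: ev_simps flip: D(2))
      from conj[OF this] have "of_nat D * ev (snd (DG x)) c = of_nat (fst (DG x)) * ev G c"
        by (simp add: ev_simps)
      thus ?thesis using DG[OF x] D(1) x by (simp add: \<phi>_def field_simps)
    qed
    have "\<phi> \<in> embeddings ?K"
      unfolding embeddings_def
    proof (intro IntI ring_hom_memI)
      fix x y assume "x \<in> carrier (ring_of_type_algebra\<lparr>carrier := ?K\<rparr>)" "y \<in> carrier (ring_of_type_algebra\<lparr>carrier := ?K\<rparr>)"
      hence xy: "x \<in> ?K" "y \<in> ?K" by simp_all
      obtain D G where D: "0 < D" "of_nat D * x = ev G z" using elem[OF xy(1)] by blast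
      obtain E H where E: "0 < E" "of_nat E * y = ev H z" using elem[OF xy(2)] by blast
      have "of_nat (D * E) * (x + y) = of_nat E * (of_nat D * x) + of_nat D * (of_nat E * y)"
        by (simp add: algebra_simps)
      hence "of_nat (D * E) * (x + y) = ev (of_nat E * G + of_nat D * H) z"
        by (simp add: ev_simps D E)
      from \<phi>[OF gf_add[OF xy] _ this]
      have "\<phi> (x + y) = (of_nat E * ev G c + of_nat D * ev H c) / of_nat (D * E)"
        using D E by (simp add: ev_simps)
      also have "\<dots> = \<phi> x + \<phi> y"
        using D(1) E(1) unfolding \<phi>[OF xy(1) D] \<phi>[OF xy(2) E] by (simp add: add_frac_eq mult.commute)
      finally have "\<phi> (x + y) = \<phi> x + \<phi> y" .
      thus "\<phi> (x \<oplus>\<^bsub>ring_of_type_algebra\<lparr>carrier := ?K\<rparr>\<^esub> y) = \<phi> x \<oplus>\<^bsub>ring_of_type_algebra\<^esub> \<phi> y"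
        by (simp add: ring_of_type_algebra_def)
      have "of_nat (D * E) * (x * y) = (of_nat D * x) * (of_nat E * y)" by simp
      hence "of_nat (D * E) * (x * y) = ev (G * H) z" by (simp only: ev_simps D E)
      from \<phi>[OF gf_mult[OF xy] _ this] have "\<phi> (x * y) = \<phi> x * \<phi> y"
        using D E \<phi>[OF xy(1) D] \<phi>[OF xy(2) E] by (simp add: ev_simps)
      thus "\<phi> (x \<otimes>\<^bsub>ring_of_type_algebra\<lparr>carrier := ?K\<rparr>\<^esub> y) = \<phi> x \<otimes>\<^bsub>ring_of_type_algebra\<^esub> \<phi> y"
        by (simp add: ring_of_type_algebra_def)
    next
      show "\<phi> \<one>\<^bsub>ring_of_type_algebra\<lparr>carrier := ?K\<rparr>\<^esub> = \<one>\<^bsub>ring_of_type_algebra\<^esub>"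
        using \<phi>[OF gf_one, of 1 1] by (simp add: ring_of_type_algebra_def)
    qed (auto simp: \<phi>_def ring_of_type_algebra_def)
    moreover have "\<phi> z = c"
      using \<phi>[OF gf_incl, of z 1 "monom 1 1"] by (simp add: ev_simps)
    ultimately show "c \<in> (\<lambda>\<phi>. \<phi> z) ` embeddings ?K" by blast
  qed
qed

lemma field_norm_ev: "field_norm (gf {z}) (ev F z) = (\<Prod>j\<in>totatives n. ev F (z ^ j))"
proof -
  have "field_norm (gf {z}) (ev F z) = (\<Prod>\<phi>\<in>embeddings (gf {z}). ev F (\<phi> z))"
    unfolding field_norm_def by (intro prod.cong) (simp_all add: embeddings_ev)
  also have "\<dots> = (\<Prod>c\<in>{c::complex. primitive_root_of_unity n c}. ev F c)"
    by (rule prod.reindex_bij_betw[OF bij_betw_embeddings])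
  also have "\<dots> = (\<Prod>j\<in>totatives n. ev F (z ^ j))"
    by (rule prod.reindex_bij_betw[OF bij_betw_totatives_primitive[OF z n], symmetric])
  finally show ?thesis .
qed

text \<open>A relation at z holds at all its conjugates, which are all primitive n-th roots of
  unity. So \<open>idl (gens n)\<close> is the kernel of evaluation at z.\<close>

lemma ev_eq_0_imp_idl: assumes "ev F z = 0" shows "F \<in> idl (gens n)"
proof (rule vanish_primitive_imp_idl[OF n])
  fix c :: complex assume "primitive_root_of_unity n c"
  then obtain j where "j \<in> totatives n" "c = z ^ j"
    using bij_betw_totatives_primitive[OF z n] by (auto simp: bij_betw_def)
  thus "ev F c = 0" using galois_conj[OF n zn assms] by (auto simp: totatives_def)
qed

end

section \<open>Reduction modulo p\<close>

lemma diff_dvd_poly_diff: "a - b dvd poly F a - poly (F :: int poly) b"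
proof -
  have "[:- b, 1:] dvd F - [:poly F b:]" by (simp add: poly_eq_0_iff_dvd[symmetric])
  then obtain S where "F - [:poly F b:] = [:- b, 1:] * S" by (auto elim: dvdE)
  from arg_cong[OF this, of "\<lambda>P. poly P a"] have "poly F a - poly F b = (a - b) * poly S a"
    by (simp add: algebra_simps)
  thus ?thesis by simp
qed

text \<open>Linear factors are split off one at a time; since \<int>/p is a field, the incongruence
  of the roots passes the remaining ones on to the quotient. The last clause serves X^n - 1, which
  has as many roots modulo p as its degree.\<close>

lemma factor_mod_roots:
  fixes a :: "'i \<Rightarrow> int"
  assumes p: "Factorial_Ring.prime (p::nat)"
  shows "finite I \<Longrightarrow> (\<And>i. i \<in> I \<Longrightarrow> int p dvd poly F (a i)) \<Longrightarrow>
    (\<And>i j. i \<in> I \<Longrightarrow> j \<in> I \<Longrightarrow> i \<noteq> j \<Longrightarrow> \<not> int p dvd a i - a j) \<Longrightarrow>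
    \<exists>Q R. F = (\<Prod>i\<in>I. [:- a i, 1:]) * Q + of_nat p * R \<and>
      (lead_coeff F = 1 \<longrightarrow> degree F = card I \<longrightarrow> Q = 1)"
proof (induction I arbitrary: F rule: finite_induct)
  case empty
  have "F = 1" if "lead_coeff F = 1" "degree F = 0"
    using that by (metis degree_eq_zeroE lead_coeff_pCons(2) one_pCons degree_0_id coeff_pCons_0)
  thus ?case by (intro exI[of _ F] exI[of _ 0]) auto
next
  case (insert b I)
  obtain c where c: "poly F (a b) = int p * c" using insert.prems(1)[of b] by (auto elim: dvdE)
  have "[:- a b, 1:] dvd F - [:poly F (a b):]" by (simp add: poly_eq_0_iff_dvd[symmetric])
  then obtain S where S: "F - [:poly F (a b):] = [:- a b, 1:] * S" by (auto elim: dvdE)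
  have pint: "Factorial_Ring.prime (int p)" using p by simp
  have "int p dvd poly S (a i)" if i: "i \<in> I" for i
  proof -
    have "poly (F - [:poly F (a b):]) (a i) = (a i - a b) * poly S (a i)"
      unfolding S by (simp add: algebra_simps)
    moreover have "int p dvd poly (F - [:poly F (a b):]) (a i)"
      using insert.prems(1)[of i] insert.prems(1)[of b] i by (simp add: dvd_diff)
    ultimately have "int p dvd (a i - a b) * poly S (a i)" by simp
    moreover have "\<not> int p dvd a i - a b" using insert i by auto
    ultimately show ?thesis using pint by (simp add: prime_dvd_mult_iff)
  qed
  with insert obtain Q R where QR: "S = (\<Prod>i\<in>I. [:- a i, 1:]) * Q + of_nat p * R"
    "lead_coeff S = 1 \<Longrightarrow> degree S = card I \<Longrightarrow> Q = 1" by (metis (no_types, lifting) insertCI)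
  have "F = [:- a b, 1:] * S + of_nat p * [:c:]"
    using S c by (simp add: of_nat_poly algebra_simps)
  hence "F = (\<Prod>i\<in>insert b I. [:- a i, 1:]) * Q + of_nat p * ([:- a b, 1:] * R + [:c:])"
    using insert.hyps by (simp only: QR(1) prod.insert) (simp add: algebra_simps)
  moreover have "Q = 1" if F: "lead_coeff F = 1" "degree F = card (insert b I)"
  proof (rule QR(2))
    have dF: "degree (F - [:poly F (a b):]) = degree F"
      using F insert.hyps unfolding diff_conv_add_uminus by (intro degree_add_eq_left) auto
    have "S \<noteq> 0"
    proof
      assume "S = 0"
      hence "degree F = 0" using dF S by simp
      thus False using F insert.hyps by simp
    qed
    hence "degree ([:- a b, 1:] * S) = Suc (degree S)" by (subst degree_mult_eq) auto
    thus "degree S = card I" using dF S F insert.hyps by simp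
    have "lead_coeff (F - [:poly F (a b):]) = 1"
      using F insert.hyps unfolding dF by (simp add: coeff_pCons split: nat.split)
    thus "lead_coeff S = 1" unfolding S lead_coeff_mult by simp
  qed
  ultimately show ?case by blast
qed

text \<open>Modulo p, t is a primitive n-th root of unity, and the argument of
  \<open>ev_gens_primitive\<close> works in the field \<int>/p.\<close>

lemma poly_gens_mod:
  assumes p: "Factorial_Ring.prime (p::nat)" and n: "0 < n"
    and ord: "\<And>j. [int (t ^ j) = 1] (mod int p) \<longleftrightarrow> n dvd j" and G: "G \<in> gens n"
  shows "int p dvd poly G (int t)"
proof -
  have X: "int p dvd poly (Xm1 n) (int t)"
    using ord[of n] by (simp add: Xm1_def poly_monom cong_iff_dvd_diff)
  moreover have "int p dvd poly (Npoly n q) (int t)" if q: "q \<in> prime_factors n" for q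
  proof -
    have qn: "q dvd n" "Factorial_Ring.prime q" using q by (auto simp: in_prime_factors_iff)
    have "\<not> n dvd n div q"
    proof
      assume "n dvd n div q"
      moreover have "0 < n div q" using qn n by (auto elim!: dvdE)
      ultimately have "n \<le> n div q" by (rule dvd_imp_le)
      thus False using qn n prime_gt_1_nat[OF qn(2)] by (metis div_less_dividend not_less)
    qed
    hence "\<not> int p dvd poly (Xm1 (n div q)) (int t)"
      using ord[of "n div q"] by (simp add: Xm1_def poly_monom cong_iff_dvd_diff)
    moreover have "int p dvd poly (Npoly n q) (int t) * poly (Xm1 (n div q)) (int t)"
      using X by (simp add: Npoly_mult[OF qn(1)] flip: poly_mult)
    moreover have "Factorial_Ring.prime (int p)" using p by simp
    ultimately show ?thesis by (simp add: prime_dvd_mult_iff)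
  qed
  ultimately show ?thesis using G by (auto simp: gens_def)
qed

text \<open>Modulo \<open>p\<close> the primitive \<open>n\<close>-th roots of unity are the powers \<open>t\<^sup>j\<close> with \<open>j\<close> prime to \<open>n\<close>, so
  \<open>N \<alpha> = \<plusminus>p\<close> makes a conjugate of \<open>\<alpha>\<close> vanish at \<open>t\<close>, and this conjugate generates the prime
  \<open>(p, \<zeta>\<^sub>n - t)\<close>.\<close>

lemma prime_ideal_generator:
  assumes p: "Factorial_Ring.prime (p::nat)" and n: "0 < n" "coprime p n"
    and ord: "\<And>j. [int (t ^ j) = 1] (mod int p) \<longleftrightarrow> n dvd j"
    and \<alpha>: "\<alpha> \<in> cyclotomic_integers n"
    and norm: "field_norm (cyclotomic_field n) \<alpha> = of_nat p \<or> field_norm (cyclotomic_field n) \<alpha> = - of_nat p"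
  obtains f where "of_nat p \<in> idl (insert f (gens n))" "monom 1 1 - of_nat t \<in> idl (insert f (gens n))"
    "int p dvd poly f (int t)"
proof -
  define z where "z = cis (2 * pi / real n)"
  have z: "primitive_root_of_unity n z" unfolding z_def by (rule cis_primitive[OF n(1)])
  have zn: "z ^ n = 1" using z by (simp add: primitive_root_of_unity_def)
  have pint: "Factorial_Ring.prime (int p)" using p by simp
  define J where "J = totatives n"
  have J: "finite J" "1 \<in> J" "\<And>j. j \<in> J \<Longrightarrow> coprime j n \<and> 0 < j \<and> j \<le> n"
    using n by (auto simp: J_def totatives_def)
  obtain F where F: "\<alpha> = ev F z" using cyclotomic_integers_eq[OF n(1) \<alpha>] by (auto simp: z_def)
  obtain \<epsilon> :: int where \<epsilon>: "\<epsilon> = 1 \<or> \<epsilon> = -1" "field_norm (cyclotomic_field n) \<alpha> = of_int \<epsilon> * of_nat p"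
    using norm by (metis mult_1 mult_minus1 of_int_1 of_int_minus)
  have normF: "(\<Prod>j\<in>J. ev F (z ^ j)) = of_int \<epsilon> * of_nat p"
    using \<epsilon>(2) field_norm_ev[OF n(1) z, of F] by (simp add: J_def F cyclotomic_field_def z_def)
  note idl0 = ev_eq_0_imp_idl[OF n(1) z]
  have idl_t: "int p dvd poly x (int t)" if "x \<in> idl (gens n)" for x
    using that
  proof (induction rule: idl.induct)
    case (step s y r)
    thus ?case using poly_gens_mod[OF p n(1) ord] by simp
  qed auto
  \<comment> \<open>The norm relation is an identity of polynomials modulo \<open>gens n\<close>, so
    it may be evaluated at t modulo p, where it makes one factor vanish.\<close>
  have "ev ((\<Prod>j\<in>J. F \<circ>\<^sub>p monom 1 j) - of_int \<epsilon> * of_nat p) z = 0"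
    by (simp add: ev_simps normF)
  from idl_t[OF idl0[OF this]]
  have "int p dvd poly (\<Prod>j\<in>J. F \<circ>\<^sub>p monom 1 j) (int t) - \<epsilon> * int p"
    by (simp add: of_int_poly of_nat_poly mult.commute)
  hence "int p dvd poly (\<Prod>j\<in>J. F \<circ>\<^sub>p monom 1 j) (int t)"
    by (metis dvd_triv_right dvd_diffD diff_add_cancel dvd_add)
  hence "int p dvd (\<Prod>j\<in>J. poly F (int t ^ j))" by (simp add: poly_prod poly_pcompose poly_monom)
  then obtain k where k: "k \<in> J" "int p dvd poly F (int t ^ k)"
    using pint J(1) by (auto simp: prime_dvd_prod_iff)
  define f where "f = F \<circ>\<^sub>p monom 1 k"
  have ft: "int p dvd poly f (int t)" using k by (simp add: f_def poly_pcompose poly_monom)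
  have norm_f: "(\<Prod>j\<in>J. ev f (z ^ j)) = of_int \<epsilon> * of_nat p"
  proof -
    have zk: "primitive_root_of_unity n (z ^ k)"
      using primitive_power_iff_coprime[OF z n(1)] J(3)[OF k(1)] by simp
    have "(\<Prod>j\<in>J. ev f (z ^ j)) = (\<Prod>j\<in>J. ev F ((z ^ k) ^ j))"
      by (simp add: f_def ev_simps mult.commute flip: power_mult)
    also have "\<dots> = (\<Prod>c\<in>{c::complex. primitive_root_of_unity n c}. ev F c)"
      unfolding J_def by (rule prod.reindex_bij_betw[OF bij_betw_totatives_primitive[OF zk n(1)]])
    also have "\<dots> = (\<Prod>j\<in>J. ev F (z ^ j))"
      unfolding J_def by (rule prod.reindex_bij_betw[OF bij_betw_totatives_primitive[OF z n(1)], symmetric])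
    finally show ?thesis using normF by simp
  qed
  define g where "g = (\<Prod>j\<in>J - {1}. f \<circ>\<^sub>p monom 1 j)"
  have fg: "ev (f * g) z = of_int \<epsilon> * of_nat p"
    using prod.remove[OF J(1,2), of "\<lambda>j. ev f (z ^ j)"] norm_f by (simp add: g_def ev_simps)
  have \<epsilon>\<epsilon>: "\<epsilon> * \<epsilon> = 1" using \<epsilon>(1) by auto
  hence \<epsilon>\<epsilon>c: "of_int \<epsilon> * of_int \<epsilon> = (1::complex)" by (metis of_int_1 of_int_mult)
  have p_idl: "of_nat p \<in> idl (insert f (gens n))"
  proof -
    have "ev (of_nat p - of_int \<epsilon> * g * f) z = of_nat p - of_int \<epsilon> * ev (f * g) z" by (simp add: ev_simps mult_ac)
    also have "\<dots> = 0" unfolding fg using \<epsilon>\<epsilon>c by (simp add: mult.assoc[symmetric])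
    finally have "of_int \<epsilon> * g * f + (of_nat p - of_int \<epsilon> * g * f) \<in> idl (insert f (gens n))"
      by (intro idl_insertI idl0)
    thus ?thesis by simp
  qed
  define T where "T = insert (of_nat p) (gens n)"
  have pT: "of_nat p \<in> idl T" by (auto simp: T_def intro: idl_incl)
  have genT: "idl (gens n) \<subseteq> idl T" by (intro idl_mono) (auto simp: T_def)
  \<comment> \<open>g is the product of the other conjugates, so f(z) g(z) = \<plusminus>p. Once p
    divides h(z) in \<int>[z], comparison with this product shows that f(z) divides z - t. For this
    it suffices that h lies in the ideal of p and \<open>gens n\<close>.\<close>
  define h where "h = g * [:- int t, 1:]"
  define A where "A i = [:- (int t ^ i), 1:]" for i
  have t_cong: "[int t ^ i = int t ^ j] (mod int p) \<longleftrightarrow> [i = j] (mod n)" for i j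
  proof -
    have ord': "[int t ^ i = 1] (mod int p) \<longleftrightarrow> n dvd i" for i using ord[of i] by simp
    have co: "coprime (int t ^ i) (int p)" for i
    proof -
      have "[int t ^ n = 1] (mod int p)" by (simp add: ord')
      from cong_imp_coprime[OF cong_sym[OF this]] have "coprime (int t ^ n) (int p)" by simp
      hence "coprime (int t) (int p)" using n(1) by (simp add: coprime_power_left_iff)
      thus ?thesis by (simp add: coprime_power_left_iff)
    qed
    have *: "[int t ^ i = int t ^ j] (mod int p) \<longleftrightarrow> [i = j] (mod n)" if "i \<le> j" for i j
    proof -
      have "int t ^ j = int t ^ i * int t ^ (j - i)" using that by (simp flip: power_add)
      hence "[int t ^ i = int t ^ j] (mod int p) \<longleftrightarrow> [int t ^ i * 1 = int t ^ i * int t ^ (j - i)] (mod int p)" by simp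
      also have "\<dots> \<longleftrightarrow> [1 = int t ^ (j - i)] (mod int p)" using co[of i] by (rule cong_mult_lcancel)
      also have "\<dots> \<longleftrightarrow> n dvd j - i" using ord'[of "j - i"] by (simp add: cong_sym_eq)
      also have "\<dots> \<longleftrightarrow> [i = j] (mod n)" using that by (metis cong_altdef_nat cong_sym_eq)
      finally show ?thesis .
    qed
    show ?thesis using *[of i j] *[of j i] by (cases "i \<le> j") (auto simp: cong_sym_eq)
  qed
  have roots: "int p dvd poly h (int t ^ i)" if i: "i \<in> J" for i
  proof (cases "i = 1")
    case True
    thus ?thesis by (simp add: h_def)
  next
    case False
    have "coprime i n" using J(3)[OF i] by simp
    then obtain x where x: "[i * x = 1] (mod n)" using cong_solve_coprime_nat[of i n] by auto
    \<comment> \<open>The representative in {1..n} of the inverse of i, with n in place of 0. Then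
      f(X^j) is a factor of g, and at t^i it takes the value f(t^(ij)) \<equiv> f(t).\<close>
    define j where "j = (if x mod n = 0 then n else x mod n)"
    have jx: "[j = x] (mod n)" by (auto simp: j_def cong_def)
    have ij: "[i * j = 1] (mod n)" using cong_trans[OF cong_mult[OF cong_refl jx] x] .
    hence "coprime (i * j) n" using cong_imp_coprime[OF cong_sym[OF ij]] by simp
    hence "j \<in> J" using n by (auto simp: J_def totatives_def j_def less_imp_le split: if_splits)
    have "j \<noteq> 1"
    proof
      assume "j = 1"
      hence "[i = 1] (mod n)" using ij by simp
      hence "i mod n = 1 mod n" by (simp add: cong_def)
      thus False using False J(3)[OF i] mod_eq_imp_eq_pos[of i n 1] n(1) by simp
    qed
    have "[int t ^ (i * j) = int t ^ 1] (mod int p)" using ij by (simp only: t_cong)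
    hence "int p dvd int t ^ (i * j) - int t" by (simp add: cong_iff_dvd_diff)
    hence "int p dvd poly f (int t ^ (i * j)) - poly f (int t)"
      using diff_dvd_poly_diff by (rule dvd_trans)
    from dvd_add[OF this ft] have "int p dvd poly f (int t ^ (i * j))" by simp
    hence "int p dvd poly (f \<circ>\<^sub>p monom 1 j) (int t ^ i)"
      by (simp add: poly_pcompose poly_monom flip: power_mult)
    moreover have "poly (f \<circ>\<^sub>p monom 1 j) (int t ^ i) dvd poly g (int t ^ i)"
      unfolding g_def poly_prod using J(1) \<open>j \<in> J\<close> \<open>j \<noteq> 1\<close>
      by (intro dvd_prodI) auto
    ultimately have "int p dvd poly g (int t ^ i)" by (rule dvd_trans)
    thus ?thesis by (simp add: h_def)
  qed
  \<comment> \<open>The linear factors of the powers of t that are not primitive modulo p. H is a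
    unit modulo p and \<open>gens n\<close>: if X = t^i and a prime q divides i and n, then X^(n/q)
    is 1 and \<open>Npoly n q\<close> becomes q, which is prime to p.\<close>
  define H where "H = (\<Prod>i\<in>{1..n} - J. A i)"
  have "1 \<in> idl (insert H T)"
    unfolding H_def
  proof (rule idl_comaximal_prod)
    fix i assume i: "i \<in> {1..n} - J"
    hence "\<not> coprime i n" by (auto simp: J_def totatives_def)
    hence "gcd i n \<noteq> 1" by (simp only: coprime_iff_gcd_eq_1 not_False_eq_True)
    then obtain q where "Factorial_Ring.prime q" "q dvd gcd i n" using prime_factor_nat by blast
    hence q: "Factorial_Ring.prime q" "q dvd i" "q dvd n" by auto
    let ?I = "idl (insert (A i) T)"
    have TI: "idl T \<subseteq> ?I" by (intro idl_mono) auto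
    have "A i dvd monom 1 (n div q) - [:(int t ^ i) ^ (n div q):]"
      unfolding A_def by (simp add: poly_eq_0_iff_dvd[symmetric] poly_monom)
    hence 1: "monom 1 (n div q) - [:(int t ^ i) ^ (n div q):] \<in> ?I"
      by (rule idl_dvd[OF idl_incl, rotated]) simp
    have "n dvd i * (n div q)" using q by (auto elim!: dvdE)
    hence "[(int t ^ i) ^ (n div q) = 1] (mod int p)" using ord[of "i * (n div q)"] by (simp flip: power_mult)
    then obtain r where "(int t ^ i) ^ (n div q) - 1 = int p * r" by (auto simp: cong_iff_dvd_diff elim: dvdE)
    hence "[:(int t ^ i) ^ (n div q):] - 1 = of_nat p * [:r:]" by (simp add: of_nat_poly one_pCons)
    moreover have "of_nat p * [:r:] \<in> ?I" using TI idl_mult_right[OF pT] by blast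
    ultimately have 2: "[:(int t ^ i) ^ (n div q):] - 1 \<in> ?I" by (simp only:)
    have X: "Xm1 (n div q) \<in> ?I" using idl_add[OF 1 2] by (simp add: Xm1_def)
    have "Npoly n q \<in> ?I"
      using q n by (intro idl_incl) (auto simp: T_def gens_def in_prime_factors_iff)
    from idl_diff[OF this idl_dvd[OF X Xm1_dvd_Npoly_minus[of n q]]]
    have qI: "of_nat q \<in> ?I" by simp
    have "coprime p q" using coprime_divisors[OF dvd_refl q(3) n(2)] .
    moreover have "q \<noteq> 1" using q(1) by auto
    ultimately obtain x y where "p * x = q * y + 1" using coprime_bezout_nat by blast
    from arg_cong[OF this, of "of_nat :: nat \<Rightarrow> int poly"]
    have "1 = of_nat x * of_nat p - of_nat y * (of_nat q :: int poly)" by (simp add: algebra_simps)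
    also have "\<dots> \<in> ?I" using pT TI qI by (intro idl_diff idl_mult) auto
    finally show "1 \<in> ?I" .
  qed
  then obtain r y where ry: "1 = r * H + y" "y \<in> idl T" by (rule idl_insertE)
  have distinct: "\<not> int p dvd int t ^ i - int t ^ j" if "i \<in> {1..n}" "j \<in> {1..n}" "i \<noteq> j" for i j
  proof
    assume "int p dvd int t ^ i - int t ^ j"
    hence "[i = j] (mod n)" using t_cong[of i j] by (simp add: cong_iff_dvd_diff)
    thus False using that mod_eq_imp_eq_pos[of i n j] by (auto simp: cong_def)
  qed
  have AT: "(\<Prod>i\<in>{1..n}. A i) \<in> idl T"
  proof -
    have "int p dvd poly (Xm1 n) (int t ^ i)" for i
      using ord[of "i * n"] by (simp add: Xm1_def poly_monom cong_iff_dvd_diff flip: power_mult)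
    then obtain Q R where "Xm1 n = (\<Prod>i\<in>{1..n}. [:- (int t ^ i), 1:]) * Q + of_nat p * R"
      "lead_coeff (Xm1 n) = 1 \<longrightarrow> degree (Xm1 n) = card {1..n} \<longrightarrow> Q = 1"
      using factor_mod_roots[OF p, of "{1..n}" "Xm1 n" "\<lambda>i. int t ^ i"] distinct by auto
    hence "(\<Prod>i\<in>{1..n}. A i) = Xm1 n - of_nat p * R" using Xm1_monic[OF n(1)] by (simp add: A_def)
    also have "\<dots> \<in> idl T"
      by (intro idl_diff idl_mult_right pT) (auto simp: T_def gens_def intro: idl_incl)
    finally show ?thesis .
  qed
  \<comment> \<open>Modulo p, h is divisible by the linear factors of the primitive powers of t and
    H consists of the others; together they form X^n - 1.\<close>
  have "h * H \<in> idl T"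
  proof -
    have JS: "J \<subseteq> {1..n}"
    proof
      fix j assume "j \<in> J"
      from J(3)[OF this] show "j \<in> {1..n}" by simp
    qed
    have "\<exists>Q R. h = (\<Prod>i\<in>J. [:- (int t ^ i), 1:]) * Q + of_nat p * R \<and>
        (lead_coeff h = 1 \<longrightarrow> degree h = card J \<longrightarrow> Q = 1)"
    proof (rule factor_mod_roots[OF p J(1)])
      fix i j assume "i \<in> J" "j \<in> J" "i \<noteq> j"
      thus "\<not> int p dvd int t ^ i - int t ^ j" using JS by (intro distinct) auto
    qed (rule roots)
    then obtain Q R where QR: "h = (\<Prod>i\<in>J. [:- (int t ^ i), 1:]) * Q + of_nat p * R" by blast
    from JS
    have "(\<Prod>i\<in>{1..n}. A i) = (\<Prod>i\<in>J. A i) * H"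
      unfolding H_def using J(1) by (subst prod.subset_diff[of J "{1..n}"]) (auto simp: mult.commute)
    hence "h * H = (\<Prod>i\<in>{1..n}. A i) * Q + of_nat p * (R * H)"
      by (simp add: QR A_def algebra_simps)
    thus ?thesis using AT pT by (simp add: idl_add idl_mult_right)
  qed
  hence "r * (h * H) + h * y \<in> idl T" by (rule idl_add[OF idl_mult idl_mult[OF ry(2)]])
  moreover have "r * (h * H) + h * y = h * (r * H + y)" by (simp add: algebra_simps)
  ultimately have "h \<in> idl T" using ry(1) by simp
  then obtain Q w where Qw: "h = Q * of_nat p + w" "w \<in> idl (gens n)"
    unfolding T_def by (rule idl_insertE)
  have "ev w z = 0" using ev_idl_eq_0[OF Qw(2)] ev_gens_primitive[OF n(1) z] by blast
  hence hz: "ev g z * (z - of_nat t) = ev Q z * of_nat p"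
    using arg_cong[OF Qw(1), of "\<lambda>F. ev F z"] by (simp add: h_def ev_simps ev_pCons algebra_simps)
  have "of_int \<epsilon> * of_nat p * (z - of_nat t) = ev f z * (ev g z * (z - of_nat t))"
    unfolding fg[symmetric] ev_mult by (rule mult.assoc)
  also have "\<dots> = of_nat p * (ev f z * ev Q z)" by (simp add: hz)
  finally have "of_int \<epsilon> * (z - of_nat t) = ev f z * ev Q z" using prime_gt_0_nat[OF p] by simp
  hence "of_int \<epsilon> * (of_int \<epsilon> * (z - of_nat t)) = of_int \<epsilon> * (ev f z * ev Q z)" by simp
  hence "(of_int \<epsilon> * of_int \<epsilon>) * (z - of_nat t) = of_int \<epsilon> * ev Q z * ev f z" by (simp only: mult_ac)
  hence "z - of_nat t = of_int \<epsilon> * ev Q z * ev f z" by (simp only: \<epsilon>\<epsilon>c mult_1)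
  hence "ev (monom 1 1 - of_nat t - of_int \<epsilon> * Q * f) z = 0" by (simp add: ev_simps)
  hence "of_int \<epsilon> * Q * f + (monom 1 1 - of_nat t - of_int \<epsilon> * Q * f) \<in> idl (insert f (gens n))"
    by (intro idl_insertI idl0)
  hence "monom 1 1 - of_nat t \<in> idl (insert f (gens n))" by simp
  from that[OF p_idl this ft] show thesis .
qed

subsection \<open>Rationality\<close>

lemma rf_const_mult: "rf_const (a * b) = rf_const a * rf_const b"
  by (simp add: rf_const_def mult_single)

lemma rf_const_add: "rf_const (a + b) = rf_const a + rf_const b"
  by (simp add: rf_const_def single_add)

lemma rf_const_0 [simp]: "rf_const 0 = 0"
  by (simp add: rf_const_def Zero_fract_def)

lemma rf_const_1 [simp]: "rf_const 1 = 1"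
  by (simp add: rf_const_def One_fract_def)

lemma rf_const_power: "rf_const (a ^ i) = rf_const a ^ i"
  by (induction i) (auto simp: rf_const_mult)

lemma rf_const_of_nat: "rf_const (of_nat i) = of_nat i"
  by (induction i) (auto simp: rf_const_add)

lemma rf_const_of_nat_nonzero: "of_nat i \<noteq> (0::'k::field) \<Longrightarrow> of_nat i \<noteq> (0 :: ('g::linorder, 'k) ratfun)"
  using rf_const_eq_iff[of "of_nat i" "0::'k", where 'a = 'g] by (simp add: rf_const_of_nat)

lemma primitive_rf_const:
  assumes "primitive_root_of_unity m (w::'k::field)"
  shows "primitive_root_of_unity m (rf_const w :: ('g::linorder, 'k) ratfun)"
proof -
  have "rf_const w ^ j = (1 :: ('g, 'k) ratfun) \<longleftrightarrow> w ^ j = 1" for j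
    using rf_const_eq_iff[of "w ^ j" 1, where 'a = 'g] by (simp add: rf_const_power)
  thus ?thesis using assms by (simp add: primitive_root_of_unity_def)
qed

lemma (in fhom) map_poly_mult: "map_poly \<phi> (P * Q) = map_poly \<phi> P * map_poly \<phi> Q"
  by (intro poly_eqI) (simp add: coeff_map_poly coeff_mult hom_sum hom_mult)

lemma (in fhom) map_poly_prod: "map_poly \<phi> (\<Prod>i\<in>I. P i) = (\<Prod>i\<in>I. map_poly \<phi> (P i))"
  by (induction I rule: infinite_finite_induct) (auto simp: map_poly_mult)

text \<open>x(g) is a root of the product of all X - x(h). The group permutes the factors, so the
  coefficients of the product are fixed.\<close>

lemma rf_var_alg_noether_field:
  fixes G :: "'g::linorder monoid"
  assumes G: "group G" "finite (carrier G)" and g: "g \<in> carrier G"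
    and N: "noether_field G = gf (S :: ('g, 'k::field) ratfun set)"
  shows "alg S (rf_var g)"
proof -
  interpret G: group G by (rule G)
  define P :: "('g, 'k) ratfun poly" where "P = (\<Prod>h\<in>carrier G. [:- rf_var h, 1:])"
  have "P \<noteq> 0" unfolding P_def using G(2) by (subst prod_zero_iff) auto
  moreover have "poly P (rf_var g) = 0"
    unfolding P_def poly_prod using G(2) g by (subst prod_zero_iff) auto
  moreover have "Polynomial.coeff P i \<in> noether_field G" for i
    unfolding noether_field_altdef[OF G(1)]
  proof (intro CollectI conjI ballI)
    have "Polynomial.coeff (\<Prod>h\<in>I. [:- rf_var h, 1:]) i \<in> (group_ratfun_field G :: ('g, 'k) ratfun set)"
      if "I \<subseteq> carrier G" for I i
      using finite_subset[OF that G(2)] that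
    proof (induction I arbitrary: i rule: finite_induct)
      case (insert h I)
      have "rf_var h \<in> (group_ratfun_field G :: ('g, 'k) ratfun set)"
        using insert.prems by (auto simp: group_ratfun_field_def intro: gf_incl)
      thus ?case using insert unfolding group_ratfun_field_def
        by (auto simp: coeff_pCons split: nat.split intro!: gf_add gf_uminus gf_mult gf_diff)
    qed (auto simp: group_ratfun_field_def)
    thus "Polynomial.coeff P i \<in> group_ratfun_field G" by (simp add: P_def)
  next
    fix h assume h: "h \<in> carrier G"
    interpret fhom "gact G h :: ('g, 'k) ratfun \<Rightarrow> _" by (rule fhom_gact[OF G(1) h])
    have "bij_betw (\<lambda>g. h \<otimes>\<^bsub>G\<^esub> g) (carrier G) (carrier G)"
      using h by (simp add: bij_betw_def G.inj_on_cmult G.surj_const_mult)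
    have "map_poly (gact G h) P = (\<Prod>g\<in>carrier G. [:- rf_var (h \<otimes>\<^bsub>G\<^esub> g), 1:])"
      unfolding P_def map_poly_prod using h
      by (intro prod.cong) (auto simp: map_poly_pCons hom_uminus gact_var[OF G(1)])
    also have "\<dots> = P" unfolding P_def by (rule prod.reindex_bij_betw) fact
    finally have "map_poly (gact G h) P = P" .
    from arg_cong[OF this, of "\<lambda>P. Polynomial.coeff P i"]
    show "gact G h (Polynomial.coeff P i) = Polynomial.coeff P i" by (simp add: coeff_map_poly)
  qed
  ultimately show ?thesis unfolding alg_def N by blast
qed

text \<open>If \<open>|G|\<close> elements generate the fixed field, then they are a transcendence basis, because the
  whole field is algebraic over the fixed field and has transcendence degree \<open>|G|\<close>.\<close>

lemma purely_transcendental_noether_field: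
  fixes G :: "'g::linorder monoid"
  assumes G: "group G" "finite (carrier G)"
    and B: "finite B" "card B \<le> card (carrier G)"
      "noether_field G = gf (range rf_const \<union> (B :: ('g, 'k::field) ratfun set))"
  shows "purely_transcendental (range rf_const) (noether_field G :: ('g, 'k) ratfun set)"
proof -
  let ?k = "range rf_const :: ('g, 'k) ratfun set"
  define A where "A = (rf_var ` carrier G :: ('g, 'k) ratfun set)"
  have cardA: "card A = card (carrier G)"
    unfolding A_def by (intro card_image inj_onI) simp
  have A: "finite A" "\<And>x. x \<in> A \<Longrightarrow> \<not> alg (?k \<union> (A - {x})) x"
  proof -
    show "finite A" using G(2) by (simp add: A_def)
    fix x assume "x \<in> A"
    then obtain g where "x = rf_var g" by (auto simp: A_def)
    moreover have "A - {rf_var g} = rf_var ` (carrier G - {g})" by (auto simp: A_def)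
    ultimately show "\<not> alg (?k \<union> (A - {x})) x" using rf_var_not_alg[of "carrier G" g] by simp
  qed
  have alg: "alg (?k \<union> B) x" if "x \<in> A" for x
    using that rf_var_alg_noether_field[OF G _ B(3)] by (auto simp: A_def)
  have "\<not> alg (?k \<union> (B - {b})) b" if b: "b \<in> B" for b
  proof
    assume *: "alg (?k \<union> (B - {b})) b"
    have "alg (?k \<union> (B - {b})) y" if "y \<in> ?k \<union> B" for y
      using that * by (cases "y = b") (auto intro!: alg_gf gf_incl)
    hence "alg (?k \<union> (B - {b})) x" if "x \<in> A" for x using alg_trans[OF alg[OF that]] by blast
    hence "card A \<le> card (B - {b})" using B(1) by (intro steinitz_bound[OF A]) auto
    also have "\<dots> < card B" using b B(1) by (intro psubset_card_mono) auto
    finally show False using B(2) cardA by simp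
  qed
  hence "alg_independent ?k B" by (rule alg_independentI)
  moreover have "B \<subseteq> noether_field G" unfolding B(3) by (auto intro: gf_incl)
  ultimately show ?thesis unfolding purely_transcendental_def using B(3) by blast
qed

lemma ord_mod_prime:
  assumes p: "Factorial_Ring.prime (p::nat)" and t: "\<not> int p dvd t"
    and ord: "group.ord (units_of (residue_ring (int p))) (t mod int p) = n"
  shows "[int (nat (t mod int p) ^ j) = 1] (mod int p) \<longleftrightarrow> n dvd j"
proof -
  interpret residues_prime p "residue_ring (int p)"
    by unfold_locales (use p in auto)
  interpret U: group "units_of (residue_ring (int p))" by (rule units_group)
  have "coprime t (int p)" using p t by (metis coprime_commute prime_imp_coprime prime_nat_int_transfer)
  hence u: "t mod int p \<in> Units (residue_ring (int p))" by (rule mod_in_res_units[OF m_gt_one])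
  have "n dvd j \<longleftrightarrow> (t mod int p) [^]\<^bsub>units_of (residue_ring (int p))\<^esub> j = \<one>\<^bsub>units_of (residue_ring (int p))\<^esub>"
    using U.pow_eq_id[of "t mod int p" j] u ord by (simp add: units_of_carrier)
  also have "\<dots> \<longleftrightarrow> t ^ j mod int p = 1 mod int p"
    using u by (simp add: units_of_pow units_of_one pow_cong one_cong)
  also have "\<dots> \<longleftrightarrow> [t ^ j = 1] (mod int p)" by (simp add: cong_def)
  also have "\<dots> \<longleftrightarrow> [int (nat (t mod int p) ^ j) = 1] (mod int p)"
  proof -
    have "[t = int (nat (t mod int p))] (mod int p)"
      using prime_gt_0_nat[OF p] by (simp add: cong_def)
    from cong_pow[OF this, of j] show ?thesis
      by (metis cong_sym cong_trans of_nat_power)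
  qed
  finally show ?thesis by simp
qed

theorem theorem4p7:
  fixes p n :: nat and t :: int
    and \<alpha> :: complex
    and G :: "'g::linorder monoid"
  assumes "Factorial_Ring.prime p"
    and "0 < n"
    and "\<not> int p dvd t"
    and "group.ord (units_of (residue_ring (int p))) (t mod int p) = n"
    and "\<alpha> \<in> cyclotomic_integers n"
    and "field_norm (cyclotomic_field n) \<alpha> = of_nat p \<or>
         field_norm (cyclotomic_field n) \<alpha> = - of_nat p"
    and "group G"
    and "G \<cong> metacyclic_group p n t"
    and "contains_zeta TYPE('k::field) p"
    and "contains_zeta TYPE('k) n"
  shows "purely_transcendental (range rf_const) (noether_field G :: ('g, 'k) ratfun set)"
proof -
  note p = assms(1) and n = assms(2) and G = assms(7)
  interpret G: group G by (rule G)
  define r where "r = nat (t mod int p)"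
  have ord: "[int (r ^ j) = 1] (mod int p) \<longleftrightarrow> n dvd j" for j
    unfolding r_def by (rule ord_mod_prime[OF p assms(3,4)])
  have p1: "1 < p" using p by (rule prime_gt_1_nat)
  have ord_nat: "[r ^ j = 1] (mod p) \<longleftrightarrow> n dvd j" for j
    using ord[of j] by (metis cong_int_iff of_nat_1)
  have np: "n < p"
  proof -
    have "\<not> p dvd r"
    proof
      assume "p dvd r"
      hence "[r ^ n = 0] (mod p)" using n by (simp add: cong_0_iff dvd_power_le dvd_trans[OF _ dvd_power])
      moreover have "[r ^ n = 1] (mod p)" by (simp only: ord_nat dvd_refl)
      ultimately have "[0 = 1] (mod p)" by (metis cong_sym cong_trans)
      thus False using p1 by (simp add: cong_def)
    qed
    hence "[r ^ (p - 1) = 1] (mod p)" by (rule fermat_theorem[OF p])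
    hence "n dvd p - 1" by (simp only: ord_nat)
    hence "n \<le> p - 1" using p1 by (intro dvd_imp_le) auto
    thus ?thesis using p1 by simp
  qed
  have co: "coprime p n" using p np n by (meson nat_dvd_not_less prime_imp_coprime)
  obtain f where f: "of_nat p \<in> idl (insert f (gens n))" "monom 1 1 - of_nat r \<in> idl (insert f (gens n))"
    "int p dvd poly f (int r)"
    using prime_ideal_generator[OF p n co ord assms(5,6)] .
  have inv: "[int (r ^ (n - 1) * r) = 1] (mod int p)"
  proof -
    have "r ^ (n - 1) * r = r ^ n" using n by (simp flip: power_Suc2)
    thus ?thesis using ord[of n] by simp
  qed
  obtain \<sigma> \<tau> where \<sigma>\<tau>: "\<sigma> \<in> carrier G" "\<tau> \<in> carrier G" "\<sigma> [^]\<^bsub>G\<^esub> p = \<one>\<^bsub>G\<^esub>" "\<tau> [^]\<^bsub>G\<^esub> n = \<one>\<^bsub>G\<^esub>"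
    "\<sigma> \<otimes>\<^bsub>G\<^esub> \<tau> = \<tau> \<otimes>\<^bsub>G\<^esub> \<sigma> [^]\<^bsub>G\<^esub> r"
    and bij: "bij_betw (\<lambda>(i, j). \<sigma> [^]\<^bsub>G\<^esub> i \<otimes>\<^bsub>G\<^esub> \<tau> [^]\<^bsub>G\<^esub> j) ({..<p} \<times> {..<n}) (carrier G)"
    using metacyclic_structure[OF G assms(8) p1 n r_def inv ord] .
  have fin: "finite (carrier G)" and card: "card (carrier G) = p * n"
    using bij_betw_finite[OF bij] bij_betw_same_card[OF bij] by auto
  obtain zp zn :: 'k where zp: "primitive_root_of_unity p zp" and zn: "primitive_root_of_unity n zn"
    using assms(9,10) by (auto simp: contains_zeta_def)
  have char: "of_nat p \<noteq> (0::'k)" "of_nat n \<noteq> (0::'k)"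
    using assms(9,10) n p1 by (auto simp: contains_zeta_def of_nat_eq_0_iff_char_dvd)
  define \<zeta> where "\<zeta> = (rf_const zp :: ('g, 'k) ratfun)"
  have \<zeta>: "primitive_root_of_unity p \<zeta>" unfolding \<zeta>_def by (rule primitive_rf_const[OF zp])
  have \<zeta>p: "\<zeta> ^ p = 1" using \<zeta> by (simp add: primitive_root_of_unity_def)
  have \<zeta>0: "\<zeta> \<noteq> 0" using \<zeta>p p1 by (auto simp: power_0_left)
  let ?k = "range rf_const :: ('g, 'k) ratfun set"
  let ?L = "group_ratfun_field G :: ('g, 'k) ratfun set"
  define s where "s = (gact G \<sigma> :: ('g, 'k) ratfun \<Rightarrow> _)"
  define u where "u = (gact G \<tau> :: ('g, 'k) ratfun \<Rightarrow> _)"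
  interpret s: fhom s unfolding s_def by (rule fhom_gact[OF G \<sigma>\<tau>(1)])
  interpret u: fhom u unfolding u_def by (rule fhom_gact[OF G \<sigma>\<tau>(2)])
  define v where "v i j = (rf_var (\<sigma> [^]\<^bsub>G\<^esub> i \<otimes>\<^bsub>G\<^esub> \<tau> [^]\<^bsub>G\<^esub> j) :: ('g, 'k) ratfun)" for i j :: nat
  have s_v: "s (v i j) = v (Suc i) j" for i j
    unfolding s_def v_def using \<sigma>\<tau>(1,2)
    by (subst gact_var[OF G]) (simp_all add: G.m_assoc[symmetric] G.nat_pow_Suc2 del: G.nat_pow_Suc nat_pow_Suc)
  have s_pow: "(s ^^ i) (v 0 j) = v i j" for i j
    by (induction i) (simp_all add: s_v)
  have comm_pow: "\<sigma> [^]\<^bsub>G\<^esub> i \<otimes>\<^bsub>G\<^esub> \<tau> = \<tau> \<otimes>\<^bsub>G\<^esub> \<sigma> [^]\<^bsub>G\<^esub> (r * i)" for i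
  proof (induction i)
    case (Suc i)
    have "\<sigma> [^]\<^bsub>G\<^esub> Suc i \<otimes>\<^bsub>G\<^esub> \<tau> = \<sigma> [^]\<^bsub>G\<^esub> i \<otimes>\<^bsub>G\<^esub> (\<sigma> \<otimes>\<^bsub>G\<^esub> \<tau>)" using \<sigma>\<tau>(1,2) by (simp add: G.m_assoc)
    also have "\<dots> = (\<sigma> [^]\<^bsub>G\<^esub> i \<otimes>\<^bsub>G\<^esub> \<tau>) \<otimes>\<^bsub>G\<^esub> \<sigma> [^]\<^bsub>G\<^esub> r" using \<sigma>\<tau>(1,2) by (simp add: \<sigma>\<tau>(5) G.m_assoc)
    also have "\<dots> = \<tau> \<otimes>\<^bsub>G\<^esub> \<sigma> [^]\<^bsub>G\<^esub> (r * i + r)" using \<sigma>\<tau>(1,2) by (simp add: Suc G.m_assoc G.nat_pow_mult)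
    finally show ?case by (simp add: add.commute)
  qed (use \<sigma>\<tau>(1,2) in simp)
  have pow_mod: "\<sigma> [^]\<^bsub>G\<^esub> (i mod p) = \<sigma> [^]\<^bsub>G\<^esub> i" for i
  proof -
    have "\<sigma> [^]\<^bsub>G\<^esub> (p * (i div p) + i mod p) = \<sigma> [^]\<^bsub>G\<^esub> (i mod p)"
      using \<sigma>\<tau>(1) by (subst G.nat_pow_mult[symmetric]) (simp_all add: \<sigma>\<tau>(3) flip: G.nat_pow_pow)
    thus ?thesis by simp
  qed
  have u_v: "u (v (r * i mod p) j) = v i (Suc j)" for i j
  proof -
    have "\<tau> \<otimes>\<^bsub>G\<^esub> (\<sigma> [^]\<^bsub>G\<^esub> (r * i mod p) \<otimes>\<^bsub>G\<^esub> \<tau> [^]\<^bsub>G\<^esub> j) = \<sigma> [^]\<^bsub>G\<^esub> i \<otimes>\<^bsub>G\<^esub> (\<tau> \<otimes>\<^bsub>G\<^esub> \<tau> [^]\<^bsub>G\<^esub> j)"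
      using \<sigma>\<tau>(1,2) comm_pow[of i] by (simp add: pow_mod G.m_assoc[symmetric])
    also have "\<tau> \<otimes>\<^bsub>G\<^esub> \<tau> [^]\<^bsub>G\<^esub> j = \<tau> [^]\<^bsub>G\<^esub> Suc j" by (simp only: G.nat_pow_Suc2 \<sigma>\<tau>(2))
    finally show ?thesis unfolding u_def v_def using \<sigma>\<tau>(1,2) by (subst gact_var[OF G]) simp_all
  qed
  \<comment> \<open>The weight \<open>a * r ^ j\<close> comes from \<tau> sending x(\<sigma>^(ri)
    \<tau>^j) to x(\<sigma>^i \<tau>^(j+1)): reindexing the sum multiplies the weight by r.\<close>
  define Y where "Y a j = res s \<zeta> p (v 0 j) (a * r ^ j)" for a j
  have Y_alt: "Y a j = (\<Sum>i<p. \<zeta> ^ (a * r ^ j * (p - i)) * v i j)" for a j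
    by (simp add: Y_def res_def s_pow)
  have fix_k: "s c = c" "u c = c" if "c \<in> ?k" for c
    using that gact_const[OF G] \<sigma>\<tau>(1,2) by (auto simp: s_def u_def)
  have zeta_k: "\<zeta> \<in> ?k" by (simp add: \<zeta>_def)
  have v_period: "v p j = v 0 j" for j using \<sigma>\<tau>(3) by (simp add: v_def)
  have s_Y: "s (Y a j) = \<zeta> ^ (a * r ^ j) * Y a j" for a j
    unfolding Y_def by (rule s.res_eigen[OF \<zeta>p]) (simp_all add: fix_k zeta_k s_pow v_period)
  have \<zeta>_mod: "\<zeta> ^ i = \<zeta> ^ j" if "[i = j] (mod p)" for i j
    using power_mod_order[OF \<zeta>p, of i] power_mod_order[OF \<zeta>p, of j] that by (simp add: cong_def)
  have u_Y: "u (Y a j) = Y a (Suc j)" for a j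
  proof -
    have r_cop: "coprime r p"
    proof -
      have "[r ^ n = 1] (mod p)" by (simp only: ord_nat dvd_refl)
      from cong_imp_coprime[OF cong_sym[OF this]] have "coprime (r ^ n) p" by simp
      thus ?thesis using n by (simp add: coprime_power_left_iff)
    qed
    have "bij_betw (\<lambda>i. r * i mod p) {..<p} {..<p}"
    proof -
      have "inj_on (\<lambda>i. r * i mod p) {..<p}"
      proof (rule inj_onI)
        fix i j assume ij: "i \<in> {..<p}" "j \<in> {..<p}" "r * i mod p = r * j mod p"
        hence "[r * i = r * j] (mod p)" by (simp add: cong_def)
        hence "[i = j] (mod p)" using r_cop by (simp add: cong_mult_lcancel_nat)
        thus "i = j" using ij by (simp add: cong_def)
      qed
      moreover have "(\<lambda>i. r * i mod p) ` {..<p} \<subseteq> {..<p}" using p1 by auto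
      ultimately show ?thesis by (simp add: bij_betw_def endo_inj_surj)
    qed
    hence "Y a j = (\<Sum>i<p. \<zeta> ^ (a * r ^ j * (p - r * i mod p)) * v (r * i mod p) j)"
      unfolding Y_alt by (rule sum.reindex_bij_betw[symmetric])
    hence "u (Y a j) = (\<Sum>i<p. \<zeta> ^ (a * r ^ j * (p - r * i mod p)) * v i (Suc j))"
      by (simp add: u.hom_sum u.hom_mult u.hom_power fix_k zeta_k u_v)
    also have "\<dots> = Y a (Suc j)" unfolding Y_alt
    proof (intro sum.cong HOL.refl arg_cong2[where f = "(*)"])
      fix i assume i: "i \<in> {..<p}"
      define N where "N = a * r ^ j"
      have le: "r * i mod p \<le> p" using p1 by (simp add: less_imp_le)
      \<comment> \<open>Both powers of \<zeta> to be compared are inverse to \<zeta>^(N r i), hence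
        equal.\<close>
      have "\<zeta> ^ (N * (p - r * i mod p)) * \<zeta> ^ (N * (r * i mod p)) = 1"
      proof -
        have "N * (p - r * i mod p) + N * (r * i mod p) = p * N"
          using le by (simp flip: distrib_left add: mult.commute)
        thus ?thesis by (simp only: power_add[symmetric]) (simp add: power_mult \<zeta>p)
      qed
      moreover have "\<zeta> ^ (N * (r * i mod p)) = \<zeta> ^ (N * r * i)"
      proof (rule \<zeta>_mod)
        have "[r * i mod p = r * i] (mod p)" by (simp add: cong_def)
        from cong_mult[OF cong_refl[of N] this] show "[N * (r * i mod p) = N * r * i] (mod p)"
          by (simp add: mult.assoc)
      qed
      moreover have "\<zeta> ^ (N * r * (p - i)) * \<zeta> ^ (N * r * i) = 1"
      proof -
        have "N * r * (p - i) + N * r * i = p * (N * r)"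
          using i by (simp only: add_mult_distrib2[symmetric]) (simp add: mult.commute)
        thus ?thesis by (simp only: power_add[symmetric]) (simp add: power_mult \<zeta>p)
      qed
      moreover have "\<zeta> ^ (N * r * i) \<noteq> 0" using \<zeta>0 by simp
      ultimately have "\<zeta> ^ (N * (p - r * i mod p)) = \<zeta> ^ (N * r * (p - i))"
        by (metis mult_right_cancel)
      thus "\<zeta> ^ (a * r ^ j * (p - r * i mod p)) = \<zeta> ^ (a * r ^ Suc j * (p - i))"
        by (simp add: N_def mult_ac)
    qed
    finally show ?thesis .
  qed
  have Y_n: "Y a n = Y a 0" for a
    unfolding Y_alt
  proof (intro sum.cong HOL.refl arg_cong2[where f = "(*)"] \<zeta>_mod)
    fix i
    have "[a * r ^ n * (p - i) = a * 1 * (p - i)] (mod p)"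
      using ord_nat[of n] by (intro cong_mult cong_refl) simp
    thus "[a * r ^ n * (p - i) = a * r ^ 0 * (p - i)] (mod p)" by simp
    show "v i n = v i 0" using \<sigma>\<tau>(4) by (simp add: v_def)
  qed
  have normal_form: "\<exists>i<p. \<exists>j<n. g = \<sigma> [^]\<^bsub>G\<^esub> i \<otimes>\<^bsub>G\<^esub> \<tau> [^]\<^bsub>G\<^esub> j" if "g \<in> carrier G" for g
  proof -
    have "g \<in> (\<lambda>(i, j). \<sigma> [^]\<^bsub>G\<^esub> i \<otimes>\<^bsub>G\<^esub> \<tau> [^]\<^bsub>G\<^esub> j) ` ({..<p} \<times> {..<n})"
      using that bij_betw_imp_surj_on[OF bij] by simp
    thus ?thesis by auto
  qed
  have L: "?L = gf (?k \<union> {Y a j |a j. a < p \<and> j < n})"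
  proof
    have v_L: "v i j \<in> ?L" for i j
      unfolding v_def group_ratfun_field_def using \<sigma>\<tau>(1,2) by (intro gf_incl) auto
    have "Y a j \<in> ?L" for a j
      using v_L zeta_k unfolding Y_alt group_ratfun_field_def
      by (intro gf_sum gf_mult gf_power) (auto intro: gf_incl)
    thus "gf (?k \<union> {Y a j |a j. a < p \<and> j < n}) \<subseteq> ?L"
      unfolding group_ratfun_field_def by (intro gf_least) (auto intro: gf_incl)
    have v_Y: "v i j \<in> gf (?k \<union> {Y a j |a j. a < p \<and> j < n})" if ij: "i < p" "j < n" for i j
    proof -
      have "(s ^^ i) (v 0 j) \<in> gf (?k \<union> {Y a j |a j. a < p \<and> j < n})"
      proof (rule res_inversion_gf[OF \<zeta> _ ij(1)])
        fix c assume c: "c < p"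
        \<comment> \<open>\<open>r ^ (n - 1)\<close> inverts r modulo p, so this a solves a r^j
          \<equiv> c, and every resolvent of x(\<tau>^j) occurs among the Y a j.\<close>
        define a where "a = c * r ^ ((n - 1) * j) mod p"
        have "[a * r ^ j = c * r ^ ((n - 1) * j) * r ^ j] (mod p)"
          unfolding a_def by (intro cong_mult cong_refl) (simp add: cong_def)
        also have "c * r ^ ((n - 1) * j) * r ^ j = c * r ^ (n * j)"
          using n by (cases n) (simp_all add: mult.assoc power_add[symmetric] add.commute)
        also have "[\<dots> = c * 1] (mod p)"
          using ord_nat[of "n * j"] by (intro cong_mult cong_refl) simp
        finally have "[a * r ^ j = c] (mod p)" by simp
        hence "\<zeta> ^ (c * (p - i)) = \<zeta> ^ (a * r ^ j * (p - i))" for i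
          by (intro \<zeta>_mod cong_mult cong_refl) (simp add: cong_sym)
        hence "res s \<zeta> p (v 0 j) c = Y a j" by (simp add: res_def Y_def)
        moreover have "a < p" using p1 by (simp add: a_def)
        ultimately show "res s \<zeta> p (v 0 j) c \<in> gf (?k \<union> {Y a j |a j. a < p \<and> j < n})"
          using ij(2) by (intro gf_incl) auto
      qed (use zeta_k rf_const_of_nat_nonzero[OF char(1)] in \<open>auto intro: gf_incl\<close>)
      thus ?thesis by (simp add: s_pow)
    qed
    have "rf_var g \<in> gf (?k \<union> {Y a j |a j. a < p \<and> j < n})" if "g \<in> carrier G" for g
    proof -
      obtain i j where "i < p" "j < n" "g = \<sigma> [^]\<^bsub>G\<^esub> i \<otimes>\<^bsub>G\<^esub> \<tau> [^]\<^bsub>G\<^esub> j"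
        using normal_form \<open>g \<in> carrier G\<close> by blast
      thus ?thesis using v_Y[of i j] by (simp add: v_def)
    qed
    thus "?L \<subseteq> gf (?k \<union> {Y a j |a j. a < p \<and> j < n})"
      unfolding group_ratfun_field_def by (intro gf_least) (auto intro: gf_incl)
  qed
  \<comment> \<open>The p n variables x(g) are algebraically independent, so by Steinitz fewer
    elements cannot generate L over k.\<close>
  have min_gens: "p * n \<le> card B" if B: "finite B" "?L \<subseteq> gf (?k \<union> B)" for B
  proof -
    define A where "A = (rf_var ` carrier G :: ('g, 'k) ratfun set)"
    have "card A = p * n" unfolding A_def card[symmetric] by (intro card_image inj_onI) simp
    moreover have "card A \<le> card B"
    proof (rule steinitz_bound[OF _ _ B(1)])
      show "finite A" using fin by (simp add: A_def)
      fix x assume x: "x \<in> A"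
      then obtain g where g: "x = rf_var g" "g \<in> carrier G" by (auto simp: A_def)
      moreover have "A - {rf_var g} = rf_var ` (carrier G - {g})" by (auto simp: A_def)
      ultimately show "\<not> alg (?k \<union> (A - {x})) x" using rf_var_not_alg[of "carrier G" g] by simp
      have "x \<in> ?L" unfolding group_ratfun_field_def using g by (intro gf_incl) auto
      thus "alg (?k \<union> B) x" using B(2) by (intro alg_gf) auto
    qed
    ultimately show ?thesis by simp
  qed
  interpret M: metacyclic_field s u ?k ?L \<zeta> "rf_const zn" Y p n r f
  proof (unfold_locales, goal_cases)
    case (1 c) thus ?case by (rule fix_k)
  next
    case (2 c) thus ?case by (rule fix_k)
  next
    case 3 show ?case by (rule \<zeta>)
  next
    case 4 show ?case by (rule zeta_k)
  next
    case 5 show ?case by (rule rf_const_of_nat_nonzero[OF char(1)])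
  next
    case 6 show ?case by (rule primitive_rf_const[OF zn])
  next
    case 7 show ?case by simp
  next
    case 8 show ?case by (rule rf_const_of_nat_nonzero[OF char(2)])
  next
    case (12 q) show ?case by (rule poly_gens_mod[OF p n ord]) (use 12 in \<open>auto simp: gens_def\<close>)
  next
    case 13 show ?case by (rule poly_gens_mod[OF p n ord]) (simp add: gens_def)
  qed (fact p n np f u_Y Y_n s_Y L min_gens)+
  obtain B where B: "finite B" "card B \<le> p * n" "{x \<in> ?L. s x = x \<and> u x = x} = gf (?k \<union> B)"
    using M.fixed_field_generators by blast
  have "{x \<in> ?L. s x = x \<and> u x = x} = noether_field G"
  proof -
    \<comment> \<open>Invariance under \<sigma> and \<tau> spreads to all of G through the normal
      form of its elements.\<close>
    have "gact G h x = x" if x: "x \<in> ?L" "s x = x" "u x = x" and h: "h \<in> carrier G" for x h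
    proof -
      have pow: "gact G (a [^]\<^bsub>G\<^esub> (i::nat)) x = x" if "a \<in> carrier G" "gact G a x = x" for a i
      proof (induction i)
        case 0
        show ?case using gact_one[OF G x(1)] by simp
      next
        case (Suc i)
        have "gact G (a [^]\<^bsub>G\<^esub> Suc i) x = gact G (a [^]\<^bsub>G\<^esub> i) (gact G a x)"
          using gact_mult[OF G _ that(1) x(1), of "a [^]\<^bsub>G\<^esub> i"] that(1) by simp
        thus ?case using Suc that by simp
      qed
      obtain i j where "h = \<sigma> [^]\<^bsub>G\<^esub> (i::nat) \<otimes>\<^bsub>G\<^esub> \<tau> [^]\<^bsub>G\<^esub> (j::nat)"
        using normal_form h by blast
      hence "gact G h x = gact G (\<sigma> [^]\<^bsub>G\<^esub> i) (gact G (\<tau> [^]\<^bsub>G\<^esub> j) x)"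
        using gact_mult[OF G _ _ x(1)] \<sigma>\<tau>(1,2) by simp
      moreover have "gact G \<sigma> x = x" "gact G \<tau> x = x" using x(2,3) unfolding s_def u_def .
      ultimately show ?thesis using pow \<sigma>\<tau>(1,2) by simp
    qed
    thus ?thesis unfolding noether_field_altdef[OF G] s_def u_def using \<sigma>\<tau>(1,2) by auto
  qed
  with B show ?thesis
    by (intro purely_transcendental_noether_field[OF G fin, of B]) (simp_all add: card)
qed

end
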